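(* Assume that $b,f$ are $\mathbb{F}$-progressively measurable and bounded, $\xi$ is $\mathcal{F}_T$-measurable and bounded, and that $b,f$ are uniformly continuous in $(t,\omega)$ under $\mathbf{d}$ and $\xi$ is uniformly continuous in $\omega$ under $\|\cdot\|$, with a common modulus of continuity function $\rho_0$. Then for any $\varepsilon>0$, any $\mathbb{F}$-stopping time $\tau$ (with values in $[0,T]$) and any $\mathcal{F}_\tau$-measurable $\eta:\Omega\to\mathbb{R}^N$, the events $$\{\omega\in\Omega:\eta(\omega)\in\hat{\mathbb{V}}_\varepsilon(\tau(\omega),\omega)\}\quad\text{and}\quad\{\omega\in\Omega:\eta(\omega)\in\mathbb{V}(\tau(\omega),\omega)\}$$ are $\mathcal{F}_\tau$-measurable.
   Context: Continuous-time game on canonical space. $\Omega=\{\omega\in C([0,T];\mathbb{R}^d):\omega_0=0\}$, $B_t(\omega)=\omega_t$ the canonical process, $\mathbb{P}_0$ the Wiener measure, $\mathbb{F}=\{\mathcal{F}_t\}_{0\le t\le T}$ the $\mathbb{P}_0$-augmented filtration generated by $B$. $\|\omega\|=\sup_{0\le t\le T}|\omega_t|$ and $\mathbf{d}((t,\omega),(\tilde t,\tilde\omega))=\sqrt{|t-\tilde t|}+\|\omega_{t\wedge\cdot}-\tilde\omega_{\tilde t\wedge\cdot}\|$. There are $N$ players; $A=A_1\times\cdots\times A_N$ is a convex domain in a Euclidean space; $\mathcal{A}=\mathcal{A}_1\times\cdots\times\mathcal{A}_N$ is the set of $\mathbb{F}$-progressively measurable $A$-valued processes. Data: $(b,f):[0,T]\times\Omega\times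 A\to\mathbb{R}^d\times\mathbb{R}^N$ (jointly measurable in $a$ as well), where $f_i$ depends on $a$ only through $a_i\in A_i$, and $\xi:\Omega\to\mathbb{R}^N$. The modulus $\rho_0$ in $(t,\omega)$ is uniform in $a$. Concatenation: $(\omega\otimes_t\tilde\omega)_s=\omega_s$ for $s\in[0,t]$ and $=\omega_t+\tilde\omega_{s-t}$ for $s\in[t,T]$. Shifts: $\xi^{t,\omega}(\tilde\omega)=\xi(\omega\otimes_t\tilde\omega)$, and $b^{t,\omega}(s,\tilde\omega,a)=b(t+s,\omega\otimes_t\tilde\omega,a)$, similarly $f^{t,\omega}_i$. For $(t,\omega)\in[0,T]\times\Omega$ and $\alpha\in\mathcal{A}$ define $\frac{d\mathbb{P}^{t,\omega,\alpha}}{d\mathbb{P}_0}=\exp\big(\int_0^{T-t}b^{t,\omega}(s,B,\alpha_s)\cdot dB_s-\frac12\int_0^{T-t}|b^{t,\omega}(s,B,\alpha_s)|^2ds\big)$ and $J_i(t,\omega,\alpha)=\mathbb{E}^{\mathbb{P}^{t,\omega,\alpha}}\big[\xi_i^{t,\omega}(B)+\int_0^{T-t}f_i^{t,\omega}(s,B,\alpha^i_s)ds\big]$, $J=(J_1,\dots,J_N)$. For $\varepsilon>0$, $\alpha^\varepsilon\in\mathcal{A}$ is an $\varepsilon$-equilibrium at $(t,\omega)$, written $\alpha^\varepsilon\in NE_\varepsilon(t,\omega)$, if $J_i(t,\omega,\alpha^\varepsilon)\le J_i(t,\omega,\alpha^{\varepsilon,-i},\alpha^i)+\varepsilon$ for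 all $i$ and all $\alpha^i\in\mathcal{A}_i$, where $(\alpha^{\varepsilon,-i},\alpha^i)$ is $\alpha^\varepsilon$ with $i$-th component replaced by $\alpha^i$. With $O_\varepsilon(y)=\{\tilde y\in\mathbb{R}^N:|\tilde y-y|<\varepsilon\}$, define $\mathbb{V}_\varepsilon(t,\omega)=\bigcup_{\alpha^\varepsilon\in NE_\varepsilon(t,\omega)}O_\varepsilon(J(t,\omega,\alpha^\varepsilon))$, $\mathbb{V}(t,\omega)=\bigcap_{\varepsilon>0}\mathbb{V}_\varepsilon(t,\omega)$, and $\hat{\mathbb{V}}_\varepsilon(t,\omega)=\bigcup_{0<\varepsilon'<\varepsilon}\mathbb{V}_{\varepsilon'}(t,\omega)$. *)

theory Defs
  imports "HOL-Probability.Probability"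
begin

section \<open>Canonical space, Wiener measure and augmented filtration\<close>

text \<open>A path on \<open>[0,T]\<close> is a function on \<open>real\<close> that is \<^const>\<open>undefined\<close> outside \<open>{0..T}\<close>,
  so that equality of paths is equality on \<open>[0,T]\<close>. The canonical process is \<open>B\<^sub>t(\<omega>) = \<omega> t\<close>.\<close>

definition path_space :: "real \<Rightarrow> (real \<Rightarrow> real ^ 'd) set" where
  "path_space T = {\<omega> \<in> extensional {0..T}. continuous_on {0..T} \<omega> \<and> \<omega> 0 = 0}"

definition path_norm :: "real \<Rightarrow> (real \<Rightarrow> real ^ 'd) \<Rightarrow> real" where
  "path_norm T \<omega> = (SUP s\<in>{0..T}. norm (\<omega> s))"

definition path_dist ::
    "real \<Rightarrow> real \<times> (real \<Rightarrow> real ^ 'd) \<Rightarrow> real \<times> (real \<Rightarrow> real ^ 'd) \<Rightarrow> real" where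
  "path_dist T = (\<lambda>(t, \<omega>) (t', \<omega>').
     sqrt \<bar>t - t'\<bar> + path_norm T (\<lambda>s. \<omega> (min t s) - \<omega>' (min t' s)))"

text \<open>The filtrations are indexed by all reals, to fit \<^const>\<open>stopping_time\<close> and
  \<^const>\<open>filtration.pre_sigma\<close>: they are constant from \<open>T\<close> on, and no coordinate contributes
  at negative times. For stopping times with values in \<open>[0,T]\<close> only times in \<open>[0,T]\<close> matter.\<close>

definition raw_filtration :: "real \<Rightarrow> real \<Rightarrow> (real \<Rightarrow> real ^ 'd) measure" where
  "raw_filtration T t = sigma (path_space T)
     {(\<lambda>\<omega>. \<omega> s) -` U \<inter> path_space T | s U. s \<in> {0..T} \<and> s \<le> t \<and> U \<in> sets borel}"

definition wiener_measure :: "real \<Rightarrow> (real \<Rightarrow> real ^ 'd) measure \<Rightarrow> bool" where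
  "wiener_measure T W \<longleftrightarrow>
     prob_space W \<and> space W = path_space T \<and> sets W = sets (raw_filtration T T) \<and>
     (\<forall>s t. 0 \<le> s \<and> s < t \<and> t \<le> T \<longrightarrow>
        distributed W lborel (\<lambda>\<omega>. \<omega> t - \<omega> s)
          (\<lambda>x. ennreal (\<Prod>j\<in>UNIV. normal_density 0 (sqrt (t - s)) (x $ j))) \<and>
        prob_space.indep_set W (sets (raw_filtration T s))
          {(\<lambda>\<omega>. \<omega> t - \<omega> s) -` U \<inter> path_space T | U. U \<in> sets borel})"

text \<open>The null sets of the completion are all subsets of \<open>W\<close>-null sets.\<close>

definition aug_filtration ::
    "real \<Rightarrow> (real \<Rightarrow> real ^ 'd) measure \<Rightarrow> real \<Rightarrow> (real \<Rightarrow> real ^ 'd) measure" where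
  "aug_filtration T W t =
     sigma (path_space T) (sets (raw_filtration T t) \<union> null_sets (completion W))"

lemma space_raw_filtration: "space (raw_filtration T t) = path_space T"
  unfolding raw_filtration_def by (rule space_measure_of) auto

lemma space_aug_filtration:
  assumes "space W = path_space T"
  shows "space (aug_filtration T W t) = path_space T"
  unfolding aug_filtration_def
proof (rule space_measure_of)
  show "sets (raw_filtration T t) \<union> null_sets (completion W) \<subseteq> Pow (path_space T)"
    using sets.space_closed[of "raw_filtration T t"] sets.space_closed[of "completion W"] assms
    by (auto simp: space_raw_filtration null_sets_def)
qed

lemma filtration_aug_filtration:
  assumes "space W = path_space T"
  shows "filtration (path_space T) (aug_filtration T W)"
proof
  show "space (aug_filtration T W t) = path_space T" for t
    using assms by (rule space_aug_filtration)
  show "sets (aug_filtration T W s) \<subseteq> sets (aug_filtration T W t)" if "s \<le> t" for s t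
  proof -
    have "sets (raw_filtration T s) \<subseteq> sets (raw_filtration T t)"
      unfolding raw_filtration_def using that
      by (subst (1 2) sets_measure_of) (auto intro!: sigma_sets_mono', force)
    moreover have "sets (raw_filtration T r) \<union> null_sets (completion W) \<subseteq> Pow (path_space T)" for r
      using sets.space_closed[of "raw_filtration T r"] sets.space_closed[of "completion W"] assms
      by (auto simp: space_raw_filtration null_sets_def)
    ultimately show ?thesis
      unfolding aug_filtration_def
      by (subst (1 2) sets_measure_of) (auto intro!: sigma_sets_mono')
  qed
qed

text \<open>For a stopping time \<open>\<tau>\<close> these are the sets \<open>E\<close> with \<open>E \<inter> {\<tau> \<le> t} \<in> \<F>\<^sub>t\<close> for all \<open>t\<close>;
  if \<open>\<tau> \<le> T\<close>, the instance \<open>t = T\<close> says \<open>E \<in> \<F>\<^sub>T\<close>.\<close>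

abbreviation stopped_algebra ::
    "real \<Rightarrow> (real \<Rightarrow> real ^ 'd) measure \<Rightarrow> ((real \<Rightarrow> real ^ 'd) \<Rightarrow> real) \<Rightarrow> (real \<Rightarrow> real ^ 'd) measure" where
  "stopped_algebra T W \<tau> \<equiv> filtration.pre_sigma (path_space T) (aug_filtration T W) \<tau>"


section \<open>Progressive measurability and the Ito integral\<close>

definition prog_measurable ::
    "real \<Rightarrow> (real \<Rightarrow> real ^ 'd) measure \<Rightarrow> 'a::topological_space set
      \<Rightarrow> (real \<Rightarrow> (real \<Rightarrow> real ^ 'd) \<Rightarrow> 'a) \<Rightarrow> bool" where
  "prog_measurable T W S X \<longleftrightarrow>
     (\<forall>t\<in>{0..T}. (\<lambda>(s, \<omega>). X s \<omega>)
        \<in> restrict_space borel {0..t} \<Otimes>\<^sub>M aug_filtration T W t \<rightarrow>\<^sub>M restrict_space borel S)"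

text \<open>Progressive measurability of a coefficient that also depends, jointly measurably, on an
  action in \<open>S\<close>.\<close>

definition prog_measurable_coeff ::
    "real \<Rightarrow> (real \<Rightarrow> real ^ 'd) measure \<Rightarrow> 'a::topological_space set
      \<Rightarrow> (real \<Rightarrow> (real \<Rightarrow> real ^ 'd) \<Rightarrow> 'a \<Rightarrow> 'b::topological_space) \<Rightarrow> bool" where
  "prog_measurable_coeff T W S g \<longleftrightarrow>
     (\<forall>t\<in>{0..T}. (\<lambda>(s, \<omega>, a). g s \<omega> a)
        \<in> restrict_space borel {0..t} \<Otimes>\<^sub>M aug_filtration T W t \<Otimes>\<^sub>M restrict_space borel S
          \<rightarrow>\<^sub>M borel)"

text \<open>Simple integrands on \<open>[0,u]\<close>: \<open>\<Sum>k<n. \<phi>\<^sub>k 1\<^bsub>(r\<^sub>k, r\<^sub>k\<^sub>+\<^sub>1]\<^esub>\<close> with \<open>\<phi>\<^sub>k\<close> bounded and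
  \<open>\<F>\<close>-measurable at time \<open>r\<^sub>k\<close>.\<close>

definition simple_integrand ::
    "real \<Rightarrow> (real \<Rightarrow> real ^ 'd) measure \<Rightarrow> real
      \<Rightarrow> nat \<Rightarrow> (nat \<Rightarrow> real) \<Rightarrow> (nat \<Rightarrow> (real \<Rightarrow> real ^ 'd) \<Rightarrow> real ^ 'd) \<Rightarrow> bool" where
  "simple_integrand T W u n r \<phi> \<longleftrightarrow>
     (\<forall>k<n. 0 \<le> r k \<and> r k \<le> r (Suc k) \<and> r (Suc k) \<le> u \<and>
        \<phi> k \<in> borel_measurable (aug_filtration T W (r k)) \<and> bounded (\<phi> k ` path_space T))"

definition simple_process ::
    "nat \<Rightarrow> (nat \<Rightarrow> real) \<Rightarrow> (nat \<Rightarrow> (real \<Rightarrow> real ^ 'd) \<Rightarrow> real ^ 'd)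
      \<Rightarrow> real \<Rightarrow> (real \<Rightarrow> real ^ 'd) \<Rightarrow> real ^ 'd" where
  "simple_process n r \<phi> s \<omega> = (\<Sum>k<n. indicator {r k<..r (Suc k)} s *\<^sub>R \<phi> k \<omega>)"

definition simple_integral ::
    "nat \<Rightarrow> (nat \<Rightarrow> real) \<Rightarrow> (nat \<Rightarrow> (real \<Rightarrow> real ^ 'd) \<Rightarrow> real ^ 'd)
      \<Rightarrow> (real \<Rightarrow> real ^ 'd) \<Rightarrow> real" where
  "simple_integral n r \<phi> \<omega> = (\<Sum>k<n. \<phi> k \<omega> \<bullet> (\<omega> (r (Suc k)) - \<omega> (r k)))"

text \<open>\<open>X\<close> is a version of \<open>\<integral>\<^sub>0\<^sup>u H\<^sub>s \<bullet> dB\<^sub>s\<close>, for square-integrable \<open>H\<close>: the \<open>L\<^sup>2\<close>-limit of the integrals of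
  simple integrands that converge to \<open>H\<close> in \<open>L\<^sup>2(ds \<otimes> W)\<close>.\<close>

definition has_ito_integral ::
    "real \<Rightarrow> (real \<Rightarrow> real ^ 'd) measure \<Rightarrow> real \<Rightarrow> (real \<Rightarrow> (real \<Rightarrow> real ^ 'd) \<Rightarrow> real ^ 'd)
      \<Rightarrow> ((real \<Rightarrow> real ^ 'd) \<Rightarrow> real) \<Rightarrow> bool" where
  "has_ito_integral T W u H X \<longleftrightarrow>
     X \<in> borel_measurable (completion W) \<and>
     (\<exists>n r \<phi>. (\<forall>m. simple_integrand T W u (n m) (r m) (\<phi> m)) \<and>
        (\<lambda>m. \<integral>\<^sup>+\<omega>. (\<integral>\<^sup>+s\<in>{0..u}.
             ennreal ((norm (H s \<omega> - simple_process (n m) (r m) (\<phi> m) s \<omega>))\<^sup>2) \<partial>lborel)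
           \<partial>completion W) \<longlonglongrightarrow> 0 \<and>
        (\<lambda>m. \<integral>\<^sup>+\<omega>. ennreal ((X \<omega> - simple_integral (n m) (r m) (\<phi> m) \<omega>)\<^sup>2)
           \<partial>completion W) \<longlonglongrightarrow> 0)"

text \<open>The integral is determined up to \<open>W\<close>-null sets only; below it enters solely through a
  density with respect to \<open>W\<close>, for which the choice of version is irrelevant.\<close>

definition ito_integral ::
    "real \<Rightarrow> (real \<Rightarrow> real ^ 'd) measure \<Rightarrow> real \<Rightarrow> (real \<Rightarrow> (real \<Rightarrow> real ^ 'd) \<Rightarrow> real ^ 'd)
      \<Rightarrow> (real \<Rightarrow> real ^ 'd) \<Rightarrow> real" where
  "ito_integral T W u H = (SOME X. has_ito_integral T W u H X)"


section \<open>The game\<close>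

definition concat_path ::
    "real \<Rightarrow> real \<Rightarrow> (real \<Rightarrow> real ^ 'd) \<Rightarrow> (real \<Rightarrow> real ^ 'd) \<Rightarrow> (real \<Rightarrow> real ^ 'd)" where
  "concat_path T t \<omega> \<omega>' = (\<lambda>s\<in>{0..T}. if s \<le> t then \<omega> s else \<omega> t + \<omega>' (s - t))"

definition shift_coeff ::
    "real \<Rightarrow> real \<Rightarrow> (real \<Rightarrow> real ^ 'd) \<Rightarrow> (real \<Rightarrow> (real \<Rightarrow> real ^ 'd) \<Rightarrow> 'a \<Rightarrow> 'b)
      \<Rightarrow> real \<Rightarrow> (real \<Rightarrow> real ^ 'd) \<Rightarrow> 'a \<Rightarrow> 'b" where
  "shift_coeff T t \<omega> g s \<omega>' a = g (t + s) (concat_path T t \<omega> \<omega>') a"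

text \<open>Players are the elements of the finite type \<open>'n\<close>. The action sets \<open>A i\<close> are arbitrary subsets
  of one Euclidean space \<open>'e\<close>, not necessarily open, so action spaces of different dimensions
  are covered by embedding them in a common one.\<close>

definition profiles :: "('n \<Rightarrow> 'e set) \<Rightarrow> ('e ^ 'n) set" where
  "profiles A = {a. \<forall>i. a $ i \<in> A i}"

definition controls ::
    "real \<Rightarrow> (real \<Rightarrow> real ^ 'd) measure \<Rightarrow> 'e::topological_space set
      \<Rightarrow> (real \<Rightarrow> (real \<Rightarrow> real ^ 'd) \<Rightarrow> 'e) set" where
  "controls T W S = {\<beta>. prog_measurable T W S \<beta>}"

definition control_profiles ::
    "real \<Rightarrow> (real \<Rightarrow> real ^ 'd) measure \<Rightarrow> ('n \<Rightarrow> 'e::topological_space set)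
      \<Rightarrow> (real \<Rightarrow> (real \<Rightarrow> real ^ 'd) \<Rightarrow> 'e ^ 'n) set" where
  "control_profiles T W A = {\<alpha>. \<forall>i. (\<lambda>s \<omega>. \<alpha> s \<omega> $ i) \<in> controls T W (A i)}"

definition deviate ::
    "(real \<Rightarrow> (real \<Rightarrow> real ^ 'd) \<Rightarrow> 'e ^ 'n) \<Rightarrow> 'n \<Rightarrow> (real \<Rightarrow> (real \<Rightarrow> real ^ 'd) \<Rightarrow> 'e)
      \<Rightarrow> real \<Rightarrow> (real \<Rightarrow> real ^ 'd) \<Rightarrow> 'e ^ 'n" where
  "deviate \<alpha> i \<beta> s \<omega> = (\<chi> j. if j = i then \<beta> s \<omega> else \<alpha> s \<omega> $ j)"

definition controlled_measure ::
    "real \<Rightarrow> (real \<Rightarrow> real ^ 'd) measure \<Rightarrow> (real \<Rightarrow> (real \<Rightarrow> real ^ 'd) \<Rightarrow> 'e ^ 'n \<Rightarrow> real ^ 'd)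
      \<Rightarrow> real \<Rightarrow> (real \<Rightarrow> real ^ 'd) \<Rightarrow> (real \<Rightarrow> (real \<Rightarrow> real ^ 'd) \<Rightarrow> 'e ^ 'n)
      \<Rightarrow> (real \<Rightarrow> real ^ 'd) measure" where
  "controlled_measure T W b t \<omega> \<alpha> =
     (let \<theta> = (\<lambda>s \<omega>'. shift_coeff T t \<omega> b s \<omega>' (\<alpha> s \<omega>')) in
        density (completion W) (\<lambda>\<omega>'. ennreal (exp
          (ito_integral T W (T - t) \<theta> \<omega>' - 1 / 2 * (LBINT s:{0..T - t}. (norm (\<theta> s \<omega>'))\<^sup>2)))))"

text \<open>The running cost of player \<open>i\<close> is \<open>f\<^sub>i\<close> at the full profile; that it only depends on the
  \<open>i\<close>-th action is a hypothesis on \<open>f\<close>, see \<open>own_action_only\<close>.\<close>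

definition cost ::
    "real \<Rightarrow> (real \<Rightarrow> real ^ 'd) measure \<Rightarrow> (real \<Rightarrow> (real \<Rightarrow> real ^ 'd) \<Rightarrow> 'e ^ 'n \<Rightarrow> real ^ 'd)
      \<Rightarrow> (real \<Rightarrow> (real \<Rightarrow> real ^ 'd) \<Rightarrow> 'e ^ 'n \<Rightarrow> real ^ 'n) \<Rightarrow> ((real \<Rightarrow> real ^ 'd) \<Rightarrow> real ^ 'n)
      \<Rightarrow> real \<Rightarrow> (real \<Rightarrow> real ^ 'd) \<Rightarrow> (real \<Rightarrow> (real \<Rightarrow> real ^ 'd) \<Rightarrow> 'e ^ 'n) \<Rightarrow> real ^ 'n" where
  "cost T W b f \<xi> t \<omega> \<alpha> =
     (\<chi> i. \<integral>\<omega>'. \<xi> (concat_path T t \<omega> \<omega>') $ i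
          + (LBINT s:{0..T - t}. shift_coeff T t \<omega> f s \<omega>' (\<alpha> s \<omega>') $ i)
        \<partial>controlled_measure T W b t \<omega> \<alpha>)"

definition own_action_only ::
    "real \<Rightarrow> ('n \<Rightarrow> 'e set)
      \<Rightarrow> (real \<Rightarrow> (real \<Rightarrow> real ^ 'd) \<Rightarrow> 'e ^ 'n \<Rightarrow> real ^ 'n) \<Rightarrow> bool" where
  "own_action_only T A f \<longleftrightarrow>
     (\<forall>t\<in>{0..T}. \<forall>\<omega>\<in>path_space T. \<forall>a\<in>profiles A. \<forall>a'\<in>profiles A. \<forall>i.
        a $ i = a' $ i \<longrightarrow> f t \<omega> a $ i = f t \<omega> a' $ i)"

definition approx_equilibria ::
    "real \<Rightarrow> (real \<Rightarrow> real ^ 'd) measure \<Rightarrow> ('n \<Rightarrow> 'e::topological_space set)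
      \<Rightarrow> (real \<Rightarrow> (real \<Rightarrow> real ^ 'd) \<Rightarrow> 'e ^ 'n \<Rightarrow> real ^ 'd)
      \<Rightarrow> (real \<Rightarrow> (real \<Rightarrow> real ^ 'd) \<Rightarrow> 'e ^ 'n \<Rightarrow> real ^ 'n) \<Rightarrow> ((real \<Rightarrow> real ^ 'd) \<Rightarrow> real ^ 'n)
      \<Rightarrow> real \<Rightarrow> real \<Rightarrow> (real \<Rightarrow> real ^ 'd) \<Rightarrow> (real \<Rightarrow> (real \<Rightarrow> real ^ 'd) \<Rightarrow> 'e ^ 'n) set" where
  "approx_equilibria T W A b f \<xi> \<epsilon> t \<omega> =
     {\<alpha> \<in> control_profiles T W A. \<forall>i. \<forall>\<beta>\<in>controls T W (A i).
        cost T W b f \<xi> t \<omega> \<alpha> $ i \<le> cost T W b f \<xi> t \<omega> (deviate \<alpha> i \<beta>) $ i + \<epsilon>}"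

definition approx_set_value ::
    "real \<Rightarrow> (real \<Rightarrow> real ^ 'd) measure \<Rightarrow> ('n \<Rightarrow> 'e::topological_space set)
      \<Rightarrow> (real \<Rightarrow> (real \<Rightarrow> real ^ 'd) \<Rightarrow> 'e ^ 'n \<Rightarrow> real ^ 'd)
      \<Rightarrow> (real \<Rightarrow> (real \<Rightarrow> real ^ 'd) \<Rightarrow> 'e ^ 'n \<Rightarrow> real ^ 'n) \<Rightarrow> ((real \<Rightarrow> real ^ 'd) \<Rightarrow> real ^ 'n)
      \<Rightarrow> real \<Rightarrow> real \<Rightarrow> (real \<Rightarrow> real ^ 'd) \<Rightarrow> (real ^ 'n) set" where
  "approx_set_value T W A b f \<xi> \<epsilon> t \<omega> =
     (\<Union>\<alpha>\<in>approx_equilibria T W A b f \<xi> \<epsilon> t \<omega>. ball (cost T W b f \<xi> t \<omega> \<alpha>) \<epsilon>)"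

definition set_value ::
    "real \<Rightarrow> (real \<Rightarrow> real ^ 'd) measure \<Rightarrow> ('n \<Rightarrow> 'e::topological_space set)
      \<Rightarrow> (real \<Rightarrow> (real \<Rightarrow> real ^ 'd) \<Rightarrow> 'e ^ 'n \<Rightarrow> real ^ 'd)
      \<Rightarrow> (real \<Rightarrow> (real \<Rightarrow> real ^ 'd) \<Rightarrow> 'e ^ 'n \<Rightarrow> real ^ 'n) \<Rightarrow> ((real \<Rightarrow> real ^ 'd) \<Rightarrow> real ^ 'n)
      \<Rightarrow> real \<Rightarrow> (real \<Rightarrow> real ^ 'd) \<Rightarrow> (real ^ 'n) set" where
  "set_value T W A b f \<xi> t \<omega> = (\<Inter>\<epsilon>\<in>{0<..}. approx_set_value T W A b f \<xi> \<epsilon> t \<omega>)"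

definition approx_set_value_hat ::
    "real \<Rightarrow> (real \<Rightarrow> real ^ 'd) measure \<Rightarrow> ('n \<Rightarrow> 'e::topological_space set)
      \<Rightarrow> (real \<Rightarrow> (real \<Rightarrow> real ^ 'd) \<Rightarrow> 'e ^ 'n \<Rightarrow> real ^ 'd)
      \<Rightarrow> (real \<Rightarrow> (real \<Rightarrow> real ^ 'd) \<Rightarrow> 'e ^ 'n \<Rightarrow> real ^ 'n) \<Rightarrow> ((real \<Rightarrow> real ^ 'd) \<Rightarrow> real ^ 'n)
      \<Rightarrow> real \<Rightarrow> real \<Rightarrow> (real \<Rightarrow> real ^ 'd) \<Rightarrow> (real ^ 'n) set" where
  "approx_set_value_hat T W A b f \<xi> \<epsilon> t \<omega> =
     (\<Union>\<epsilon>'\<in>{0<..<\<epsilon>}. approx_set_value T W A b f \<xi> \<epsilon>' t \<omega>)"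


section \<open>Regularity of the data\<close>

definition modulus_of_continuity :: "(real \<Rightarrow> real) \<Rightarrow> bool" where
  "modulus_of_continuity \<rho> \<longleftrightarrow> \<rho> 0 = 0 \<and> mono_on {0..} \<rho> \<and> (\<rho> \<longlongrightarrow> 0) (at_right 0)"

definition bounded_coeff ::
    "real \<Rightarrow> 'a set \<Rightarrow> (real \<Rightarrow> (real \<Rightarrow> real ^ 'd) \<Rightarrow> 'a \<Rightarrow> 'b::real_normed_vector) \<Rightarrow> bool" where
  "bounded_coeff T S g \<longleftrightarrow>
     (\<exists>C. \<forall>t\<in>{0..T}. \<forall>\<omega>\<in>path_space T. \<forall>a\<in>S. norm (g t \<omega> a) \<le> C)"

definition coeff_has_modulus ::
    "real \<Rightarrow> 'a set \<Rightarrow> (real \<Rightarrow> real) \<Rightarrow> (real \<Rightarrow> (real \<Rightarrow> real ^ 'd) \<Rightarrow> 'a \<Rightarrow> 'b::real_normed_vector)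
      \<Rightarrow> bool" where
  "coeff_has_modulus T S \<rho> g \<longleftrightarrow>
     (\<forall>t\<in>{0..T}. \<forall>t'\<in>{0..T}. \<forall>\<omega>\<in>path_space T. \<forall>\<omega>'\<in>path_space T. \<forall>a\<in>S.
        norm (g t \<omega> a - g t' \<omega>' a) \<le> \<rho> (path_dist T (t, \<omega>) (t', \<omega>')))"

end

theory Submission
  imports Defs
begin

text \<open>The costs \<open>J(t, \<omega>, \<alpha>)\<close> are uniformly continuous in \<open>(t, \<omega>)\<close> for the pseudometric
  \<open>path_dist\<close>, uniformly over the controls \<open>\<alpha>\<close>. An \<open>\<epsilon>'\<close>-equilibrium at \<open>(t, \<omega>)\<close> with
  \<open>\<epsilon>' < \<epsilon>\<close> is therefore an \<open>\<epsilon>''\<close>-equilibrium, for some \<open>\<epsilon>'' < \<epsilon>\<close>, at all nearby points,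
  so that \<open>y \<in> V\<^sub>\<epsilon>(t, \<omega>)\<close> (with the union over \<open>\<epsilon>' < \<epsilon>\<close>) is an open condition on
  \<open>(t, \<omega>, y)\<close>. The space of stopped paths is separable, hence the condition is a countable union
  of balls, and the distance of \<open>(\<tau>, \<omega>)\<close> to a fixed point is measurable at time \<open>\<tau>\<close>. The set
  value is the intersection over \<open>\<epsilon> = 1 / (n + 1)\<close>.

  For the continuity, write \<open>J\<close> as an expectation under the Wiener measure of
  \<open>exp (X - A / 2)\<close> times a bounded payoff, where \<open>X\<close> is the Ito integral of the drift and \<open>A\<close> its
  energy. Neither Girsanov's theorem nor the martingale property of the density is needed: it
  suffices that \<open>exp X\<close> is bounded in \<open>L\<^sup>2\<close> and that \<open>X\<close> depends on the drift in a Lipschitz way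
  in \<open>L\<^sup>2\<close>. Both follow from the elementary integrals, once bounded progressive integrands are
  approximated by their averages over the preceding cell of a partition.\<close>

section \<open>Gaussian increments under the augmented filtration\<close>

text \<open>Equilibria range over uncountably many controls and are tested against uncountably many
  deviations, so measurability of each single cost in \<open>(t, \<omega>)\<close> would not be
  enough. Openness removes both quantifiers, and this is why every estimate must be uniform in the
  control. The uniformity comes from keeping the control and the driving path \<open>w\<close> fixed
  while only \<open>(t, \<omega>)\<close> moves: both integrands then see the same action
  \<open>\<alpha> s w\<close>. What differs is the delay with which \<open>w\<close> is appended, so
  the comparison costs the oscillation of \<open>w\<close> over \<open>\<bar>t - t'\<bar>\<close>.
  No bound on it holds for all paths at once; it is small outside a set of small probability that
  does not depend on the control, and boundedness of the data pays for the rest. The horizons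
  \<open>T - t\<close> and \<open>T - t'\<close> differ as well, which is handled by extending the
  integrands by zero.\<close>

lemma measurable_vec_lambda_PiM[measurable]:
  "(\<lambda>g. \<chi> j. g j) \<in> (\<Pi>\<^sub>M j\<in>(UNIV :: 'd::finite set). (lborel :: real measure)) \<rightarrow>\<^sub>M borel"
  by (rule borel_measurable_euclidean_space[THEN iffD2])
     (auto simp: Basis_vec_def inner_axis intro!: measurable_component_singleton)

text \<open>Both measures agree on boxes, which determines Lebesgue measure. The identification with
  a product measure is what lets integrals of products over coordinates factor.\<close>

lemma lborel_vec_eq:
  "(lborel :: (real ^ 'd) measure) = distr (\<Pi>\<^sub>M j\<in>(UNIV :: 'd set). lborel) borel (\<lambda>g. \<chi> j. g j)"
proof (rule lborel_eqI)
  interpret product_sigma_finite "\<lambda>_ :: 'd. lborel :: real measure"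
    by standard
  interpret finite_product_sigma_finite "\<lambda>_ :: 'd. lborel :: real measure" UNIV
    by standard auto
  fix l u :: "real ^ 'd" assume lu: "\<And>b. b \<in> Basis \<Longrightarrow> l \<bullet> b \<le> u \<bullet> b"
  have le: "l $ j \<le> u $ j" for j
    using lu[of "axis j 1"] by (simp add: inner_axis axis_in_Basis_iff)
  have vim: "(\<lambda>g. \<chi> j. g j) -` box l u \<inter> space (\<Pi>\<^sub>M j\<in>(UNIV :: 'd set). (lborel :: real measure))
      = Pi\<^sub>E UNIV (\<lambda>j. {l $ j<..<u $ j})"
    by (auto simp: space_PiM mem_box_cart PiE_iff)
  have "emeasure (distr (\<Pi>\<^sub>M j\<in>(UNIV :: 'd set). lborel) borel (\<lambda>g. \<chi> j. g j)) (box l u)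
      = emeasure (\<Pi>\<^sub>M j\<in>(UNIV :: 'd set). lborel) (Pi\<^sub>E UNIV (\<lambda>j. {l $ j<..<u $ j}))"
    by (subst emeasure_distr) (auto simp: vim)
  also have "\<dots> = (\<Prod>j\<in>UNIV. emeasure lborel {l $ j<..<u $ j})"
    by (subst emeasure_PiM) auto
  also have "\<dots> = ennreal (\<Prod>j\<in>UNIV. u $ j - l $ j)"
    using le by (simp add: prod_ennreal)
  also have "(\<Prod>j\<in>UNIV. u $ j - l $ j) = (\<Prod>b\<in>Basis. (u - l) \<bullet> b)"
    by (rule prod.reindex_bij_witness[of _ axis_index "\<lambda>j. axis j 1"])
       (auto simp: axis_in_Basis_iff inner_axis axis_index[symmetric] Basis_vec_def)
  finally show "emeasure (distr (\<Pi>\<^sub>M j\<in>(UNIV :: 'd set). lborel) borel (\<lambda>g. \<chi> j. g j)) (box l u)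
      = ennreal (\<Prod>b\<in>Basis. (u - l) \<bullet> b)" .
qed simp

lemma borel_measurable_vec_nth[measurable]: "(\<lambda>x :: 'a::real_normed_vector ^ 'd. x $ j) \<in> borel_measurable borel"
  by (intro borel_measurable_continuous_onI continuous_intros)

lemma nn_integral_lborel_vec_prod:
  assumes [measurable]: "\<And>j. g j \<in> borel_measurable borel"
  shows "(\<integral>\<^sup>+x. (\<Prod>j\<in>UNIV. g j (x $ j)) \<partial>(lborel :: (real ^ 'd) measure)) = (\<Prod>j\<in>UNIV. \<integral>\<^sup>+y. g j y \<partial>lborel)"
proof -
  interpret product_sigma_finite "\<lambda>_ :: 'd. lborel :: real measure"
    by standard
  show ?thesis
    by (simp add: lborel_vec_eq nn_integral_distr product_nn_integral_prod)
qed

lemma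
  fixes g :: "'d::finite \<Rightarrow> real \<Rightarrow> real"
  assumes g: "\<And>j. integrable lborel (g j)"
  shows integrable_lborel_vec_prod:
      "integrable (lborel :: (real ^ 'd) measure) (\<lambda>x. \<Prod>j\<in>UNIV. g j (x $ j))" (is ?int)
    and integral_lborel_vec_prod:
      "(\<integral>x. (\<Prod>j\<in>UNIV. g j (x $ j)) \<partial>(lborel :: (real ^ 'd) measure)) = (\<Prod>j\<in>UNIV. \<integral>y. g j y \<partial>lborel)"
        (is ?eq)
proof -
  interpret product_sigma_finite "\<lambda>_ :: 'd. lborel :: real measure"
    by standard
  have [measurable]: "g j \<in> borel_measurable borel" for j
    using borel_measurable_integrable[OF g] by simp
  show ?int
    unfolding lborel_vec_eq
    by (subst integrable_distr_eq) (auto intro!: product_integrable_prod g)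
  show ?eq
    unfolding lborel_vec_eq
    by (subst integral_distr) (auto intro!: product_integral_prod g)
qed

text \<open>The density of a centred Gaussian vector whose covariance is \<open>v\<close> times the
  identity. The parameter is the variance, so \<open>v = t - s\<close> gives the density required of
  an increment in \<open>wiener_measure\<close>.\<close>

definition gauss_density :: "real \<Rightarrow> real ^ 'd \<Rightarrow> real" where
  "gauss_density v x = (\<Prod>j\<in>UNIV. normal_density 0 (sqrt v) (x $ j))"

lemma gauss_density_nonneg: "0 \<le> gauss_density v x"
  unfolding gauss_density_def by (intro prod_nonneg) auto

lemma gauss_density_measurable[measurable]: "gauss_density v \<in> borel_measurable borel"
  unfolding gauss_density_def[abs_def] by measurable

text \<open>Completing the square: tilting a centred Gaussian by \<open>exp (c * y)\<close> only
  moves its mean to \<open>c * v\<close>, up to the factor that becomes the moment generating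
  function.\<close>

lemma normal_density_exp:
  assumes "0 < v"
  shows "exp (c * y) * normal_density 0 (sqrt v) y = exp (c\<^sup>2 * v / 2) * normal_density (c * v) (sqrt v) y"
proof -
  have "c * y - y\<^sup>2 / (2 * v) = c\<^sup>2 * v / 2 - (y - c * v)\<^sup>2 / (2 * v)"
    using assms by (simp add: field_simps power2_eq_square)
  then have "exp (c * y) * exp (- y\<^sup>2 / (2 * v)) = exp (c\<^sup>2 * v / 2) * exp (- (y - c * v)\<^sup>2 / (2 * v))"
    by (simp flip: exp_add)
  then show ?thesis
    using assms by (simp add: normal_density_def)
qed

text \<open>The tilted densities have mass one, so each coordinate contributes its factor
  \<open>exp ((c $ j)\<^sup>2 * v / 2)\<close>, and the exponents add up to the squared
  norm.\<close>

lemma gauss_mgf: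
  fixes c :: "real ^ 'd"
  assumes v: "0 < v"
  shows "(\<integral>\<^sup>+x. ennreal (exp (c \<bullet> x) * gauss_density v x) \<partial>lborel) = ennreal (exp ((norm c)\<^sup>2 * v / 2))"
proof -
  have "(\<integral>\<^sup>+x. ennreal (exp (c \<bullet> x) * gauss_density v x) \<partial>lborel)
      = (\<integral>\<^sup>+x. (\<Prod>j\<in>UNIV. ennreal (exp (c $ j * x $ j) * normal_density 0 (sqrt v) (x $ j))) \<partial>lborel)"
    unfolding gauss_density_def inner_vec_def
    by (simp add: exp_sum prod.distrib prod_ennreal)
  also have "\<dots> = (\<Prod>j\<in>UNIV. \<integral>\<^sup>+y. ennreal (exp (c $ j * y) * normal_density 0 (sqrt v) y) \<partial>lborel)"
    by (rule nn_integral_lborel_vec_prod[of "\<lambda>j y. ennreal (exp (c $ j * y) * normal_density 0 (sqrt v) y)"]) measurable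
  also have "\<dots> = (\<Prod>j\<in>UNIV. ennreal (exp ((c $ j)\<^sup>2 * v / 2)))"
  proof (rule prod.cong)
    fix j
    have "(\<integral>\<^sup>+y. ennreal (exp (c $ j * y) * normal_density 0 (sqrt v) y) \<partial>lborel)
        = (\<integral>\<^sup>+y. ennreal (exp ((c $ j)\<^sup>2 * v / 2)) * ennreal (normal_density (c $ j * v) (sqrt v) y) \<partial>lborel)"
      using v by (simp add: normal_density_exp ennreal_mult)
    also have "\<dots> = ennreal (exp ((c $ j)\<^sup>2 * v / 2)) * (\<integral>\<^sup>+y. ennreal (normal_density (c $ j * v) (sqrt v) y) \<partial>lborel)"
      by (rule nn_integral_cmult) measurable
    also have "(\<integral>\<^sup>+y. ennreal (normal_density (c $ j * v) (sqrt v) y) \<partial>lborel) = 1"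
      using v by (subst nn_integral_eq_integral) auto
    finally show "(\<integral>\<^sup>+y. ennreal (exp (c $ j * y) * normal_density 0 (sqrt v) y) \<partial>lborel)
        = ennreal (exp ((c $ j)\<^sup>2 * v / 2))" by simp
  qed simp
  also have "\<dots> = ennreal (exp ((norm c)\<^sup>2 * v / 2))"
    by (simp add: prod_ennreal norm_vec_def L2_set_def sum_nonneg real_sqrt_pow2
        exp_sum[symmetric] sum_distrib_right sum_divide_distrib)
  finally show ?thesis .
qed

lemma
  assumes v: "0 < v"
  shows integrable_gauss_density_nth: "integrable lborel (\<lambda>x :: real ^ 'd. gauss_density v x * x $ i)"
    and integral_gauss_density_nth: "(\<integral>x. gauss_density v x * x $ i \<partial>(lborel :: (real ^ 'd) measure)) = 0"
proof -
  let ?n = "normal_density 0 (sqrt v)"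
  define g where "g = (\<lambda>k :: 'd. \<lambda>y. ?n y * (if k = i then y else 1))"
  have s: "0 < sqrt v" using v by simp
  have m1: "has_bochner_integral lborel (\<lambda>y. ?n y * y) 0"
    using normal_moment_odd[OF s, of 0 0] by simp
  have int: "integrable lborel (g k)" for k
    using s m1 by (cases "k = i") (simp_all add: g_def has_bochner_integral_iff)
  have eq: "(\<lambda>x :: real ^ 'd. gauss_density v x * x $ i) = (\<lambda>x. \<Prod>k\<in>UNIV. g k (x $ k))"
    by (simp add: g_def gauss_density_def prod.distrib prod.If_cases fun_eq_iff)
  show "integrable lborel (\<lambda>x :: real ^ 'd. gauss_density v x * x $ i)"
    unfolding eq by (rule integrable_lborel_vec_prod[OF int])
  have "(\<integral>y. g i y \<partial>lborel) = 0"
    using m1 by (simp add: g_def has_bochner_integral_iff)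
  then show "(\<integral>x. gauss_density v x * x $ i \<partial>(lborel :: (real ^ 'd) measure)) = 0"
    unfolding eq by (subst integral_lborel_vec_prod[OF int]) (auto intro!: prod_zero)
qed

text \<open>The monomial changes only the factors of the coordinates \<open>i\<close> and
  \<open>j\<close>. For \<open>i \<noteq> j\<close> the factor of \<open>i\<close> is a first
  moment, which vanishes; for \<open>i = j\<close> it is the variance, and the other factors are
  normalised.\<close>

lemma
  assumes v: "0 < v"
  shows integrable_gauss_density_nth_nth:
      "integrable lborel (\<lambda>x :: real ^ 'd. gauss_density v x * (x $ i * x $ j))"
    and integral_gauss_density_nth_nth:
      "(\<integral>x. gauss_density v x * (x $ i * x $ j) \<partial>(lborel :: (real ^ 'd) measure)) = (if i = j then v else 0)"
proof -
  let ?n = "normal_density 0 (sqrt v)"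
  define g where "g = (\<lambda>k :: 'd. \<lambda>y. ?n y * ((if k = i then y else 1) * (if k = j then y else 1)))"
  have s: "0 < sqrt v" using v by simp
  have m1: "has_bochner_integral lborel (\<lambda>y. ?n y * y) 0"
    using normal_moment_odd[OF s, of 0 0] by simp
  have m2: "has_bochner_integral lborel (\<lambda>y. ?n y * (y * y)) v"
    using normal_moment_even[OF s, of 0 1] v by (simp add: power2_eq_square)
  have int: "integrable lborel (g k)" for k
    using s m1 m2 by (cases "k = i"; cases "k = j") (simp_all add: g_def has_bochner_integral_iff)
  have eq: "(\<lambda>x :: real ^ 'd. gauss_density v x * (x $ i * x $ j)) = (\<lambda>x. \<Prod>k\<in>UNIV. g k (x $ k))"
    by (simp add: g_def gauss_density_def prod.distrib prod.If_cases fun_eq_iff)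
  show "integrable lborel (\<lambda>x :: real ^ 'd. gauss_density v x * (x $ i * x $ j))"
    unfolding eq by (rule integrable_lborel_vec_prod[OF int])
  have "(\<Prod>k\<in>UNIV. \<integral>y. g k y \<partial>lborel) = (if i = j then v else 0)"
  proof (cases "i = j")
    case True
    have "(\<Prod>k\<in>UNIV. \<integral>y. g k y \<partial>lborel) = (\<Prod>k\<in>UNIV. if k = j then v else 1)"
      using True m2 s by (intro prod.cong) (auto simp: g_def has_bochner_integral_iff)
    then show ?thesis using True by simp
  next
    case False
    then have "(\<integral>y. g i y \<partial>lborel) = 0"
      using m1 by (simp add: g_def has_bochner_integral_iff)
    then show ?thesis using False by (auto intro!: prod_zero)
  qed
  then show "(\<integral>x. gauss_density v x * (x $ i * x $ j) \<partial>(lborel :: (real ^ 'd) measure)) = (if i = j then v else 0)"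
    unfolding eq by (subst integral_lborel_vec_prod[OF int]) 
qed

section \<open>Wiener space: completed measure, augmented filtration, coordinates\<close>

locale wiener_space =
  fixes T :: real and W :: "(real \<Rightarrow> real ^ 'd) measure"
  assumes T_pos: "0 < T" and wiener: "wiener_measure T W"
begin

abbreviation "\<Omega> \<equiv> path_space T :: (real \<Rightarrow> real ^ 'd) set"
text \<open>Expectations are taken under the completion, because the augmented filtration contains
  all subsets of null sets and these need not be \<open>W\<close>-measurable.\<close>

abbreviation "P \<equiv> completion W"
abbreviation "F \<equiv> aug_filtration T W"
abbreviation "F0 \<equiv> raw_filtration T :: real \<Rightarrow> (real \<Rightarrow> real ^ 'd) measure"

lemma space_W[simp]: "space W = \<Omega>" and sets_W: "sets W = sets (F0 T)"
  and prob_space_W: "prob_space W"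
  using wiener by (auto simp: wiener_measure_def)

sublocale prob_space P
  using prob_space_W by (rule prob_space.prob_space_completion)

sublocale filtration \<Omega> F
  by (rule filtration_aug_filtration) simp

lemma space_F'[simp]: "space (F t) = \<Omega>" by (rule space_F)

lemma space_raw[simp]: "space (F0 t) = \<Omega>"
  by (rule space_raw_filtration)

lemma sets_F: "sets (F t) = sigma_sets \<Omega> (sets (F0 t) \<union> null_sets P)"
  unfolding aug_filtration_def
  using sets.space_closed[of "F0 t", unfolded space_raw] sets.space_closed[of P]
  by (subst sets_measure_of) (auto simp: null_sets_def)

lemma sets_raw_F: "sets (F0 t) \<subseteq> sets (F t)"
  by (auto simp: sets_F)

lemma sets_raw_W: "sets (F0 t) \<subseteq> sets W"
proof -
  have "sets (F0 t) \<subseteq> sets (F0 T)"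
    unfolding raw_filtration_def
    by (subst (1 2) sets_measure_of) (auto intro!: sigma_sets_mono')
  then show ?thesis by (simp add: sets_W)
qed

lemma sets_F_P: "sets (F t) \<subseteq> sets P"
proof -
  have "sigma_sets (space P) (sets (F0 t) \<union> null_sets P) \<subseteq> sets P"
    using sets_raw_W[of t] by (intro sets.sigma_sets_subset) (auto simp: null_sets_def)
  then show ?thesis by (simp add: sets_F)
qed

lemma measurable_F_mono: "g \<in> F s \<rightarrow>\<^sub>M N \<Longrightarrow> s \<le> t \<Longrightarrow> g \<in> F t \<rightarrow>\<^sub>M N"
  using sets_F_mono[of s t] by (auto simp: measurable_def)

lemma measurable_F_P: "g \<in> F s \<rightarrow>\<^sub>M N \<Longrightarrow> g \<in> P \<rightarrow>\<^sub>M N"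
  using sets_F_P[of s] by (auto simp: measurable_def)

lemma measurable_raw_F: "g \<in> F0 s \<rightarrow>\<^sub>M N \<Longrightarrow> g \<in> F s \<rightarrow>\<^sub>M N"
  using sets_raw_F[of s] by (auto simp: measurable_def)

lemma measurable_raw_W: "g \<in> F0 s \<rightarrow>\<^sub>M N \<Longrightarrow> g \<in> W \<rightarrow>\<^sub>M N"
  using sets_raw_W[of s] by (auto simp: measurable_def)

lemma coord_raw: "s \<in> {0..T} \<Longrightarrow> s \<le> t \<Longrightarrow> (\<lambda>\<omega>. \<omega> s) \<in> borel_measurable (F0 t)"
  unfolding raw_filtration_def
  by (rule measurableI) (auto simp: space_measure_of_conv sets_measure_of_conv)

text \<open>Paths are continuous, so evaluation at a random time is the limit of evaluations at
  times with countably many values. Rounding down keeps these times in \<open>{0..v}\<close>, where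
  the coordinates are measurable for \<open>F0 v\<close>.\<close>

lemma path_eval_measurable:
  assumes \<pi>: "\<pi> \<in> M \<rightarrow>\<^sub>M F0 v" and v: "0 \<le> v" "v \<le> T"
    and \<sigma>[measurable]: "\<sigma> \<in> borel_measurable M" and range: "\<And>m. m \<in> space M \<Longrightarrow> \<sigma> m \<in> {0..v}"
  shows "(\<lambda>m. \<pi> m (\<sigma> m)) \<in> borel_measurable M"
proof (rule borel_measurable_LIMSEQ_metric)
  define \<sigma>' where "\<sigma>' = (\<lambda>n m. of_int \<lfloor>real (Suc n) * \<sigma> m\<rfloor> / real (Suc n))"
  \<comment> \<open>The truncation makes \<open>c n k\<close> an admissible time for every integer
    \<open>k\<close>, also for those that the rounding never attains.\<close>
  define c where "c = (\<lambda>n (k :: int). max 0 (min v (of_int k / real (Suc n))))"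
  have le: "\<sigma>' n m \<le> \<sigma> m" for n m
    unfolding \<sigma>'_def by (simp add: divide_le_eq mult.commute)
  have ge: "\<sigma> m - 1 / real (Suc n) \<le> \<sigma>' n m" for n m
  proof -
    have "real (Suc n) * \<sigma> m - 1 \<le> of_int \<lfloor>real (Suc n) * \<sigma> m\<rfloor>" by linarith
    then have "(real (Suc n) * \<sigma> m - 1) / real (Suc n) \<le> \<sigma>' n m"
      unfolding \<sigma>'_def by (intro divide_right_mono) auto
    then show ?thesis by (simp add: diff_divide_distrib)
  qed
  have nn: "m \<in> space M \<Longrightarrow> 0 \<le> \<sigma>' n m" for n m
    using range[of m] unfolding \<sigma>'_def by auto
  have \<sigma>'_c: "m \<in> space M \<Longrightarrow> \<sigma>' n m = c n \<lfloor>real (Suc n) * \<sigma> m\<rfloor>" for n m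
    using nn[of m n] le[of n m] range[of m] unfolding c_def by (auto simp: \<sigma>'_def)
  show "(\<lambda>m. \<pi> m (\<sigma>' n m)) \<in> borel_measurable M" for n
  proof -
    have "(\<lambda>m. \<pi> m (c n k)) \<in> borel_measurable M" for k
    proof (rule measurable_compose[OF \<pi>])
      show "(\<lambda>\<omega>. \<omega> (c n k)) \<in> borel_measurable (F0 v)"
        using v by (intro coord_raw) (auto simp: c_def)
    qed
    then have "(\<lambda>m. \<pi> m (c n \<lfloor>real (Suc n) * \<sigma> m\<rfloor>)) \<in> borel_measurable M"
      by (rule measurable_compose_countable) measurable
    then show ?thesis
      by (rule measurable_cong[THEN iffD1, rotated]) (simp add: \<sigma>'_c)
  qed
  fix m assume m: "m \<in> space M"
  have "(\<lambda>n. \<sigma>' n m) \<longlonglongrightarrow> \<sigma> m"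
  proof (rule tendsto_sandwich)
    show "(\<lambda>n. \<sigma> m - 1 / real (Suc n)) \<longlonglongrightarrow> \<sigma> m"
      using tendsto_diff[OF tendsto_const LIMSEQ_inverse_real_of_nat, of "\<sigma> m"] by (simp add: inverse_eq_divide)
    show "\<forall>\<^sub>F n in sequentially. \<sigma> m - 1 / real (Suc n) \<le> \<sigma>' n m" using ge by simp
    show "\<forall>\<^sub>F n in sequentially. \<sigma>' n m \<le> \<sigma> m" using le by simp
  qed simp
  moreover have "\<pi> m \<in> \<Omega>" using measurable_space[OF \<pi> m] by simp
  then have "continuous_on {0..T} (\<pi> m)" by (simp add: path_space_def)
  moreover have "\<sigma>' n m \<in> {0..T}" for n
    using nn[OF m, of n] le[of n m] range[OF m] v by auto
  ultimately show "(\<lambda>n. \<pi> m (\<sigma>' n m)) \<longlonglongrightarrow> \<pi> m (\<sigma> m)"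
    using range[OF m] v by (intro continuous_on_tendsto_compose[of "{0..T}" "\<pi> m"]) auto
qed

section \<open>The law of an increment given the past\<close>

context
  fixes s t :: real assumes st: "0 \<le> s" "s < t" "t \<le> T"
begin

lemma increment_measurable: "(\<lambda>\<omega>. \<omega> t - \<omega> s) \<in> borel_measurable W"
  using st by (intro borel_measurable_diff measurable_raw_W[OF coord_raw[of _ T]]) auto

lemma increment_measurable_P: "(\<lambda>\<omega>. \<omega> t - \<omega> s) \<in> borel_measurable P"
  using increment_measurable by (rule measurable_completion)

lemma distr_increment: "distr P borel (\<lambda>\<omega>. \<omega> t - \<omega> s) = density lborel (\<lambda>x. ennreal (gauss_density (t - s) x))"
proof -
  have "distributed W lborel (\<lambda>\<omega>. \<omega> t - \<omega> s) (\<lambda>x. ennreal (gauss_density (t - s) x))"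
    using wiener st unfolding wiener_measure_def gauss_density_def by auto
  then have "distr W lborel (\<lambda>\<omega>. \<omega> t - \<omega> s) = density lborel (\<lambda>x. ennreal (gauss_density (t - s) x))"
    by (simp add: distributed_def)
  moreover have "distr P borel (\<lambda>\<omega>. \<omega> t - \<omega> s) = distr W borel (\<lambda>\<omega>. \<omega> t - \<omega> s)"
    by (rule distr_completion[OF increment_measurable])
  moreover have "distr W borel (\<lambda>\<omega>. \<omega> t - \<omega> s) = distr W lborel (\<lambda>\<omega>. \<omega> t - \<omega> s)"
    by (intro distr_cong) auto
  ultimately show ?thesis by simp
qed

text \<open>\<open>wiener_measure\<close> speaks of the raw filtration only. Null sets are
  independent of every event, and together with the raw events they still form a system closed under
  intersection, so independence extends to the generated \<open>F s\<close>.\<close>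

lemma indep_increment:
  "indep_set (sets (F s)) {(\<lambda>\<omega>. \<omega> t - \<omega> s) -` U \<inter> \<Omega> | U. U \<in> sets borel}"
proof -
  let ?I = "{(\<lambda>\<omega>. \<omega> t - \<omega> s) -` U \<inter> \<Omega> | U. U \<in> sets borel}"
  interpret W: prob_space W by (rule prob_space_W)
  have ind: "W.indep_set (sets (F0 s)) ?I"
    using wiener st unfolding wiener_measure_def by auto
  have I_W: "?I \<subseteq> sets W"
    using measurable_sets[OF increment_measurable] by auto
  then have I_P: "?I \<subseteq> sets P" by auto
  have meas_null: "prob (N \<inter> B) = 0" if "N \<in> null_sets P" "B \<in> sets P" for N B
    using that by (meson measure_eq_0_null_sets null_set_Int2)
  have "indep_set (sets (F0 s) \<union> null_sets P) ?I"
    unfolding indep_sets2_eq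
  proof (intro conjI ballI)
    show "sets (F0 s) \<union> null_sets P \<subseteq> events"
      using sets_raw_W[of s] by auto
    show "?I \<subseteq> events" by (rule I_P)
    fix A B assume A: "A \<in> sets (F0 s) \<union> null_sets P" and B: "B \<in> ?I"
    have BP: "B \<in> sets P" and BW: "B \<in> sets W" using I_P I_W B by auto
    from A show "prob (A \<inter> B) = prob A * prob B"
    proof
      assume A: "A \<in> sets (F0 s)"
      then have "A \<in> sets W" using sets_raw_W by auto
      then show ?thesis
        using W.indep_setD[OF ind A B] BW by simp
    next
      assume "A \<in> null_sets P"
      then show ?thesis using meas_null[OF _ BP] BP by (simp add: measure_eq_0_null_sets)
    qed
  qed
  moreover have "Int_stable (sets (F0 s) \<union> null_sets P)"
  proof (rule Int_stableI)
    fix A B assume A: "A \<in> sets (F0 s) \<union> null_sets P" "B \<in> sets (F0 s) \<union> null_sets P"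
    then have "A \<in> sets P" "B \<in> sets P" using sets_raw_W by auto
    then show "A \<inter> B \<in> sets (F0 s) \<union> null_sets P"
      using A by (auto intro: null_set_Int1 null_set_Int2)
  qed
  moreover have "Int_stable ?I"
  proof (rule Int_stableI)
    fix A B assume "A \<in> ?I" "B \<in> ?I"
    then obtain U V where "U \<in> sets borel" "V \<in> sets borel"
      "A = (\<lambda>\<omega>. \<omega> t - \<omega> s) -` U \<inter> \<Omega>" "B = (\<lambda>\<omega>. \<omega> t - \<omega> s) -` V \<inter> \<Omega>" by auto
    then show "A \<inter> B \<in> ?I" by (auto intro!: exI[of _ "U \<inter> V"])
  qed
  ultimately have "indep_set (sigma_sets (space P) (sets (F0 s) \<union> null_sets P)) (sigma_sets (space P) ?I)"
    by (rule indep_set_sigma_sets)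
  then have *: "indep_set (sets (F s)) (sigma_sets \<Omega> ?I)"
    by (simp add: sets_F)
  show ?thesis
    using * unfolding indep_sets2_eq by auto
qed

text \<open>Conditioning on \<open>F s\<close> without conditional expectations: independence makes
  the joint law of \<open>Y\<close> and the increment a product, and Tonelli integrates out the
  increment with \<open>Y\<close> frozen. The space \<open>N\<close> is arbitrary so that
  \<open>Y\<close> can carry several variables at once.\<close>

lemma nn_integral_increment:
  assumes Y: "Y \<in> F s \<rightarrow>\<^sub>M N" and [measurable]: "g \<in> borel_measurable (N \<Otimes>\<^sub>M borel)"
  shows "(\<integral>\<^sup>+\<omega>. g (Y \<omega>, \<omega> t - \<omega> s) \<partial>P)
       = (\<integral>\<^sup>+\<omega>. (\<integral>\<^sup>+x. g (Y \<omega>, x) * ennreal (gauss_density (t - s) x) \<partial>lborel) \<partial>P)"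
proof -
  note [measurable] = measurable_F_P[OF Y] increment_measurable_P
  let ?D = "density lborel (\<lambda>x. ennreal (gauss_density (t - s) x)) :: (real ^ 'd) measure"
  have D: "distr P N Y \<Otimes>\<^sub>M ?D = distr P (N \<Otimes>\<^sub>M borel) (\<lambda>\<omega>. (Y \<omega>, \<omega> t - \<omega> s))"
  proof (rule pair_measure_eqI)
    show "sigma_finite_measure (distr P N Y)"
      by (rule prob_space_imp_sigma_finite[OF prob_space_distr[OF measurable_F_P[OF Y]]])
    show "sigma_finite_measure ?D"
      using prob_space_imp_sigma_finite[OF prob_space_distr[OF increment_measurable_P]]
      unfolding distr_increment .
    fix A B assume A: "A \<in> sets (distr P N Y)" and B: "B \<in> sets ?D"
    have "Y -` A \<inter> \<Omega> \<in> sets (F s)"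
      using measurable_sets[OF Y, of A] A by simp
    then have "prob ((Y -` A \<inter> \<Omega>) \<inter> ((\<lambda>\<omega>. \<omega> t - \<omega> s) -` B \<inter> \<Omega>))
        = prob (Y -` A \<inter> \<Omega>) * prob ((\<lambda>\<omega>. \<omega> t - \<omega> s) -` B \<inter> \<Omega>)"
      using B by (intro indep_setD[OF indep_increment]) auto
    moreover have "emeasure ?D B = emeasure (distr P borel (\<lambda>\<omega>. \<omega> t - \<omega> s)) B"
      by (simp add: distr_increment)
    moreover have "(\<lambda>\<omega>. (Y \<omega>, \<omega> t - \<omega> s)) -` (A \<times> B) \<inter> space P
        = (Y -` A \<inter> \<Omega>) \<inter> ((\<lambda>\<omega>. \<omega> t - \<omega> s) -` B \<inter> \<Omega>)" by auto
    ultimately show "emeasure (distr P N Y) A * emeasure ?D B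
        = emeasure (distr P (N \<Otimes>\<^sub>M borel) (\<lambda>\<omega>. (Y \<omega>, \<omega> t - \<omega> s))) (A \<times> B)"
      using A B by (simp add: emeasure_distr emeasure_eq_measure ennreal_mult)
  qed (simp cong: sets_pair_measure_cong)
  interpret D: prob_space ?D
    using prob_space_distr[OF increment_measurable_P] by (simp add: distr_increment)
  have [measurable]: "g \<in> borel_measurable (N \<Otimes>\<^sub>M ?D)"
    using assms(2) by (simp cong: measurable_cong_sets)
  have "(\<integral>\<^sup>+\<omega>. g (Y \<omega>, \<omega> t - \<omega> s) \<partial>P) = (\<integral>\<^sup>+z. g z \<partial>distr P (N \<Otimes>\<^sub>M borel) (\<lambda>\<omega>. (Y \<omega>, \<omega> t - \<omega> s)))"
    by (subst nn_integral_distr) auto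
  also have "\<dots> = (\<integral>\<^sup>+z. g z \<partial>(distr P N Y \<Otimes>\<^sub>M ?D))" by (simp add: D)
  also have "\<dots> = (\<integral>\<^sup>+y. \<integral>\<^sup>+x. g (y, x) \<partial>?D \<partial>distr P N Y)"
    by (rule D.nn_integral_fst[symmetric]) (simp cong: measurable_cong_sets)
  also have "\<dots> = (\<integral>\<^sup>+\<omega>. \<integral>\<^sup>+x. g (Y \<omega>, x) \<partial>?D \<partial>P)"
    by (subst nn_integral_distr) auto
  also have "\<dots> = (\<integral>\<^sup>+\<omega>. (\<integral>\<^sup>+x. g (Y \<omega>, x) * ennreal (gauss_density (t - s) x) \<partial>lborel) \<partial>P)"
  proof (rule nn_integral_cong)
    fix \<omega> assume "\<omega> \<in> space P"
    then have "Y \<omega> \<in> space N" using measurable_F_P[OF Y] by (rule measurable_space[rotated])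
    then have [measurable]: "(\<lambda>x. g (Y \<omega>, x)) \<in> borel_measurable borel"
      using assms(2) by (rule measurable_Pair2[rotated])
    show "(\<integral>\<^sup>+x. g (Y \<omega>, x) \<partial>?D) = (\<integral>\<^sup>+x. g (Y \<omega>, x) * ennreal (gauss_density (t - s) x) \<partial>lborel)"
      by (subst nn_integral_density) (auto simp: mult.commute)
  qed
  finally show ?thesis .
qed

text \<open>The analogue for signed products. With \<open>h\<close> a coordinate or a product of two
  coordinates, it gives the mean and covariance of an increment weighted by a variable of the
  past.\<close>

lemma
  assumes Y: "Y \<in> borel_measurable (F s)" and int: "integrable P Y"
    and h[measurable]: "h \<in> borel_measurable borel" and hint: "integrable lborel (\<lambda>x. gauss_density (t - s) x * h x)"
  shows integrable_mult_increment: "integrable P (\<lambda>\<omega>. Y \<omega> * h (\<omega> t - \<omega> s))"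
    and integral_mult_increment: "(\<integral>\<omega>. Y \<omega> * h (\<omega> t - \<omega> s) \<partial>P) = (\<integral>\<omega>. Y \<omega> \<partial>P) * (\<integral>x. gauss_density (t - s) x * h x \<partial>lborel)"
proof -
  note [measurable] = increment_measurable_P
  have hD: "integrable (distr P borel (\<lambda>\<omega>. \<omega> t - \<omega> s)) h"
    unfolding distr_increment using hint by (subst integrable_density) (auto simp: gauss_density_nonneg)
  then have hI: "integrable P (\<lambda>\<omega>. h (\<omega> t - \<omega> s))"
    by (subst (asm) integrable_distr_eq) auto
  have ind: "indep_var borel Y borel (\<lambda>\<omega>. h (\<omega> t - \<omega> s))"
    unfolding indep_var_eq
  proof (intro conjI)
    show "random_variable borel Y" using Y by (rule measurable_F_P)
    show "random_variable borel (\<lambda>\<omega>. h (\<omega> t - \<omega> s))" by measurable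
    have Yj: "{Y -` A \<inter> \<Omega> |A. A \<in> sets borel} \<subseteq> sets (F s)"
      using measurable_sets[OF Y] by auto
    have "Int_stable {(\<lambda>\<omega>. \<omega> t - \<omega> s) -` U \<inter> \<Omega> | U. U \<in> sets borel}"
    proof (rule Int_stableI, clarify)
      fix U V :: "(real ^ 'd) set" assume "U \<in> sets borel" "V \<in> sets borel"
      then show "\<exists>Z. (\<lambda>\<omega>. \<omega> t - \<omega> s) -` U \<inter> \<Omega> \<inter> ((\<lambda>\<omega>. \<omega> t - \<omega> s) -` V \<inter> \<Omega>)
            = (\<lambda>\<omega>. \<omega> t - \<omega> s) -` Z \<inter> \<Omega> \<and> Z \<in> sets borel"
        by (intro exI[of _ "U \<inter> V"]) auto
    qed
    then have 1: "indep_set (sigma_sets (space P) (sets (F s)))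
        (sigma_sets (space P) {(\<lambda>\<omega>. \<omega> t - \<omega> s) -` U \<inter> \<Omega> | U. U \<in> sets borel})"
      using indep_increment by (intro indep_set_sigma_sets) (auto intro!: Int_stableI)
    \<comment> \<open>Events of \<open>h\<close> of the increment are events of the increment, which
      passes the independence on.\<close>
    have "{(\<lambda>\<omega>. h (\<omega> t - \<omega> s)) -` A \<inter> \<Omega> |A. A \<in> sets borel}
        \<subseteq> {(\<lambda>\<omega>. \<omega> t - \<omega> s) -` U \<inter> \<Omega> | U. U \<in> sets borel}"
    proof clarify
      fix A :: "real set" assume "A \<in> sets borel"
      then have "h -` A \<in> sets borel" using measurable_sets[OF h] by simp
      then show "\<exists>U. (\<lambda>\<omega>. h (\<omega> t - \<omega> s)) -` A \<inter> \<Omega> = (\<lambda>\<omega>. \<omega> t - \<omega> s) -` U \<inter> \<Omega> \<and> U \<in> sets borel"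
        by (intro exI[of _ "h -` A"] conjI) (simp_all add: vimage_def)
    qed
    then have 2: "sigma_sets \<Omega> {(\<lambda>\<omega>. h (\<omega> t - \<omega> s)) -` A \<inter> \<Omega> |A. A \<in> sets borel}
        \<subseteq> sigma_sets \<Omega> {(\<lambda>\<omega>. \<omega> t - \<omega> s) -` U \<inter> \<Omega> | U. U \<in> sets borel}"
      by (rule sigma_sets_mono')
    have 3: "sigma_sets \<Omega> {Y -` A \<inter> \<Omega> |A. A \<in> sets borel} \<subseteq> sigma_sets \<Omega> (sets (F s))"
      using Yj by (rule sigma_sets_mono')
    show "indep_set (sigma_sets (space P) {Y -` A \<inter> space P |A. A \<in> sets borel})
       (sigma_sets (space P) {(\<lambda>\<omega>. h (\<omega> t - \<omega> s)) -` A \<inter> space P |A. A \<in> sets borel})"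
      unfolding indep_sets2_eq
    proof (intro conjI ballI)
      show "sigma_sets (space P) {Y -` A \<inter> space P |A. A \<in> sets borel} \<subseteq> events"
        using 1 3 unfolding indep_sets2_eq space_completion space_W by (meson subset_trans)
      show "sigma_sets (space P) {(\<lambda>\<omega>. h (\<omega> t - \<omega> s)) -` A \<inter> space P |A. A \<in> sets borel} \<subseteq> events"
        using 1 2 unfolding indep_sets2_eq space_completion space_W by (meson subset_trans)
      fix a b assume "a \<in> sigma_sets (space P) {Y -` A \<inter> space P |A. A \<in> sets borel}"
        "b \<in> sigma_sets (space P) {(\<lambda>\<omega>. h (\<omega> t - \<omega> s)) -` A \<inter> space P |A. A \<in> sets borel}"
      then show "prob (a \<inter> b) = prob a * prob b"
        using 2 3 unfolding space_completion space_W
        by (intro indep_setD[OF 1]) (simp_all only: space_completion space_W, blast+)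
    qed
  qed
  have "(\<integral>\<omega>. h (\<omega> t - \<omega> s) \<partial>P) = (\<integral>x. h x \<partial>distr P borel (\<lambda>\<omega>. \<omega> t - \<omega> s))"
    by (subst integral_distr) auto
  also have "\<dots> = (\<integral>x. gauss_density (t - s) x * h x \<partial>lborel)"
    unfolding distr_increment by (subst integral_density) (auto simp: gauss_density_nonneg)
  finally have eq: "(\<integral>\<omega>. h (\<omega> t - \<omega> s) \<partial>P) = (\<integral>x. gauss_density (t - s) x * h x \<partial>lborel)" .
  show "integrable P (\<lambda>\<omega>. Y \<omega> * h (\<omega> t - \<omega> s))"
    by (rule indep_var_integrable[OF ind int hI])
  show "(\<integral>\<omega>. Y \<omega> * h (\<omega> t - \<omega> s) \<partial>P) = (\<integral>\<omega>. Y \<omega> \<partial>P) * (\<integral>x. gauss_density (t - s) x * h x \<partial>lborel)"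
    using indep_var_lebesgue_integral[OF ind int hI] by (simp add: eq)
qed

end

end

section \<open>The isometry for elementary integrals\<close>

context wiener_space
begin

lemma increment_measurable_F:
  assumes "0 \<le> a" "a \<le> b" "b \<le> T" "b \<le> c"
  shows "(\<lambda>\<omega>. \<omega> b - \<omega> a) \<in> borel_measurable (F c)"
  using assms by (intro borel_measurable_diff measurable_raw_F coord_raw) auto

text \<open>For \<open>b = d\<close> the increment vanishes and has no density, so that case is
  split off from the Gaussian computation.\<close>

lemma
  assumes Y: "Y \<in> borel_measurable (F b)" "integrable P Y" and bd: "0 \<le> b" "b \<le> d" "d \<le> T"
  shows integrable_mult_increment_nth: "integrable P (\<lambda>\<omega>. Y \<omega> * (\<omega> d - \<omega> b) $ j)"
    and integral_mult_increment_nth: "(\<integral>\<omega>. Y \<omega> * (\<omega> d - \<omega> b) $ j \<partial>P) = 0"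
    and integrable_mult_increment_nth_nth:
      "integrable P (\<lambda>\<omega>. Y \<omega> * ((\<omega> d - \<omega> b) $ i * (\<omega> d - \<omega> b) $ j))"
    and integral_mult_increment_nth_nth:
      "(\<integral>\<omega>. Y \<omega> * ((\<omega> d - \<omega> b) $ i * (\<omega> d - \<omega> b) $ j) \<partial>P)
        = (\<integral>\<omega>. Y \<omega> \<partial>P) * (if i = j then d - b else 0)"
proof -
  show "integrable P (\<lambda>\<omega>. Y \<omega> * (\<omega> d - \<omega> b) $ j)"
  proof (cases "b = d")
    case False
    then show ?thesis
      using bd by (intro integrable_mult_increment[OF _ _ _ Y, of d "\<lambda>x. x $ j"] integrable_gauss_density_nth) auto
  qed simp
  show "(\<integral>\<omega>. Y \<omega> * (\<omega> d - \<omega> b) $ j \<partial>P) = 0"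
  proof (cases "b = d")
    case False
    then show ?thesis
      using bd by (subst integral_mult_increment[OF _ _ _ Y, of d "\<lambda>x. x $ j"])
        (auto intro!: integrable_gauss_density_nth simp: integral_gauss_density_nth)
  qed simp
  show "integrable P (\<lambda>\<omega>. Y \<omega> * ((\<omega> d - \<omega> b) $ i * (\<omega> d - \<omega> b) $ j))"
  proof (cases "b = d")
    case False
    then show ?thesis
      using bd by (intro integrable_mult_increment[OF _ _ _ Y, of d "\<lambda>x. x $ i * x $ j"]
          integrable_gauss_density_nth_nth) auto
  qed simp
  show "(\<integral>\<omega>. Y \<omega> * ((\<omega> d - \<omega> b) $ i * (\<omega> d - \<omega> b) $ j) \<partial>P)
        = (\<integral>\<omega>. Y \<omega> \<partial>P) * (if i = j then d - b else 0)"
  proof (cases "b = d")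
    case False
    then show ?thesis
      using bd by (subst integral_mult_increment[OF _ _ _ Y, of d "\<lambda>x. x $ i * x $ j"])
        (auto intro!: integrable_gauss_density_nth_nth simp: integral_gauss_density_nth_nth)
  qed simp
qed

lemma integrable_increment_sq:
  assumes "0 \<le> b" "b \<le> d" "d \<le> T"
  shows "integrable P (\<lambda>\<omega>. (norm (\<omega> d - \<omega> b))\<^sup>2)"
proof -
  have "integrable P (\<lambda>\<omega>. \<Sum>j\<in>UNIV. 1 * ((\<omega> d - \<omega> b) $ j * (\<omega> d - \<omega> b) $ j))"
    using assms by (intro Bochner_Integration.integrable_sum integrable_mult_increment_nth_nth) auto
  then show ?thesis
    by (simp add: power2_norm_eq_inner inner_vec_def)
qed

definition adapted_bounded :: "real \<Rightarrow> ((real \<Rightarrow> real ^ 'd) \<Rightarrow> real ^ 'd) \<Rightarrow> bool" where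
  "adapted_bounded a \<phi> \<longleftrightarrow> \<phi> \<in> borel_measurable (F a) \<and> bounded (\<phi> ` \<Omega>)"

lemma adapted_bounded_mono: "adapted_bounded a \<phi> \<Longrightarrow> a \<le> b \<Longrightarrow> adapted_bounded b \<phi>"
  unfolding adapted_bounded_def by (blast intro: measurable_F_mono)

lemma adapted_bounded_measurable:
  "adapted_bounded a \<phi> \<Longrightarrow> a \<le> c \<Longrightarrow> \<phi> \<in> borel_measurable (F c)"
  unfolding adapted_bounded_def by (blast intro: measurable_F_mono)

lemma adapted_boundedE:
  assumes "adapted_bounded a \<phi>"
  obtains C where "0 \<le> C" "\<And>\<omega>. \<omega> \<in> \<Omega> \<Longrightarrow> norm (\<phi> \<omega>) \<le> C"
proof -
  obtain C where "\<forall>x\<in>\<phi> ` \<Omega>. norm x \<le> C"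
    using assms by (auto simp: adapted_bounded_def bounded_iff)
  then show thesis by (intro that[of "max 0 C"]) (auto simp: le_max_iff_disj)
qed

lemma adapted_bounded_uminus: "adapted_bounded a \<phi> \<Longrightarrow> adapted_bounded a (\<lambda>\<omega>. - \<phi> \<omega>)"
  unfolding adapted_bounded_def bounded_iff by (simp add: ball_simps borel_measurable_uminus)

text \<open>The stochastic integral of \<open>\<phi>\<close> times the indicator of
  \<open>{a<..b}\<close>. Adaptedness of \<open>\<phi>\<close> is kept apart from the interval,
  because intervals get cut at later times while \<open>\<phi>\<close> stays the same.\<close>

definition elem_integral ::
    "((real \<Rightarrow> real ^ 'd) \<Rightarrow> real ^ 'd) \<Rightarrow> real \<Rightarrow> real \<Rightarrow> (real \<Rightarrow> real ^ 'd) \<Rightarrow> real" where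
  "elem_integral \<phi> a b \<omega> = \<phi> \<omega> \<bullet> (\<omega> b - \<omega> a)"

lemma elem_integral_measurable_F:
  assumes "adapted_bounded a \<phi>" "0 \<le> a" "a \<le> b" "b \<le> T" "b \<le> c"
  shows "elem_integral \<phi> a b \<in> borel_measurable (F c)"
proof -
  have "\<phi> \<in> borel_measurable (F c)"
    using assms by (intro adapted_bounded_measurable[of a]) auto
  then show ?thesis
    using assms unfolding elem_integral_def[abs_def]
    by (intro borel_measurable_inner increment_measurable_F)
qed

lemma elem_integral_measurable:
  assumes "adapted_bounded a \<phi>" "0 \<le> a" "a \<le> b" "b \<le> T"
  shows "elem_integral \<phi> a b \<in> borel_measurable P"
  using elem_integral_measurable_F[OF assms order_refl] by (rule measurable_F_P)

lemma integrable_elem_integral_sq: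
  assumes \<phi>: "adapted_bounded a \<phi>" and ab: "0 \<le> a" "a \<le> b" "b \<le> T"
  shows "integrable P (\<lambda>\<omega>. (elem_integral \<phi> a b \<omega>)\<^sup>2)"
proof -
  note [measurable] = elem_integral_measurable[OF assms]
  obtain C where C: "0 \<le> C" "\<And>\<omega>. \<omega> \<in> \<Omega> \<Longrightarrow> norm (\<phi> \<omega>) \<le> C"
    using adapted_boundedE[OF \<phi>] by blast
  show ?thesis
  proof (rule Bochner_Integration.integrable_bound)
    show "integrable P (\<lambda>\<omega>. C\<^sup>2 * (norm (\<omega> b - \<omega> a))\<^sup>2)"
      using integrable_increment_sq[OF ab] by simp
    show "AE \<omega> in P. norm ((elem_integral \<phi> a b \<omega>)\<^sup>2) \<le> norm (C\<^sup>2 * (norm (\<omega> b - \<omega> a))\<^sup>2)"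
    proof (rule AE_I2)
      fix \<omega> assume "\<omega> \<in> space P"
      then have "\<bar>elem_integral \<phi> a b \<omega>\<bar> \<le> C * norm (\<omega> b - \<omega> a)"
        using C(2)[of \<omega>] Cauchy_Schwarz_ineq2[of "\<phi> \<omega>" "\<omega> b - \<omega> a"] unfolding elem_integral_def
        by (auto intro: order_trans[OF _ mult_right_mono])
      then have "\<bar>elem_integral \<phi> a b \<omega>\<bar>\<^sup>2 \<le> (C * norm (\<omega> b - \<omega> a))\<^sup>2"
        by (rule power_mono) simp
      then show "norm ((elem_integral \<phi> a b \<omega>)\<^sup>2) \<le> norm (C\<^sup>2 * (norm (\<omega> b - \<omega> a))\<^sup>2)"
        by (simp add: power_mult_distrib)
    qed
  qed measurable
qed

lemma integrable_mult_of_sq: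
  fixes X Y :: "_ \<Rightarrow> real"
  assumes [measurable]: "X \<in> borel_measurable P" "Y \<in> borel_measurable P"
    and "integrable P (\<lambda>\<omega>. (X \<omega>)\<^sup>2)" "integrable P (\<lambda>\<omega>. (Y \<omega>)\<^sup>2)"
  shows "integrable P (\<lambda>\<omega>. X \<omega> * Y \<omega>)"
proof (rule Bochner_Integration.integrable_bound)
  show "integrable P (\<lambda>\<omega>. (X \<omega>)\<^sup>2 + (Y \<omega>)\<^sup>2)" using assms by simp
  show "AE \<omega> in P. norm (X \<omega> * Y \<omega>) \<le> norm ((X \<omega>)\<^sup>2 + (Y \<omega>)\<^sup>2)"
  proof (rule AE_I2)
    fix \<omega>
    have "2 * \<bar>X \<omega>\<bar> * \<bar>Y \<omega>\<bar> \<le> \<bar>X \<omega>\<bar>\<^sup>2 + \<bar>Y \<omega>\<bar>\<^sup>2" by (rule sum_squares_bound)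
    moreover have "0 \<le> \<bar>X \<omega>\<bar> * \<bar>Y \<omega>\<bar>" by simp
    ultimately have "\<bar>X \<omega>\<bar> * \<bar>Y \<omega>\<bar> \<le> \<bar>X \<omega>\<bar>\<^sup>2 + \<bar>Y \<omega>\<bar>\<^sup>2" by linarith
    then show "norm (X \<omega> * Y \<omega>) \<le> norm ((X \<omega>)\<^sup>2 + (Y \<omega>)\<^sup>2)" by (simp add: abs_mult)
  qed
qed measurable

lemma integrable_elem_integral_mult:
  assumes "adapted_bounded a \<phi>" "0 \<le> a" "a \<le> b" "b \<le> T"
    and "adapted_bounded c \<psi>" "0 \<le> c" "c \<le> d" "d \<le> T"
  shows "integrable P (\<lambda>\<omega>. elem_integral \<phi> a b \<omega> * elem_integral \<psi> c d \<omega>)"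
  using assms by (intro integrable_mult_of_sq elem_integral_measurable integrable_elem_integral_sq) auto

lemma adapted_bounded_mult_integrable:
  assumes "adapted_bounded a \<phi>" and Y: "integrable P Y"
  shows "integrable P (\<lambda>\<omega>. Y \<omega> * \<phi> \<omega> $ j)"
proof -
  obtain C where C: "0 \<le> C" "\<And>\<omega>. \<omega> \<in> \<Omega> \<Longrightarrow> norm (\<phi> \<omega>) \<le> C"
    using adapted_boundedE[OF assms(1)] by blast
  have [measurable]: "\<phi> \<in> borel_measurable P"
    using adapted_bounded_measurable[OF assms(1) order_refl] by (rule measurable_F_P)
  have [measurable]: "Y \<in> borel_measurable P" using Y by simp
  show ?thesis
  proof (rule Bochner_Integration.integrable_bound)
    show "integrable P (\<lambda>\<omega>. C * norm (Y \<omega>))" using Y by simp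
    show "AE \<omega> in P. norm (Y \<omega> * \<phi> \<omega> $ j) \<le> norm (C * norm (Y \<omega>))"
    proof (rule AE_I2)
      fix \<omega> assume "\<omega> \<in> space P"
      then have "\<bar>\<phi> \<omega> $ j\<bar> \<le> C" using C(2)[of \<omega>] component_le_norm_cart[of "\<phi> \<omega>" j] by auto
      then have "\<bar>\<phi> \<omega> $ j\<bar> * \<bar>Y \<omega>\<bar> \<le> C * \<bar>Y \<omega>\<bar>" by (rule mult_right_mono) simp
      then show "norm (Y \<omega> * \<phi> \<omega> $ j) \<le> norm (C * norm (Y \<omega>))"
        using C by (simp add: abs_mult mult.commute)
    qed
  qed measurable
qed

lemma integrable_elem_integral:
  assumes "adapted_bounded a \<phi>" "0 \<le> a" "a \<le> b" "b \<le> T"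
  shows "integrable P (elem_integral \<phi> a b)"
  using integrable_mult_of_sq[OF elem_integral_measurable[OF assms] _ integrable_elem_integral_sq[OF assms], of "\<lambda>_. 1"]
  by simp

text \<open>Since \<open>b \<le> c\<close>, everything except the increment over
  \<open>{c<..d}\<close> belongs to the past at time \<open>c\<close>, and that increment is
  centred.\<close>

lemma elem_integral_orthogonal:
  assumes \<phi>: "adapted_bounded a \<phi>" and \<psi>: "adapted_bounded c \<psi>"
    and le: "0 \<le> a" "a \<le> b" "b \<le> c" "c \<le> d" "d \<le> T"
  shows "(\<integral>\<omega>. elem_integral \<phi> a b \<omega> * elem_integral \<psi> c d \<omega> \<partial>P) = 0"
proof -
  define Y where "Y = (\<lambda>j \<omega>. elem_integral \<phi> a b \<omega> * \<psi> \<omega> $ j)"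
  have "elem_integral \<phi> a b \<in> borel_measurable (F c)"
    using le by (intro elem_integral_measurable_F \<phi>) auto
  moreover have [measurable]: "\<psi> \<in> borel_measurable (F c)" using \<psi> by (simp add: adapted_bounded_def)
  ultimately have Ym: "Y j \<in> borel_measurable (F c)" for j
    unfolding Y_def by (intro borel_measurable_times measurable_compose[OF _ borel_measurable_vec_nth])
  have Yi: "integrable P (Y j)" for j
    unfolding Y_def using le by (intro adapted_bounded_mult_integrable[OF \<psi>] integrable_elem_integral \<phi>) auto
  have "(\<integral>\<omega>. elem_integral \<phi> a b \<omega> * elem_integral \<psi> c d \<omega> \<partial>P) = (\<integral>\<omega>. (\<Sum>j\<in>UNIV. Y j \<omega> * (\<omega> d - \<omega> c) $ j) \<partial>P)"
    by (simp add: Y_def elem_integral_def[of \<psi>] inner_vec_def sum_distrib_left mult.assoc)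
  also have "\<dots> = (\<Sum>j\<in>UNIV. \<integral>\<omega>. Y j \<omega> * (\<omega> d - \<omega> c) $ j \<partial>P)"
    using le by (intro Bochner_Integration.integral_sum integrable_mult_increment_nth Ym Yi) auto
  also have "\<dots> = 0"
    using le by (intro sum.neutral ballI integral_mult_increment_nth Ym Yi) auto
  finally show ?thesis .
qed

lemma adapted_bounded_inner_integrable:
  assumes \<phi>: "adapted_bounded a \<phi>" and \<psi>: "adapted_bounded c \<psi>"
  shows "integrable P (\<lambda>\<omega>. \<phi> \<omega> \<bullet> \<psi> \<omega>)"
proof -
  have "integrable P (\<lambda>\<omega>. (\<Sum>j\<in>UNIV. 1 * \<phi> \<omega> $ j * \<psi> \<omega> $ j))"
    by (intro Bochner_Integration.integrable_sum adapted_bounded_mult_integrable[OF \<phi>] adapted_bounded_mult_integrable[OF \<psi>]) simp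
  then show ?thesis by (simp add: inner_vec_def)
qed

text \<open>Expanding both inner products produces all products of two coordinates of the same
  increment. Its covariance is \<open>b - a\<close> times the identity, so only the diagonal
  survives and forms the inner product of the integrands.\<close>

lemma elem_integral_isometry_same:
  assumes \<phi>: "adapted_bounded a \<phi>" and \<psi>: "adapted_bounded a \<psi>" and le: "0 \<le> a" "a \<le> b" "b \<le> T"
  shows "(\<integral>\<omega>. elem_integral \<phi> a b \<omega> * elem_integral \<psi> a b \<omega> \<partial>P) = (\<integral>\<omega>. \<phi> \<omega> \<bullet> \<psi> \<omega> \<partial>P) * (b - a)"
proof -
  define Y where "Y = (\<lambda>i j \<omega>. 1 * \<phi> \<omega> $ i * \<psi> \<omega> $ j)"
  have [measurable]: "\<psi> \<in> borel_measurable (F a)" "\<phi> \<in> borel_measurable (F a)"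
    using \<phi> \<psi> by (auto simp: adapted_bounded_def)
  have Ym: "Y i j \<in> borel_measurable (F a)" for i j
    unfolding Y_def by measurable
  have Yi: "integrable P (Y i j)" for i j
    unfolding Y_def by (intro adapted_bounded_mult_integrable[OF \<phi>] adapted_bounded_mult_integrable[OF \<psi>]) simp
  have "(\<integral>\<omega>. elem_integral \<phi> a b \<omega> * elem_integral \<psi> a b \<omega> \<partial>P)
      = (\<integral>\<omega>. (\<Sum>i\<in>UNIV. \<Sum>j\<in>UNIV. Y i j \<omega> * ((\<omega> b - \<omega> a) $ i * (\<omega> b - \<omega> a) $ j)) \<partial>P)"
    by (simp add: Y_def elem_integral_def inner_vec_def sum_product ac_simps)
  also have "\<dots> = (\<Sum>i\<in>UNIV. \<Sum>j\<in>UNIV. \<integral>\<omega>. Y i j \<omega> * ((\<omega> b - \<omega> a) $ i * (\<omega> b - \<omega> a) $ j) \<partial>P)"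
  proof -
    have i: "integrable P (\<lambda>\<omega>. Y i j \<omega> * ((\<omega> b - \<omega> a) $ i * (\<omega> b - \<omega> a) $ j))" for i j
      using le by (intro integrable_mult_increment_nth_nth Ym Yi) auto
    show ?thesis
      by (subst Bochner_Integration.integral_sum[OF Bochner_Integration.integrable_sum[OF i]],
          subst Bochner_Integration.integral_sum[OF i]) (rule refl)
  qed
  also have "\<dots> = (\<Sum>i\<in>UNIV. \<Sum>j\<in>UNIV. (\<integral>\<omega>. Y i j \<omega> \<partial>P) * (if i = j then b - a else 0))"
    using le by (intro sum.cong refl integral_mult_increment_nth_nth Ym Yi) auto
  also have "\<dots> = (\<Sum>i\<in>UNIV. \<integral>\<omega>. Y i i \<omega> \<partial>P) * (b - a)"
    by (simp add: sum_distrib_right if_distrib sum.delta' cong: if_cong)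
  also have "(\<Sum>i\<in>UNIV. \<integral>\<omega>. Y i i \<omega> \<partial>P) = (\<integral>\<omega>. (\<Sum>i\<in>UNIV. Y i i \<omega>) \<partial>P)"
    by (rule Bochner_Integration.integral_sum[symmetric]) (rule Yi)
  finally show ?thesis by (simp add: Y_def inner_vec_def)
qed

lemma elem_integral_split: "elem_integral \<phi> a c \<omega> = elem_integral \<phi> a b \<omega> + elem_integral \<phi> b c \<omega>"
  by (simp add: elem_integral_def inner_diff_right)

text \<open>Both intervals are cut at \<open>c\<close> and at \<open>m = min b d\<close>. Pieces
  over disjoint intervals are orthogonal, and only the common interval \<open>{c<..m}\<close>
  contributes. The factor \<open>max 0 (min b d - max a c)\<close> is the length of the
  overlap.\<close>

lemma elem_integral_isometry_le:
  assumes \<phi>: "adapted_bounded a \<phi>" and \<psi>: "adapted_bounded c \<psi>"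
    and le: "0 \<le> a" "a \<le> b" "b \<le> T" "0 \<le> c" "c \<le> d" "d \<le> T" "a \<le> c"
  shows "(\<integral>\<omega>. elem_integral \<phi> a b \<omega> * elem_integral \<psi> c d \<omega> \<partial>P)
      = (\<integral>\<omega>. \<phi> \<omega> \<bullet> \<psi> \<omega> \<partial>P) * max 0 (min b d - max a c)"
proof (cases "b \<le> c")
  case True
  then show ?thesis
    using elem_integral_orthogonal[OF \<phi> \<psi>] le by (simp add: max_def min_def)
next
  case False
  define m where "m = min b d"
  have m: "c \<le> m" "m \<le> b" "m \<le> d" "m = b \<or> m = d" using False le by (auto simp: m_def min_def)
  let ?I = "elem_integral \<phi>" and ?J = "elem_integral \<psi>"
  have ad: "adapted_bounded c \<phi>" "adapted_bounded m \<phi>" "adapted_bounded m \<psi>"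
    using \<phi> \<psi> m le by (auto intro: adapted_bounded_mono)
  have i: "integrable P (\<lambda>\<omega>. ?I x y \<omega> * ?J z w \<omega>)"
    if "x \<in> {a, c, m}" "x \<le> y" "y \<le> T" "z \<in> {c, m}" "z \<le> w" "w \<le> T" for x y z w
    using that ad \<phi> \<psi> le m by (intro integrable_elem_integral_mult) auto
  have eq: "?I a b \<omega> * ?J c d \<omega>
      = ?I a c \<omega> * ?J c d \<omega> + (?I c m \<omega> * ?J c m \<omega> + (?I c m \<omega> * ?J m d \<omega> + (?I m b \<omega> * ?J c m \<omega> + ?I m b \<omega> * ?J m d \<omega>)))"
    for \<omega>
    using elem_integral_split[of \<phi> a b \<omega> c] elem_integral_split[of \<phi> c b \<omega> m] elem_integral_split[of \<psi> c d \<omega> m]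
    by (simp add: algebra_simps)
  have "(\<integral>\<omega>. ?I a b \<omega> * ?J c d \<omega> \<partial>P)
      = (\<integral>\<omega>. ?I a c \<omega> * ?J c d \<omega> \<partial>P) + ((\<integral>\<omega>. ?I c m \<omega> * ?J c m \<omega> \<partial>P) + ((\<integral>\<omega>. ?I c m \<omega> * ?J m d \<omega> \<partial>P)
        + ((\<integral>\<omega>. ?I m b \<omega> * ?J c m \<omega> \<partial>P) + (\<integral>\<omega>. ?I m b \<omega> * ?J m d \<omega> \<partial>P))))"
  proof -
    have i1: "integrable P (\<lambda>\<omega>. ?I a c \<omega> * ?J c d \<omega>)" "integrable P (\<lambda>\<omega>. ?I c m \<omega> * ?J c m \<omega>)"
      "integrable P (\<lambda>\<omega>. ?I c m \<omega> * ?J m d \<omega>)" "integrable P (\<lambda>\<omega>. ?I m b \<omega> * ?J c m \<omega>)"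
      "integrable P (\<lambda>\<omega>. ?I m b \<omega> * ?J m d \<omega>)"
      using le m by (auto intro!: i)
    show ?thesis
      unfolding eq
      by (subst Bochner_Integration.integral_add; (intro Bochner_Integration.integrable_add i1)?)+ (rule refl)
  qed
  moreover have "(\<integral>\<omega>. ?I a c \<omega> * ?J c d \<omega> \<partial>P) = 0"
    using le by (intro elem_integral_orthogonal \<phi> \<psi>) auto
  moreover have "(\<integral>\<omega>. ?I c m \<omega> * ?J m d \<omega> \<partial>P) = 0"
    using le m by (intro elem_integral_orthogonal ad) auto
  moreover have "(\<integral>\<omega>. ?I m b \<omega> * ?J c m \<omega> \<partial>P) = 0"
    using elem_integral_orthogonal[OF \<psi> ad(2), of m b] le m by (simp add: mult.commute)
  \<comment> \<open>One of the two intervals after \<open>m\<close> is empty, because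
    \<open>m\<close> equals \<open>b\<close> or \<open>d\<close>.\<close>
  moreover have "(\<integral>\<omega>. ?I m b \<omega> * ?J m d \<omega> \<partial>P) = 0"
    using m(4) by (auto simp: elem_integral_def)
  moreover have "(\<integral>\<omega>. ?I c m \<omega> * ?J c m \<omega> \<partial>P) = (\<integral>\<omega>. \<phi> \<omega> \<bullet> \<psi> \<omega> \<partial>P) * (m - c)"
    using le m by (intro elem_integral_isometry_same ad \<psi>) auto
  ultimately show ?thesis using m(1) le by (simp add: m_def max_def)
qed

lemma elem_integral_isometry:
  assumes \<phi>: "adapted_bounded a \<phi>" and \<psi>: "adapted_bounded c \<psi>"
    and le: "0 \<le> a" "a \<le> b" "b \<le> T" "0 \<le> c" "c \<le> d" "d \<le> T"
  shows "(\<integral>\<omega>. elem_integral \<phi> a b \<omega> * elem_integral \<psi> c d \<omega> \<partial>P)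
      = (\<integral>\<omega>. \<phi> \<omega> \<bullet> \<psi> \<omega> \<partial>P) * max 0 (min b d - max a c)"
proof (cases "a \<le> c")
  case True
  then show ?thesis using elem_integral_isometry_le[OF \<phi> \<psi>] le by simp
next
  case False
  then show ?thesis using elem_integral_isometry_le[OF \<psi> \<phi>, of d b] le
    by (simp add: mult.commute inner_commute min.commute max.commute)
qed

lemma emeasure_lborel_Ioc_max: "emeasure lborel {x<..y :: real} = ennreal (max 0 (y - x))"
  by (cases "x \<le> y") (simp_all add: max_def)

lemma integral_indicator_Ioc_mult:
  "has_bochner_integral lborel (\<lambda>s. indicator {a<..b} s * indicator {c<..d} s :: real) (max 0 (min b d - max a c))"
proof -
  have "(\<lambda>s. indicator {a<..b} s * indicator {c<..d} s :: real) = indicator {max a c<..min b d}"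
    by (auto simp: fun_eq_iff indicator_def)
  moreover have "has_bochner_integral lborel (indicator {max a c<..min b d}) (measure lborel {max a c<..min b d})"
    by (rule has_bochner_integral_real_indicator) (simp_all only: emeasure_lborel_Ioc_max ennreal_less_top infinity_ennreal_def, simp)
  moreover have "measure lborel {max a c<..min b d} = max 0 (min b d - max a c)"
    unfolding measure_def emeasure_lborel_Ioc_max by (rule enn2real_ennreal) simp
  ultimately show ?thesis by simp
qed

text \<open>Both sides expand into the same double sum, with the overlap length of the intervals
  \<open>k\<close> and \<open>l\<close> as weight. The intervals may overlap in any way: this is
  what later allows the difference of two simple integrals on unrelated partitions to be treated
  without a common refinement.\<close>

proposition elem_sum_isometry:
  fixes \<phi> :: "'k \<Rightarrow> (real \<Rightarrow> real ^ 'd) \<Rightarrow> real ^ 'd"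
  assumes K: "finite K"
    and \<phi>: "\<And>k. k \<in> K \<Longrightarrow> adapted_bounded (a k) (\<phi> k)"
    and le: "\<And>k. k \<in> K \<Longrightarrow> 0 \<le> a k \<and> a k \<le> b k \<and> b k \<le> T"
  shows "(\<integral>\<^sup>+\<omega>. ennreal ((\<Sum>k\<in>K. elem_integral (\<phi> k) (a k) (b k) \<omega>)\<^sup>2) \<partial>P)
       = (\<integral>\<^sup>+\<omega>. (\<integral>\<^sup>+s. ennreal ((norm (\<Sum>k\<in>K. indicator {a k<..b k} s *\<^sub>R \<phi> k \<omega>))\<^sup>2) \<partial>lborel) \<partial>P)"
proof -
  let ?I = "\<lambda>k. elem_integral (\<phi> k) (a k) (b k)"
  let ?m = "\<lambda>k l. max 0 (min (b k) (b l) - max (a k) (a l))"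
  have int: "integrable P (\<lambda>\<omega>. ?I k \<omega> * ?I l \<omega>)" if "k \<in> K" "l \<in> K" for k l
    using that le \<phi> by (intro integrable_elem_integral_mult) auto
  have intin: "integrable P (\<lambda>\<omega>. \<phi> k \<omega> \<bullet> \<phi> l \<omega>)" if "k \<in> K" "l \<in> K" for k l
    using that \<phi> by (intro adapted_bounded_inner_integrable) auto
  have inner: "(\<integral>\<^sup>+s. ennreal ((norm (\<Sum>k\<in>K. indicator {a k<..b k} s *\<^sub>R \<phi> k \<omega>))\<^sup>2) \<partial>lborel)
      = ennreal (\<Sum>k\<in>K. \<Sum>l\<in>K. (\<phi> k \<omega> \<bullet> \<phi> l \<omega>) * ?m k l)"
    and inner_nn: "0 \<le> (\<Sum>k\<in>K. \<Sum>l\<in>K. (\<phi> k \<omega> \<bullet> \<phi> l \<omega>) * ?m k l)" for \<omega>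
  proof -
    have "(norm (\<Sum>k\<in>K. indicator {a k<..b k} s *\<^sub>R \<phi> k \<omega>))\<^sup>2
        = (\<Sum>k\<in>K. \<Sum>l\<in>K. (\<phi> k \<omega> \<bullet> \<phi> l \<omega>) * (indicator {a k<..b k} s * indicator {a l<..b l} s))" for s
      unfolding power2_norm_eq_inner inner_sum_left inner_sum_right
      by (intro sum.cong refl) (simp add: inner_commute mult_ac)
    moreover have "has_bochner_integral lborel
        (\<lambda>s. \<Sum>k\<in>K. \<Sum>l\<in>K. (\<phi> k \<omega> \<bullet> \<phi> l \<omega>) * (indicator {a k<..b k} s * indicator {a l<..b l} s))
        (\<Sum>k\<in>K. \<Sum>l\<in>K. (\<phi> k \<omega> \<bullet> \<phi> l \<omega>) * ?m k l)"
      by (intro has_bochner_integral_sum has_bochner_integral_mult_right integral_indicator_Ioc_mult)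
    ultimately have h: "has_bochner_integral lborel
        (\<lambda>s. (norm (\<Sum>k\<in>K. indicator {a k<..b k} s *\<^sub>R \<phi> k \<omega>))\<^sup>2) (\<Sum>k\<in>K. \<Sum>l\<in>K. (\<phi> k \<omega> \<bullet> \<phi> l \<omega>) * ?m k l)"
      by simp
    then show "(\<integral>\<^sup>+s. ennreal ((norm (\<Sum>k\<in>K. indicator {a k<..b k} s *\<^sub>R \<phi> k \<omega>))\<^sup>2) \<partial>lborel)
      = ennreal (\<Sum>k\<in>K. \<Sum>l\<in>K. (\<phi> k \<omega> \<bullet> \<phi> l \<omega>) * ?m k l)"
      by (subst nn_integral_eq_integral) (auto simp: has_bochner_integral_iff)
    \<comment> \<open>As the integral of a squared norm the double sum is nonnegative, which the
      passage between \<open>ennreal\<close> and Bochner integrals requires.\<close>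
    show "0 \<le> (\<Sum>k\<in>K. \<Sum>l\<in>K. (\<phi> k \<omega> \<bullet> \<phi> l \<omega>) * ?m k l)"
      unfolding has_bochner_integral_integral_eq[OF h, symmetric] by (rule Bochner_Integration.integral_nonneg) simp
  qed
  have sq: "(\<Sum>k\<in>K. ?I k \<omega>)\<^sup>2 = (\<Sum>k\<in>K. \<Sum>l\<in>K. ?I k \<omega> * ?I l \<omega>)" for \<omega>
    by (simp add: power2_eq_square sum_product)
  have "(\<integral>\<^sup>+\<omega>. ennreal ((\<Sum>k\<in>K. ?I k \<omega>)\<^sup>2) \<partial>P) = ennreal (\<integral>\<omega>. (\<Sum>k\<in>K. ?I k \<omega>)\<^sup>2 \<partial>P)"
    unfolding sq
    by (rule nn_integral_eq_integral)
       (intro Bochner_Integration.integrable_sum int, assumption+, simp add: sq[symmetric])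
  also have "(\<integral>\<omega>. (\<Sum>k\<in>K. ?I k \<omega>)\<^sup>2 \<partial>P) = (\<Sum>k\<in>K. \<Sum>l\<in>K. \<integral>\<omega>. ?I k \<omega> * ?I l \<omega> \<partial>P)"
    unfolding sq
  proof -
    have "(\<integral>\<omega>. (\<Sum>k\<in>K. \<Sum>l\<in>K. ?I k \<omega> * ?I l \<omega>) \<partial>P) = (\<Sum>k\<in>K. \<integral>\<omega>. (\<Sum>l\<in>K. ?I k \<omega> * ?I l \<omega>) \<partial>P)"
      by (intro Bochner_Integration.integral_sum Bochner_Integration.integrable_sum int)
    also have "\<dots> = (\<Sum>k\<in>K. \<Sum>l\<in>K. \<integral>\<omega>. ?I k \<omega> * ?I l \<omega> \<partial>P)"
      by (intro sum.cong refl Bochner_Integration.integral_sum int)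
    finally show "(\<integral>\<omega>. (\<Sum>k\<in>K. \<Sum>l\<in>K. ?I k \<omega> * ?I l \<omega>) \<partial>P) = (\<Sum>k\<in>K. \<Sum>l\<in>K. \<integral>\<omega>. ?I k \<omega> * ?I l \<omega> \<partial>P)" .
  qed
  also have "\<dots> = (\<Sum>k\<in>K. \<Sum>l\<in>K. (\<integral>\<omega>. \<phi> k \<omega> \<bullet> \<phi> l \<omega> \<partial>P) * ?m k l)"
    using le \<phi> by (intro sum.cong refl elem_integral_isometry) auto
  also have "\<dots> = (\<integral>\<omega>. (\<Sum>k\<in>K. \<Sum>l\<in>K. (\<phi> k \<omega> \<bullet> \<phi> l \<omega>) * ?m k l) \<partial>P)"
  proof -
    have i: "integrable P (\<lambda>\<omega>. (\<phi> k \<omega> \<bullet> \<phi> l \<omega>) * ?m k l)" if "k \<in> K" "l \<in> K" for k l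
      using intin[OF that] by (rule integrable_mult_left)
    have "(\<integral>\<omega>. (\<Sum>k\<in>K. \<Sum>l\<in>K. (\<phi> k \<omega> \<bullet> \<phi> l \<omega>) * ?m k l) \<partial>P)
        = (\<Sum>k\<in>K. \<integral>\<omega>. (\<Sum>l\<in>K. (\<phi> k \<omega> \<bullet> \<phi> l \<omega>) * ?m k l) \<partial>P)"
      by (intro Bochner_Integration.integral_sum Bochner_Integration.integrable_sum i)
    also have "\<dots> = (\<Sum>k\<in>K. \<Sum>l\<in>K. \<integral>\<omega>. (\<phi> k \<omega> \<bullet> \<phi> l \<omega>) * ?m k l \<partial>P)"
      by (intro sum.cong refl Bochner_Integration.integral_sum i)
    also have "\<dots> = (\<Sum>k\<in>K. \<Sum>l\<in>K. (\<integral>\<omega>. \<phi> k \<omega> \<bullet> \<phi> l \<omega> \<partial>P) * ?m k l)"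
      by (intro sum.cong refl integral_mult_left_zero)
    finally show ?thesis by simp
  qed
  also have "ennreal \<dots> = (\<integral>\<^sup>+\<omega>. ennreal (\<Sum>k\<in>K. \<Sum>l\<in>K. (\<phi> k \<omega> \<bullet> \<phi> l \<omega>) * ?m k l) \<partial>P)"
    using inner_nn
    by (intro nn_integral_eq_integral[symmetric] Bochner_Integration.integrable_sum integrable_mult_left intin) auto
  finally show ?thesis by (simp add: inner)
qed

text \<open>The last increment is integrated out with the past frozen: its exponential moment is at
  most \<open>exp (C\<^sup>2 / 2 * (r (Suc n) - r n))\<close>, a constant that comes out of the
  expectation, and the induction continues. The bound depends on the partition through its total
  length only.\<close>

proposition exp_moment_bound:
  assumes r: "\<And>k. k < n \<Longrightarrow> 0 \<le> r k \<and> r k \<le> r (Suc k) \<and> r (Suc k) \<le> T"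
    and \<psi>: "\<And>k. k < n \<Longrightarrow> \<psi> k \<in> borel_measurable (F (r k))"
    and C: "\<And>k \<omega>. k < n \<Longrightarrow> \<omega> \<in> \<Omega> \<Longrightarrow> norm (\<psi> k \<omega>) \<le> C"
  shows "(\<integral>\<^sup>+\<omega>. ennreal (exp (\<Sum>k<n. \<psi> k \<omega> \<bullet> (\<omega> (r (Suc k)) - \<omega> (r k)))) \<partial>P)
      \<le> ennreal (exp (C\<^sup>2 / 2 * (\<Sum>k<n. r (Suc k) - r k)))"
  using assms
proof (induction n)
  case 0
  then show ?case by (simp add: emeasure_space_1[simplified])
next
  case (Suc n)
  define Y where "Y = (\<lambda>\<omega>. exp (\<Sum>k<n. \<psi> k \<omega> \<bullet> (\<omega> (r (Suc k)) - \<omega> (r k))))"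
  have rn: "0 \<le> r n" "r n \<le> r (Suc n)" "r (Suc n) \<le> T" using Suc.prems(1)[of n] by auto
  have mono: "k \<le> n \<Longrightarrow> r k \<le> r n" for k
  proof (induction k rule: inc_induct)
    case (step k)
    then show ?case using Suc.prems(1)[of k] by auto
  qed simp
  have IH: "(\<integral>\<^sup>+\<omega>. ennreal (Y \<omega>) \<partial>P) \<le> ennreal (exp (C\<^sup>2 / 2 * (\<Sum>k<n. r (Suc k) - r k)))"
    unfolding Y_def using Suc.prems by (intro Suc.IH) auto
  have "(\<lambda>\<omega>. \<psi> k \<omega> \<bullet> (\<omega> (r (Suc k)) - \<omega> (r k))) \<in> borel_measurable (F (r n))" if "k < n" for k
  proof (rule borel_measurable_inner)
    show "\<psi> k \<in> borel_measurable (F (r n))"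
      using that mono[of k] by (intro measurable_F_mono[OF Suc.prems(2)]) auto
    show "(\<lambda>\<omega>. \<omega> (r (Suc k)) - \<omega> (r k)) \<in> borel_measurable (F (r n))"
      using that mono[of "Suc k"] Suc.prems(1)[of k] by (intro increment_measurable_F) auto
  qed
  then have Ym: "Y \<in> borel_measurable (F (r n))"
    unfolding Y_def by (intro borel_measurable_exp[THEN measurable_compose[rotated]] borel_measurable_sum) auto
  have \<psi>m: "\<psi> n \<in> borel_measurable (F (r n))" using Suc.prems by auto
  note [measurable] = measurable_F_P[OF Ym]
  let ?\<Delta> = "r (Suc n) - r n"
  have "(\<integral>\<^sup>+\<omega>. ennreal (exp (\<Sum>k<Suc n. \<psi> k \<omega> \<bullet> (\<omega> (r (Suc k)) - \<omega> (r k)))) \<partial>P)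
      = (\<integral>\<^sup>+\<omega>. ennreal (Y \<omega>) * ennreal (exp (\<psi> n \<omega> \<bullet> (\<omega> (r (Suc n)) - \<omega> (r n)))) \<partial>P)"
    by (simp add: Y_def exp_add ennreal_mult)
  also have "\<dots> \<le> (\<integral>\<^sup>+\<omega>. ennreal (Y \<omega>) * ennreal (exp (C\<^sup>2 / 2 * ?\<Delta>)) \<partial>P)"
  proof (cases "r n = r (Suc n)")
    case True
    then show ?thesis by simp
  next
    case False
    then have lt: "r n < r (Suc n)" using rn by simp
    let ?g = "\<lambda>z. ennreal (fst (fst z)) * ennreal (exp (snd (fst z) \<bullet> snd z))"
    have "(\<lambda>\<omega>. (Y \<omega>, \<psi> n \<omega>)) \<in> F (r n) \<rightarrow>\<^sub>M borel \<Otimes>\<^sub>M borel"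
      using Ym \<psi>m by (rule measurable_Pair)
    then have "(\<integral>\<^sup>+\<omega>. ?g ((Y \<omega>, \<psi> n \<omega>), \<omega> (r (Suc n)) - \<omega> (r n)) \<partial>P)
        = (\<integral>\<^sup>+\<omega>. (\<integral>\<^sup>+x. ?g ((Y \<omega>, \<psi> n \<omega>), x) * ennreal (gauss_density ?\<Delta> x) \<partial>lborel) \<partial>P)"
      using rn lt by (intro nn_integral_increment) (simp_all, measurable)
    also have "\<dots> = (\<integral>\<^sup>+\<omega>. ennreal (Y \<omega>) * ennreal (exp ((norm (\<psi> n \<omega>))\<^sup>2 * ?\<Delta> / 2)) \<partial>P)"
    proof (rule nn_integral_cong)
      fix \<omega>
      have "(\<integral>\<^sup>+x. ?g ((Y \<omega>, \<psi> n \<omega>), x) * ennreal (gauss_density ?\<Delta> x) \<partial>lborel)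
          = (\<integral>\<^sup>+x. ennreal (Y \<omega>) * ennreal (exp (\<psi> n \<omega> \<bullet> x) * gauss_density ?\<Delta> x) \<partial>lborel)"
        by (simp add: ennreal_mult gauss_density_nonneg mult.assoc)
      also have "\<dots> = ennreal (Y \<omega>) * ennreal (exp ((norm (\<psi> n \<omega>))\<^sup>2 * ?\<Delta> / 2))"
        using lt by (subst nn_integral_cmult) (simp_all add: gauss_mgf)
      finally show "(\<integral>\<^sup>+x. ?g ((Y \<omega>, \<psi> n \<omega>), x) * ennreal (gauss_density ?\<Delta> x) \<partial>lborel)
          = ennreal (Y \<omega>) * ennreal (exp ((norm (\<psi> n \<omega>))\<^sup>2 * ?\<Delta> / 2))" .
    qed
    also have "\<dots> \<le> (\<integral>\<^sup>+\<omega>. ennreal (Y \<omega>) * ennreal (exp (C\<^sup>2 / 2 * ?\<Delta>)) \<partial>P)"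
    proof (rule nn_integral_mono)
      fix \<omega> assume "\<omega> \<in> space P"
      then have "(norm (\<psi> n \<omega>))\<^sup>2 \<le> C\<^sup>2" using Suc.prems(3)[of n \<omega>] by (intro power_mono) auto
      then have "(norm (\<psi> n \<omega>))\<^sup>2 * ?\<Delta> \<le> C\<^sup>2 * ?\<Delta>" using lt by (intro mult_right_mono) auto
      then show "ennreal (Y \<omega>) * ennreal (exp ((norm (\<psi> n \<omega>))\<^sup>2 * ?\<Delta> / 2))
          \<le> ennreal (Y \<omega>) * ennreal (exp (C\<^sup>2 / 2 * ?\<Delta>))"
        by (intro mult_left_mono ennreal_leI) auto
    qed
    finally show ?thesis by simp
  qed
  also have "\<dots> = (\<integral>\<^sup>+\<omega>. ennreal (Y \<omega>) \<partial>P) * ennreal (exp (C\<^sup>2 / 2 * ?\<Delta>))"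
    by (rule nn_integral_multc) measurable
  also have "\<dots> \<le> ennreal (exp (C\<^sup>2 / 2 * (\<Sum>k<n. r (Suc k) - r k))) * ennreal (exp (C\<^sup>2 / 2 * ?\<Delta>))"
    by (intro mult_right_mono IH) simp
  also have "\<dots> = ennreal (exp (C\<^sup>2 / 2 * (\<Sum>k<Suc n. r (Suc k) - r k)))"
    by (simp add: distrib_left exp_add ennreal_mult)
  finally show ?case .
qed

end

section \<open>Approximation by averages over the preceding cell\<close>

text \<open>Nodes of the partition of \<open>[0,u]\<close> into \<open>Suc n\<close> equal cells;
  the successor avoids an empty partition at \<open>n = 0\<close>.\<close>

definition grid :: "real \<Rightarrow> nat \<Rightarrow> nat \<Rightarrow> real" where
  "grid u n k = real k * (u / real (Suc n))"

text \<open>The value on a cell is the average over the preceding one, so that a progressive integrand is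
  turned into an adapted simple one; hence the value \<open>0\<close> on the first cell.\<close>

definition cell_average :: "real \<Rightarrow> nat \<Rightarrow> (real \<Rightarrow> 'b::euclidean_space) \<Rightarrow> nat \<Rightarrow> 'b" where
  "cell_average u n h k =
     (if k = 0 then 0 else (real (Suc n) / u) *\<^sub>R (LBINT x:{grid u n (k - 1)<..grid u n k}. h x))"

definition averaging :: "real \<Rightarrow> nat \<Rightarrow> (real \<Rightarrow> 'b::euclidean_space) \<Rightarrow> real \<Rightarrow> 'b" where
  "averaging u n h s = (\<Sum>k<Suc n. indicator {grid u n k<..grid u n (Suc k)} s *\<^sub>R cell_average u n h k)"

lemma grid_0[simp]: "grid u n 0 = 0" and grid_last[simp]: "grid u n (Suc n) = u"
  by (simp_all add: grid_def)

lemma grid_mono: "0 \<le> u \<Longrightarrow> i \<le> j \<Longrightarrow> grid u n i \<le> grid u n j"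
  unfolding grid_def by (intro mult_right_mono) auto

lemma grid_Suc: "grid u n (Suc k) = grid u n k + u / real (Suc n)"
  by (simp add: grid_def algebra_simps add_divide_distrib)

lemma grid_cell:
  assumes u: "0 < u" and s: "s \<in> {0<..u}"
  obtains k where "k < Suc n" "s \<in> {grid u n k<..grid u n (Suc k)}"
proof -
  have ex: "s \<le> grid u n (Suc n)" using s by simp
  define k where "k = (LEAST k. s \<le> grid u n k)"
  have k: "s \<le> grid u n k" unfolding k_def using ex by (rule LeastI)
  have "k \<le> Suc n" unfolding k_def using ex by (rule Least_le)
  have "k \<noteq> 0" using k s by (metis grid_0 greaterThanAtMost_iff not_le)
  then obtain j where j: "k = Suc j" by (cases k) auto
  have "\<not> s \<le> grid u n j" using not_less_Least[of j "\<lambda>k. s \<le> grid u n k"] j unfolding k_def by simp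
  then show thesis using k j \<open>k \<le> Suc n\<close> by (intro that[of j]) auto
qed

lemma averaging_cell:
  assumes u: "0 < u" and k: "k < Suc n" and s: "s \<in> {grid u n k<..grid u n (Suc k)}"
  shows "averaging u n h s = cell_average u n h k"
proof -
  have ind: "indicator {grid u n j<..grid u n (Suc j)} s = (if j = k then 1 else 0 :: real)" for j
  proof (cases j k rule: linorder_cases)
    case less
    then have "grid u n (Suc j) \<le> grid u n k" using u by (intro grid_mono) auto
    then show ?thesis using s less by (auto simp: indicator_def)
  next
    case greater
    then have "grid u n (Suc k) \<le> grid u n j" using u by (intro grid_mono) auto
    then show ?thesis using s greater by (auto simp: indicator_def)
  qed (use s in auto)
  have "averaging u n h s = (\<Sum>j<Suc n. if j = k then cell_average u n h j else 0)"
    unfolding averaging_def ind by (intro sum.cong) auto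
  then show ?thesis using k by (simp add: sum.delta)
qed

lemma grid_nonneg: "0 \<le> u \<Longrightarrow> 0 \<le> grid u n k"
  using grid_mono[of u 0 k n] by simp

lemma grid_le: "0 \<le> u \<Longrightarrow> k \<le> Suc n \<Longrightarrow> grid u n k \<le> u"
  using grid_mono[of u k "Suc n" n] by simp

lemma averaging_outside:
  assumes "0 < u" "s \<notin> {0<..u}"
  shows "averaging u n h s = 0"
  unfolding averaging_def
proof (intro sum.neutral ballI)
  fix k assume "k \<in> {..<Suc n}"
  then have "0 \<le> grid u n k" "grid u n (Suc k) \<le> u"
    using assms(1) by (auto intro!: grid_nonneg grid_le)
  then have "s \<notin> {grid u n k<..grid u n (Suc k)}" using assms(2) by auto
  then show "indicator {grid u n k<..grid u n (Suc k)} s *\<^sub>R cell_average u n h k = 0"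
    by (simp add: indicator_def)
qed

lemma averaging_measurable[measurable]: "averaging u n h \<in> borel_measurable borel"
  unfolding averaging_def[abs_def] by measurable

lemma bounded_set_integrable:
  fixes h :: "real \<Rightarrow> 'b::euclidean_space"
  assumes "h \<in> borel_measurable borel" "\<And>x. norm (h x) \<le> C"
  shows "set_integrable lborel {a<..b} h"
  unfolding set_integrable_def
  by (rule integrableI_bounded_set_indicator[of _ _ _ C])
     (use assms emeasure_bounded_finite[of "{a<..b}"] in \<open>auto simp: bounded_subset[of "{a..b}"]\<close>)

text \<open>The mean of \<open>h\<close> deviates from \<open>c\<close> by at most the mean
  deviation. With \<open>c = 0\<close> this gives boundedness of the averages, with \<open>c\<close>
  a value of \<open>h\<close> it gives convergence.\<close>

lemma cell_average_close:
  fixes h :: "real \<Rightarrow> 'b::euclidean_space"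
  assumes h: "h \<in> borel_measurable borel" "\<And>x. norm (h x) \<le> C" and u: "0 < u" and k: "0 < k"
    and close: "\<And>x. x \<in> {grid u n (k - 1)<..grid u n k} \<Longrightarrow> norm (h x - c) \<le> \<kappa>"
  shows "norm (cell_average u n h k - c) \<le> \<kappa>"
proof -
  let ?I = "{grid u n (k - 1)<..grid u n k}"
  define \<delta> where "\<delta> = u / real (Suc n)"
  have d: "0 < \<delta>" using u by (simp add: \<delta>_def)
  have len: "grid u n k = grid u n (k - 1) + \<delta>" using grid_Suc[of u n "k - 1"] k by (simp add: \<delta>_def)
  have m: "measure lborel ?I = \<delta>" using d len by (simp add: measure_def)
  have fin: "emeasure lborel ?I < \<infinity>" using d len by simp
  have inth: "set_integrable lborel ?I h" by (rule bounded_set_integrable[OF h])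
  have intc: "set_integrable lborel ?I (\<lambda>_. c)"
    by (rule bounded_set_integrable[of _ "norm c"]) auto
  have "(LBINT x:?I. h x - c) = (LBINT x:?I. h x) - \<delta> *\<^sub>R c"
    using set_integral_diff(2)[OF inth intc] m fin unfolding set_lebesgue_integral_def by simp
  then have eq: "cell_average u n h k - c = (1 / \<delta>) *\<^sub>R (LBINT x:?I. h x - c)"
    using k d u by (simp add: cell_average_def \<delta>_def scaleR_diff_right)
  have "norm (LBINT x:?I. h x - c) \<le> (LBINT x:?I. norm (h x - c))"
    by (rule set_integral_norm_bound[OF set_integral_diff(1)[OF inth intc]])
  also have "\<dots> \<le> (LBINT x:?I. \<kappa>)"
    by (rule set_integral_mono[OF set_integrable_norm[OF set_integral_diff(1)[OF inth intc]]
          bounded_set_integrable[of _ "\<bar>\<kappa>\<bar>"]])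
       (use close in auto)
  also have "\<dots> = \<delta> * \<kappa>" using m fin unfolding set_lebesgue_integral_def by simp
  finally show ?thesis unfolding eq using d by (simp add: divide_simps mult.commute)
qed

lemma cell_average_bounded:
  fixes h :: "real \<Rightarrow> 'b::euclidean_space"
  assumes "h \<in> borel_measurable borel" "\<And>x. norm (h x) \<le> C" "0 < u"
  shows "norm (cell_average u n h k) \<le> C"
proof (cases "k = 0")
  case True
  then show ?thesis using order_trans[OF norm_ge_zero assms(2)[of 0]] by (simp add: cell_average_def)
next
  case False
  then show ?thesis using cell_average_close[OF assms(1,2,3), of k n 0 C] assms(2) by simp
qed

lemma averaging_bounded:
  fixes h :: "real \<Rightarrow> 'b::euclidean_space"
  assumes "h \<in> borel_measurable borel" "\<And>x. norm (h x) \<le> C" "0 < u"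
  shows "norm (averaging u n h s) \<le> C"
proof (cases "s \<in> {0<..u}")
  case True
  then obtain k where "k < Suc n" "s \<in> {grid u n k<..grid u n (Suc k)}"
    using grid_cell[OF assms(3)] by blast
  then show ?thesis using averaging_cell[OF assms(3)] cell_average_bounded[OF assms] by metis
next
  case False
  then show ?thesis
    using order_trans[OF norm_ge_zero assms(2)[of 0]] by (simp add: averaging_outside[OF assms(3)])
qed

lemma averaging_diff:
  fixes h g :: "real \<Rightarrow> 'b::euclidean_space"
  assumes "h \<in> borel_measurable borel" "\<And>x. norm (h x) \<le> C"
    and "g \<in> borel_measurable borel" "\<And>x. norm (g x) \<le> C"
  shows "averaging u n h s - averaging u n g s = averaging u n (\<lambda>x. h x - g x) s"
proof -
  have "cell_average u n h k - cell_average u n g k = cell_average u n (\<lambda>x. h x - g x) k" for k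
    using set_integral_diff(2)[OF bounded_set_integrable[OF assms(1,2)] bounded_set_integrable[OF assms(3,4)]]
    by (simp add: cell_average_def scaleR_diff_right)
  then show ?thesis
    unfolding averaging_def by (simp only: sum_subtractf[symmetric] scaleR_diff_right[symmetric])
qed

text \<open>Averaging contracts the L1 norm: the integral over each cell is spread over the next
  cell. The bound is uniform in \<open>n\<close>, which carries convergence over from continuous
  functions to bounded measurable ones.\<close>

lemma nn_integral_averaging_le:
  fixes h :: "real \<Rightarrow> 'b::euclidean_space"
  assumes h[measurable]: "h \<in> borel_measurable borel" and C: "\<And>x. norm (h x) \<le> C" and u: "0 < u"
  shows "(\<integral>\<^sup>+s. ennreal (norm (averaging u n h s)) \<partial>lborel) \<le> (\<integral>\<^sup>+s\<in>{0..u}. ennreal (norm (h s)) \<partial>lborel)"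
proof -
  let ?I = "\<lambda>k. {grid u n k<..grid u n (Suc k)}"
  define \<delta> where "\<delta> = u / real (Suc n)"
  have d: "0 < \<delta>" using u by (simp add: \<delta>_def)
  have cell: "ennreal \<delta> * ennreal (norm (cell_average u n h (Suc k))) \<le> (\<integral>\<^sup>+s. ennreal (norm (h s)) * indicator (?I k) s \<partial>lborel)" for k
  proof -
    have int: "set_integrable lborel (?I k) h" by (rule bounded_set_integrable[OF h C])
    have "\<delta> * norm (cell_average u n h (Suc k)) = norm (LBINT x:?I k. h x)"
      using d u by (simp add: cell_average_def \<delta>_def)
    also have "\<dots> \<le> (LBINT x:?I k. norm (h x))" by (rule set_integral_norm_bound[OF int])
    finally have "ennreal (\<delta> * norm (cell_average u n h (Suc k))) \<le> ennreal (LBINT x:?I k. norm (h x))"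
      by (rule ennreal_leI)
    also have "\<dots> = (\<integral>\<^sup>+x. ennreal (norm (h x)) * indicator (?I k) x \<partial>lborel)"
      using set_integrable_norm[OF int] unfolding set_lebesgue_integral_def set_integrable_def
      by (subst nn_integral_eq_integral[symmetric]) (auto intro!: nn_integral_cong simp: indicator_def)
    finally show ?thesis using d by (simp add: ennreal_mult)
  qed
  have "(\<integral>\<^sup>+s. ennreal (norm (averaging u n h s)) \<partial>lborel)
      \<le> (\<integral>\<^sup>+s. (\<Sum>k<Suc n. ennreal (norm (cell_average u n h k)) * indicator (?I k) s) \<partial>lborel)"
  proof (rule nn_integral_mono)
    fix s
    have "norm (averaging u n h s) \<le> (\<Sum>k<Suc n. norm (indicator (?I k) s *\<^sub>R cell_average u n h k))"
      unfolding averaging_def by (rule norm_sum)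
    then have "ennreal (norm (averaging u n h s)) \<le> ennreal (\<Sum>k<Suc n. norm (cell_average u n h k) * indicator (?I k) s)"
      by (intro ennreal_leI) (simp add: mult.commute)
    also have "\<dots> = (\<Sum>k<Suc n. ennreal (norm (cell_average u n h k)) * indicator (?I k) s)"
      by (subst sum_ennreal[symmetric]) (auto simp: ennreal_mult ennreal_indicator)
    finally show "ennreal (norm (averaging u n h s)) \<le> (\<Sum>k<Suc n. ennreal (norm (cell_average u n h k)) * indicator (?I k) s)" .
  qed
  also have "\<dots> = (\<Sum>k<Suc n. ennreal (norm (cell_average u n h k)) * ennreal \<delta>)"
    using d by (subst nn_integral_sum) (auto simp: nn_integral_cmult grid_Suc \<delta>_def)
  \<comment> \<open>The first cell carries the value \<open>0\<close> and drops out. After the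
    shift, the average on cell \<open>Suc k\<close> is paired with the integral over cell
    \<open>k\<close>; the integral over the last cell never enters.\<close>
  also have "\<dots> = (\<Sum>k<n. ennreal \<delta> * ennreal (norm (cell_average u n h (Suc k))))"
    by (subst sum.lessThan_Suc_shift) (simp add: cell_average_def mult.commute)
  also have "\<dots> \<le> (\<Sum>k<n. \<integral>\<^sup>+s. ennreal (norm (h s)) * indicator (?I k) s \<partial>lborel)"
    by (intro sum_mono cell)
  also have "\<dots> = (\<integral>\<^sup>+s. (\<Sum>k<n. ennreal (norm (h s)) * indicator (?I k) s) \<partial>lborel)"
    by (subst nn_integral_sum) auto
  also have "\<dots> \<le> (\<integral>\<^sup>+s\<in>{0..u}. ennreal (norm (h s)) \<partial>lborel)"
  proof (rule nn_integral_mono)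
    fix s
    have "(\<Sum>k<n. indicator (?I k) s) = (indicator (\<Union>k<n. ?I k) s :: ennreal)"
    proof (rule indicator_UN_disjoint[symmetric])
      show "disjoint_family_on ?I {..<n}"
        unfolding disjoint_family_on_def
      proof (intro ballI impI)
        fix i j :: nat assume "i \<noteq> j"
        have "?I i \<inter> ?I j = {}" if "i < j" for i j
          using grid_mono[of u "Suc i" j n] that u by force
        then show "?I i \<inter> ?I j = {}" using \<open>i \<noteq> j\<close> by (metis Int_commute linorder_neqE_nat)
      qed
    qed simp
    moreover have "(\<Union>k<n. ?I k) \<subseteq> {0..u}"
    proof clarify
      fix k x assume "k < n" "x \<in> ?I k"
      then show "x \<in> {0..u}"
        using grid_nonneg[of u n k] grid_le[of u "Suc k" n] u by auto
    qed
    then have "(indicator (\<Union>k<n. ?I k) s :: ennreal) \<le> indicator {0..u} s"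
      by (metis (no_types, lifting) indicator_leI subsetD)
    ultimately show "(\<Sum>k<n. ennreal (norm (h s)) * indicator (?I k) s) \<le> ennreal (norm (h s)) * indicator {0..u} s"
      by (simp add: sum_distrib_left[symmetric] mult_left_mono)
  qed
  finally show ?thesis .
qed

text \<open>A point and the cell preceding its own cell lie within two mesh widths of each
  other.\<close>

lemma averaging_tendsto_continuous:
  fixes g :: "real \<Rightarrow> 'b::euclidean_space"
  assumes g: "continuous_on UNIV g" and C: "\<And>x. norm (g x) \<le> C" and u: "0 < u" and s: "s \<in> {0<..u}"
  shows "(\<lambda>n. averaging u n g s) \<longlonglongrightarrow> g s"
proof (rule tendstoI)
  fix e :: real assume "0 < e"
  have gm: "g \<in> borel_measurable borel" using g by (rule borel_measurable_continuous_onI)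
  have "isCont g s" using g by (simp add: continuous_on_eq_continuous_at)
  then obtain d where d: "0 < d" "\<And>x. dist x s < d \<Longrightarrow> dist (g x) (g s) < e / 2"
    using \<open>0 < e\<close> unfolding continuous_at_eps_delta by (metis half_gt_zero)
  have "(\<lambda>n. 2 * u / real (Suc n)) \<longlonglongrightarrow> 0"
    using LIMSEQ_Suc[OF lim_const_over_n[of "2 * u"]] by simp
  \<comment> \<open>Besides continuity at distance \<open>d\<close>, the mesh must be finer than
    \<open>s\<close>, so that \<open>s\<close> has left the first cell, where the average is set to
    \<open>0\<close>.\<close>
  then have "\<forall>\<^sub>F n in sequentially. 2 * u / real (Suc n) < min d s"
    using d s by (intro order_tendstoD) auto
  then show "\<forall>\<^sub>F n in sequentially. dist (averaging u n g s) (g s) < e"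
  proof eventually_elim
    case (elim n)
    obtain k where k: "k < Suc n" "s \<in> {grid u n k<..grid u n (Suc k)}"
      using grid_cell[OF u s] by blast
    have "k \<noteq> 0"
    proof
      assume "k = 0"
      then have "s \<le> u / real (Suc n)" using k by (simp add: grid_Suc)
      moreover have "u / real (Suc n) \<le> 2 * u / real (Suc n)" using u by (simp add: divide_right_mono)
      ultimately show False using elim by simp
    qed
    then have eq: "grid u n k = grid u n (k - 1) + u / real (Suc n)"
      using grid_Suc[of u n "k - 1"] by simp
    have "norm (cell_average u n g k - g s) \<le> e / 2"
    proof (rule cell_average_close[OF gm C u])
      fix x assume "x \<in> {grid u n (k - 1)<..grid u n k}"
      then have "\<bar>x - s\<bar> < 2 * u / real (Suc n)"
        using k(2) unfolding grid_Suc eq by (auto simp: abs_if)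
      then show "norm (g x - g s) \<le> e / 2"
        using d(2)[of x] elim by (simp add: dist_norm)
    qed (use \<open>k \<noteq> 0\<close> in simp)
    moreover have "averaging u n g s = cell_average u n g k" by (rule averaging_cell[OF u k])
    ultimately show ?case
      using \<open>0 < e\<close> by (simp add: dist_norm)
  qed
qed

lemma ennreal_tendsto_zeroI:
  fixes f :: "nat \<Rightarrow> ennreal"
  assumes "\<And>e :: real. 0 < e \<Longrightarrow> \<forall>\<^sub>F n in sequentially. f n \<le> ennreal e"
  shows "f \<longlonglongrightarrow> 0"
proof (rule order_tendstoI)
  fix a :: ennreal assume "0 < a"
  then obtain e where e: "0 < e" "ennreal e < a"
    by (metis ennreal_less_zero_iff ennreal_cases dense ennreal_0 less_ennreal.rep_eq less_top top_greatest zero_less_iff_neq_zero ennreal_eq_0_iff not_le)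
  then show "\<forall>\<^sub>F n in sequentially. f n < a"
    using assms[OF e(1)] by (auto elim!: eventually_mono)
qed simp

text \<open>Density argument: \<open>h\<close> is approximated in L1 by a bounded continuous
  \<open>g m\<close>, for which the averages converge pointwise, and the contraction property
  controls the average of the remainder \<open>h - g m\<close>.\<close>

lemma averaging_tendsto_L1:
  fixes h :: "real \<Rightarrow> 'b::euclidean_space"
  assumes h[measurable]: "h \<in> borel_measurable borel" and C: "\<And>x. norm (h x) \<le> C" and u: "0 < u"
  shows "(\<lambda>n. \<integral>\<^sup>+s\<in>{0..u}. ennreal (norm (h s - averaging u n h s)) \<partial>lborel) \<longlonglongrightarrow> 0"
proof (rule ennreal_tendsto_zeroI)
  fix e :: real assume e: "0 < e"
  have C0: "0 \<le> C" using C[of 0] norm_ge_zero order_trans by blast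
  \<comment> \<open>By definition, \<open>measurable_on\<close> provides continuous functions that
    converge to \<open>h\<close> outside a negligible set.\<close>
  have "h measurable_on UNIV"
    by (intro lebesgue_measurable_imp_measurable_on measurable_completion) auto
  then obtain N g0 where N: "negligible N" and g0: "\<And>n. continuous_on UNIV (g0 n)"
    and lim0: "\<And>x. x \<notin> N \<Longrightarrow> (\<lambda>n. g0 n x) \<longlonglongrightarrow> h x"
    unfolding measurable_on_def by auto
  \<comment> \<open>Projecting onto the ball of radius \<open>C\<close> leaves \<open>h\<close>
    unchanged and bounds the approximations, so that dominated convergence applies.\<close>
  define p where "p = closest_point (cball (0 :: 'b) C)"
  have pc: "continuous_on UNIV p"
    unfolding p_def using C0 by (intro continuous_on_closest_point) auto
  define g where "g = (\<lambda>n x. p (g0 n x))"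
  have gc: "continuous_on UNIV (g n)" for n
    unfolding g_def using g0 continuous_on_subset[OF pc] by (intro continuous_on_compose2[OF pc g0]) auto
  have [measurable]: "g n \<in> borel_measurable borel" for n
    using gc by (rule borel_measurable_continuous_onI)
  have gC: "norm (g n x) \<le> C" for n x
    using closest_point_in_set[of "cball (0 :: 'b) C" "g0 n x"] C0 by (simp add: g_def p_def)
  have lim: "(\<lambda>n. g n x) \<longlonglongrightarrow> h x" if "x \<notin> N" for x
  proof -
    have "isCont p (h x)" using pc by (simp add: continuous_on_eq_continuous_at)
    then have "(\<lambda>n. p (g0 n x)) \<longlonglongrightarrow> p (h x)" using lim0[OF that] by (rule isCont_tendsto_compose)
    moreover have "p (h x) = h x" unfolding p_def using C by (intro closest_point_self) simp
    ultimately show ?thesis by (simp add: g_def)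
  qed
  have AE: "AE x in lborel. x \<notin> N"
  proof -
    have "N \<in> null_sets lebesgue" using N by (simp add: negligible_iff_null_sets)
    then have "AE x in lebesgue. x \<notin> N" by (rule AE_not_in)
    then show ?thesis by (simp add: AE_completion_iff)
  qed
  have fin: "(\<integral>\<^sup>+s. ennreal (2 * C) * indicator {0..u} s \<partial>lborel) < \<infinity>"
    using u by (simp add: nn_integral_cmult ennreal_mult_less_top)
  have "(\<lambda>m. \<integral>\<^sup>+s\<in>{0..u}. ennreal (norm (h s - g m s)) \<partial>lborel) \<longlonglongrightarrow> (\<integral>\<^sup>+s. 0 \<partial>(lborel :: real measure))"
  proof (rule nn_integral_dominated_convergence[where w="\<lambda>s. ennreal (2 * C) * indicator {0..u} s" and u'="\<lambda>_. 0"])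
    show "(\<integral>\<^sup>+s. ennreal (2 * C) * indicator {0..u} s \<partial>lborel) < \<infinity>" by (rule fin)
    show "AE s in lborel. ennreal (norm (h s - g m s)) * indicator {0..u} s \<le> ennreal (2 * C) * indicator {0..u} s" for m
    proof (rule AE_I2)
      fix s
      have "norm (h s - g m s) \<le> 2 * C" using norm_triangle_ineq4[of "h s" "g m s"] C[of s] gC[of m s] by simp
      then show "ennreal (norm (h s - g m s)) * indicator {0..u} s \<le> ennreal (2 * C) * indicator {0..u} s"
        by (intro mult_right_mono ennreal_leI) auto
    qed
    show "AE s in lborel. (\<lambda>m. ennreal (norm (h s - g m s)) * indicator {0..u} s) \<longlonglongrightarrow> 0"
      using AE
    proof eventually_elim
      case (elim s)
      have "(\<lambda>m. norm (h s - g m s)) \<longlonglongrightarrow> norm (h s - h s)"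
        by (intro tendsto_intros lim elim)
      then have "(\<lambda>m. ennreal (norm (h s - g m s))) \<longlonglongrightarrow> 0" by (simp add: tendsto_ennrealI[where x=0, simplified])
      then show ?case by (auto simp: indicator_def)
    qed
  qed measurable
  then have "\<forall>\<^sub>F m in sequentially. (\<integral>\<^sup>+s\<in>{0..u}. ennreal (norm (h s - g m s)) \<partial>lborel) < ennreal (e / 3)"
    using e by (intro order_tendstoD) (auto simp: zero_less_iff_neq_zero)
  then obtain m where m: "(\<integral>\<^sup>+s\<in>{0..u}. ennreal (norm (h s - g m s)) \<partial>lborel) < ennreal (e / 3)"
    by (auto simp: eventually_sequentially)
  have "(\<lambda>n. \<integral>\<^sup>+s\<in>{0..u}. ennreal (norm (g m s - averaging u n (g m) s)) \<partial>lborel) \<longlonglongrightarrow> (\<integral>\<^sup>+s. 0 \<partial>(lborel :: real measure))"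
  proof (rule nn_integral_dominated_convergence[where w="\<lambda>s. ennreal (2 * C) * indicator {0..u} s" and u'="\<lambda>_. 0"])
    show "(\<integral>\<^sup>+s. ennreal (2 * C) * indicator {0..u} s \<partial>lborel) < \<infinity>" by (rule fin)
    show "AE s in lborel. ennreal (norm (g m s - averaging u n (g m) s)) * indicator {0..u} s \<le> ennreal (2 * C) * indicator {0..u} s" for n
    proof (rule AE_I2)
      fix s
      have "norm (g m s - averaging u n (g m) s) \<le> 2 * C"
        using norm_triangle_ineq4[of "g m s" "averaging u n (g m) s"] gC[of m s] averaging_bounded[of "g m" C u n s, OF _ gC u] by simp
      then show "ennreal (norm (g m s - averaging u n (g m) s)) * indicator {0..u} s \<le> ennreal (2 * C) * indicator {0..u} s"
        by (intro mult_right_mono ennreal_leI) auto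
    qed
    \<comment> \<open>At \<open>s = 0\<close> the average is always \<open>0\<close> and need not
      converge to the value of \<open>g m\<close>.\<close>
    have "AE s in lborel. s \<noteq> (0::real)" by (rule AE_lborel_singleton)
    then show "AE s in lborel. (\<lambda>n. ennreal (norm (g m s - averaging u n (g m) s)) * indicator {0..u} s) \<longlonglongrightarrow> 0"
    proof eventually_elim
      case (elim s)
      show ?case
      proof (cases "s \<in> {0..u}")
        case True
        then have "(\<lambda>n. norm (g m s - averaging u n (g m) s)) \<longlonglongrightarrow> norm (g m s - g m s)"
          using elim by (intro tendsto_intros averaging_tendsto_continuous[OF gc gC u]) auto
        then have "(\<lambda>n. ennreal (norm (g m s - averaging u n (g m) s))) \<longlonglongrightarrow> 0" by (simp add: tendsto_ennrealI[where x=0, simplified])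
        then show ?thesis using True by simp
      qed simp
    qed
  qed measurable
  then have "\<forall>\<^sub>F n in sequentially. (\<integral>\<^sup>+s\<in>{0..u}. ennreal (norm (g m s - averaging u n (g m) s)) \<partial>lborel) < ennreal (e / 3)"
    using e by (intro order_tendstoD) (auto simp: zero_less_iff_neq_zero)
  then show "\<forall>\<^sub>F n in sequentially. (\<integral>\<^sup>+s\<in>{0..u}. ennreal (norm (h s - averaging u n h s)) \<partial>lborel) \<le> ennreal e"
  proof eventually_elim
    case (elim n)
    let ?d = "\<lambda>x. h x - g m x"
    have dm: "?d \<in> borel_measurable borel" by measurable
    have dC: "norm (?d x) \<le> 2 * C" for x
      using norm_triangle_ineq4[of "h x" "g m x"] C[of x] gC[of m x] by simp
    have "(\<integral>\<^sup>+s\<in>{0..u}. ennreal (norm (h s - averaging u n h s)) \<partial>lborel)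
        \<le> (\<integral>\<^sup>+s. (ennreal (norm (h s - g m s)) * indicator {0..u} s
            + ennreal (norm (g m s - averaging u n (g m) s)) * indicator {0..u} s)
            + ennreal (norm (averaging u n ?d s)) \<partial>lborel)"
    proof (rule nn_integral_mono)
      fix s
      have "averaging u n h s - averaging u n (g m) s = averaging u n ?d s"
        by (rule averaging_diff[OF h C _ gC]) measurable
      then have "h s - averaging u n h s = (h s - g m s) + (g m s - averaging u n (g m) s) - averaging u n ?d s"
        by (simp add: algebra_simps)
      then have eq: "h s - averaging u n h s = (h s - g m s) + (g m s - averaging u n (g m) s) - averaging u n ?d s" .
      have "norm (h s - averaging u n h s)
          \<le> norm (h s - g m s) + norm (g m s - averaging u n (g m) s) + norm (averaging u n ?d s)"
        unfolding eq
        using norm_triangle_ineq4[of "(h s - g m s) + (g m s - averaging u n (g m) s)" "averaging u n ?d s"]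
          norm_triangle_ineq[of "h s - g m s" "g m s - averaging u n (g m) s"] by linarith
      then have "ennreal (norm (h s - averaging u n h s))
          \<le> ennreal (norm (h s - g m s)) + ennreal (norm (g m s - averaging u n (g m) s)) + ennreal (norm (averaging u n ?d s))"
        by (simp add: ennreal_plus[symmetric] ennreal_leI del: ennreal_plus)
      then show "ennreal (norm (h s - averaging u n h s)) * indicator {0..u} s
          \<le> (ennreal (norm (h s - g m s)) * indicator {0..u} s
            + ennreal (norm (g m s - averaging u n (g m) s)) * indicator {0..u} s)
            + ennreal (norm (averaging u n ?d s))"
        by (auto simp: indicator_def)
    qed
    also have "\<dots> = (\<integral>\<^sup>+s\<in>{0..u}. ennreal (norm (h s - g m s)) \<partial>lborel)
        + (\<integral>\<^sup>+s\<in>{0..u}. ennreal (norm (g m s - averaging u n (g m) s)) \<partial>lborel)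
        + (\<integral>\<^sup>+s. ennreal (norm (averaging u n ?d s)) \<partial>lborel)"
    proof -
      have 1: "(\<lambda>s. ennreal (norm (h s - g m s)) * indicator {0..u} s) \<in> borel_measurable lborel"
        and 2: "(\<lambda>s. ennreal (norm (g m s - averaging u n (g m) s)) * indicator {0..u} s) \<in> borel_measurable lborel"
        and 3: "(\<lambda>s. ennreal (norm (averaging u n ?d s))) \<in> borel_measurable lborel"
        by measurable
      show ?thesis
        by (simp only: nn_integral_add[OF borel_measurable_add[OF 1 2] 3] nn_integral_add[OF 1 2])
    qed
    also have "\<dots> \<le> ennreal (e / 3) + ennreal (e / 3) + ennreal (e / 3)"
      using nn_integral_averaging_le[OF dm dC u, of n] m elim
      by (intro add_mono) auto
    also have "\<dots> = ennreal e" using e by (simp add: ennreal_plus[symmetric] del: ennreal_plus)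
    finally show ?case .
  qed
qed

text \<open>For bounded functions L1 convergence implies L2 convergence: one factor of the square is
  at most \<open>2 * C\<close>.\<close>

lemma averaging_tendsto_L2:
  fixes h :: "real \<Rightarrow> 'b::euclidean_space"
  assumes h[measurable]: "h \<in> borel_measurable borel" and C: "\<And>x. norm (h x) \<le> C" and u: "0 < u"
  shows "(\<lambda>n. \<integral>\<^sup>+s\<in>{0..u}. ennreal ((norm (h s - averaging u n h s))\<^sup>2) \<partial>lborel) \<longlonglongrightarrow> 0"
proof (rule tendsto_sandwich[where f="\<lambda>_. 0", rotated 2])
  show "(\<lambda>n. ennreal (2 * C) * (\<integral>\<^sup>+s\<in>{0..u}. ennreal (norm (h s - averaging u n h s)) \<partial>lborel)) \<longlonglongrightarrow> 0"
    using ennreal_tendsto_cmult[OF _ averaging_tendsto_L1[OF h C u], of "ennreal (2 * C)"] by simp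
  show "\<forall>\<^sub>F n in sequentially. (\<integral>\<^sup>+s\<in>{0..u}. ennreal ((norm (h s - averaging u n h s))\<^sup>2) \<partial>lborel)
      \<le> ennreal (2 * C) * (\<integral>\<^sup>+s\<in>{0..u}. ennreal (norm (h s - averaging u n h s)) \<partial>lborel)"
  proof (rule always_eventually, rule allI)
    fix n
    have "(\<integral>\<^sup>+s\<in>{0..u}. ennreal ((norm (h s - averaging u n h s))\<^sup>2) \<partial>lborel)
        \<le> (\<integral>\<^sup>+s. ennreal (2 * C) * (ennreal (norm (h s - averaging u n h s)) * indicator {0..u} s) \<partial>lborel)"
    proof (rule nn_integral_mono)
      fix s
      have "norm (h s - averaging u n h s) \<le> 2 * C"
        using norm_triangle_ineq4[of "h s" "averaging u n h s"] C[of s] averaging_bounded[OF h C u, of n s] by simp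
      then have "norm (h s - averaging u n h s) * norm (h s - averaging u n h s) \<le> 2 * C * norm (h s - averaging u n h s)"
        by (rule mult_right_mono) simp
      moreover have "0 \<le> 2 * C" using C[of 0] norm_ge_zero[of "h 0"] by linarith
      ultimately have "ennreal ((norm (h s - averaging u n h s))\<^sup>2) \<le> ennreal (2 * C) * ennreal (norm (h s - averaging u n h s))"
        by (simp add: power2_eq_square ennreal_mult[symmetric] ennreal_leI)
      then show "ennreal ((norm (h s - averaging u n h s))\<^sup>2) * indicator {0..u} s
          \<le> ennreal (2 * C) * (ennreal (norm (h s - averaging u n h s)) * indicator {0..u} s)"
        by (simp add: mult.assoc[symmetric] mult_right_mono)
    qed
    also have "\<dots> = ennreal (2 * C) * (\<integral>\<^sup>+s\<in>{0..u}. ennreal (norm (h s - averaging u n h s)) \<partial>lborel)"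
      by (rule nn_integral_cmult) measurable
    finally show "(\<integral>\<^sup>+s\<in>{0..u}. ennreal ((norm (h s - averaging u n h s))\<^sup>2) \<partial>lborel)
      \<le> ennreal (2 * C) * (\<integral>\<^sup>+s\<in>{0..u}. ennreal (norm (h s - averaging u n h s)) \<partial>lborel)" .
  qed
qed (rule tendsto_const, simp)

section \<open>Existence and stability of the Ito integral\<close>

text \<open>Completeness of L2 by the Riesz-Fischer argument. The subsequence is part of the
  conclusion because its almost sure convergence is used later to pass exponential moments to the
  limit by Fatou.\<close>

lemma (in finite_measure) L2_Cauchy_limit:
  fixes I :: "nat \<Rightarrow> 'a \<Rightarrow> real" and \<delta> :: "nat \<Rightarrow> ennreal"
  assumes meas[measurable]: "\<And>n. I n \<in> borel_measurable M"
    and Cauchy: "\<And>n m. (\<integral>\<^sup>+x. ennreal ((I n x - I m x)\<^sup>2) \<partial>M) \<le> \<delta> n + \<delta> m"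
    and \<delta>: "\<delta> \<longlonglongrightarrow> 0"
  obtains X \<rho> where "X \<in> borel_measurable M" "strict_mono (\<rho> :: nat \<Rightarrow> nat)"
    "AE x in M. (\<lambda>k. I (\<rho> k) x) \<longlonglongrightarrow> X x"
    "(\<lambda>k. \<integral>\<^sup>+x. ennreal ((X x - I (\<rho> k) x)\<^sup>2) \<partial>M) \<longlonglongrightarrow> 0"
proof -
  \<comment> \<open>With squared distances of order \<open>(1/4)^k\<close>, consecutive differences
    have L1 norms of order \<open>(1/2)^k\<close>, which are summable.\<close>
  have ev: "\<forall>\<^sub>F n in sequentially. \<delta> n < ennreal ((1/4)^k)" for k
    by (rule order_tendstoD(2)[OF \<delta>]) simp
  have "\<exists>\<rho>. \<forall>k. \<delta> (\<rho> k) < ennreal ((1/4)^k) \<and> \<rho> k < \<rho> (Suc k)"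
  proof (rule dependent_nat_choice)
    show "\<exists>x. \<delta> x < ennreal ((1/4)^0)"
      using ev[of 0] by (auto simp: eventually_sequentially)
    fix x k
    have "\<forall>\<^sub>F n in sequentially. \<delta> n < ennreal ((1/4)^Suc k) \<and> x < n"
      using ev[of "Suc k"] eventually_gt_at_top[of x] by eventually_elim simp
    then show "\<exists>y. \<delta> y < ennreal ((1/4)^Suc k) \<and> x < y"
      by (auto simp: eventually_sequentially)
  qed
  then obtain \<rho> where \<rho>: "\<And>k. \<delta> (\<rho> k) < ennreal ((1/4)^k)" "\<And>k. \<rho> k < \<rho> (Suc k)" by auto
  have mono: "strict_mono \<rho>" using \<rho>(2) by (simp add: strict_mono_Suc_iff)
  have near: "(\<integral>\<^sup>+x. ennreal ((I (\<rho> j) x - I (\<rho> k) x)\<^sup>2) \<partial>M) \<le> ennreal (2 * (1/4)^k)" if "k \<le> j" for j k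
  proof -
    have "(1/4 :: real)^j \<le> (1/4)^k" using that by (intro power_decreasing) auto
    then have "\<delta> (\<rho> j) + \<delta> (\<rho> k) \<le> ennreal ((1/4)^k) + ennreal ((1/4)^k)"
      using \<rho>(1)[of j] \<rho>(1)[of k] by (intro add_mono) (auto intro: order_trans[OF less_imp_le ennreal_leI])
    also have "\<dots> = ennreal (2 * (1/4)^k)"
      by (simp add: ennreal_plus[symmetric] del: ennreal_plus)
    finally show ?thesis using Cauchy[of "\<rho> j" "\<rho> k"] by (rule order_trans[rotated])
  qed
  define D where "D = (\<lambda>k x. I (\<rho> (Suc k)) x - I (\<rho> k) x)"
  have [measurable]: "D k \<in> borel_measurable M" for k unfolding D_def by measurable
  define c where "c = measure M (space M)"
  have c: "emeasure M (space M) = ennreal c" "0 \<le> c" by (auto simp: c_def emeasure_eq_measure)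
  have D1: "(\<integral>\<^sup>+x. ennreal \<bar>D k x\<bar> \<partial>M) \<le> ennreal ((c + 2) * (1/2)^k)" for k
  proof -
    have "(\<integral>\<^sup>+x. ennreal \<bar>D k x\<bar> \<partial>M) \<le> (\<integral>\<^sup>+x. ennreal ((1/2)^k) + ennreal (2^k) * ennreal ((D k x)\<^sup>2) \<partial>M)"
    proof (rule nn_integral_mono)
      fix x
      \<comment> \<open>Young's inequality with a weight that balances the size
        \<open>(1/4)^k\<close> of the expected square.\<close>
      have "2 * \<bar>D k x\<bar> * (1/2)^k \<le> \<bar>D k x\<bar>\<^sup>2 + ((1/2)^k)\<^sup>2" by (rule sum_squares_bound)
      then have "(2 * \<bar>D k x\<bar> * (1/2)^k) * 2^k \<le> ((D k x)\<^sup>2 + ((1/2)^k)\<^sup>2) * 2^k"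
        by (intro mult_right_mono) auto
      moreover have "(1/2 :: real)^k * 2^k = 1" by (simp flip: power_mult_distrib)
      ultimately have "2 * \<bar>D k x\<bar> \<le> 2^k * (D k x)\<^sup>2 + (1/2)^k"
        by (simp add: algebra_simps power2_eq_square) (simp add: mult.assoc[symmetric])
      then have "\<bar>D k x\<bar> \<le> (1/2)^k + 2^k * (D k x)\<^sup>2" by linarith
      then show "ennreal \<bar>D k x\<bar> \<le> ennreal ((1/2)^k) + ennreal (2^k) * ennreal ((D k x)\<^sup>2)"
        by (simp add: ennreal_plus[symmetric] ennreal_mult[symmetric] ennreal_leI del: ennreal_plus)
    qed
    also have "\<dots> = ennreal ((1/2)^k) * ennreal c + ennreal (2^k) * (\<integral>\<^sup>+x. ennreal ((D k x)\<^sup>2) \<partial>M)"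
      by (subst nn_integral_add) (auto simp: nn_integral_cmult c)
    also have "\<dots> \<le> ennreal ((1/2)^k) * ennreal c + ennreal (2^k) * ennreal (2 * (1/4)^k)"
      using near[of k "Suc k"] by (intro add_mono mult_left_mono) (auto simp: D_def)
    also have "\<dots> = ennreal ((c + 2) * (1/2)^k)"
    proof -
      have "(2::real)^k * (1/4)^k = (1/2)^k" by (simp flip: power_mult_distrib)
      then have "(1/2)^k * c + 2^k * (2 * (1/4)^k) = (c + 2) * (1/2)^k"
        by (simp add: algebra_simps)
      then show ?thesis using c by (simp add: ennreal_plus[symmetric] ennreal_mult[symmetric] del: ennreal_plus)
    qed
    finally show ?thesis .
  qed
  have "(\<integral>\<^sup>+x. (\<Sum>k. ennreal \<bar>D k x\<bar>) \<partial>M) = (\<Sum>k. \<integral>\<^sup>+x. ennreal \<bar>D k x\<bar> \<partial>M)"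
    by (rule nn_integral_suminf) measurable
  also have "\<dots> \<le> (\<Sum>k. ennreal ((c + 2) * (1/2)^k))"
    by (intro suminf_le D1) auto
  also have "\<dots> = ennreal (\<Sum>k. (c + 2) * (1/2)^k)"
    using c by (intro suminf_ennreal2 summable_mult summable_geometric) auto
  also have "\<dots> < \<infinity>" by simp
  finally have "(\<integral>\<^sup>+x. (\<Sum>k. ennreal \<bar>D k x\<bar>) \<partial>M) \<noteq> \<infinity>" by simp
  then have "AE x in M. (\<Sum>k. ennreal \<bar>D k x\<bar>) \<noteq> \<infinity>"
    by (intro nn_integral_PInf_AE) auto
  then have conv: "AE x in M. convergent (\<lambda>k. I (\<rho> k) x)"
  proof eventually_elim
    case (elim x)
    then have "summable (\<lambda>k. norm (D k x))"
      using summable_suminf_not_top[of "\<lambda>k. \<bar>D k x\<bar>"] by simp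
    then have "summable (\<lambda>k. D k x)" by (rule summable_norm_cancel)
    then have "convergent (\<lambda>n. \<Sum>k<n. D k x)" by (simp add: summable_iff_convergent)
    moreover have "(\<Sum>k<n. D k x) = I (\<rho> n) x - I (\<rho> 0) x" for n
      unfolding D_def by (rule sum_lessThan_telescope)
    ultimately have "convergent (\<lambda>n. (I (\<rho> n) x - I (\<rho> 0) x) + I (\<rho> 0) x)"
      by (intro convergent_add convergent_const) simp
    then show ?case by simp
  qed
  define X where "X = (\<lambda>x. lim (\<lambda>k. I (\<rho> k) x))"
  have Xm[measurable]: "X \<in> borel_measurable M" unfolding X_def by measurable
  have lim: "AE x in M. (\<lambda>k. I (\<rho> k) x) \<longlonglongrightarrow> X x"
    using conv by eventually_elim (simp add: X_def convergent_LIMSEQ_iff)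
  \<comment> \<open>Fatou's lemma in the first index \<open>j\<close> of the Cauchy estimate
    \<open>near\<close>.\<close>
  have bound: "(\<integral>\<^sup>+x. ennreal ((X x - I (\<rho> k) x)\<^sup>2) \<partial>M) \<le> ennreal (2 * (1/4)^k)" for k
  proof -
    have "(\<integral>\<^sup>+x. ennreal ((X x - I (\<rho> k) x)\<^sup>2) \<partial>M) = (\<integral>\<^sup>+x. liminf (\<lambda>j. ennreal ((I (\<rho> j) x - I (\<rho> k) x)\<^sup>2)) \<partial>M)"
    proof (rule nn_integral_cong_AE)
      show "AE x in M. ennreal ((X x - I (\<rho> k) x)\<^sup>2) = liminf (\<lambda>j. ennreal ((I (\<rho> j) x - I (\<rho> k) x)\<^sup>2))"
        using lim
      proof eventually_elim
        case (elim x)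
        then have "(\<lambda>j. ennreal ((I (\<rho> j) x - I (\<rho> k) x)\<^sup>2)) \<longlonglongrightarrow> ennreal ((X x - I (\<rho> k) x)\<^sup>2)"
          by (intro tendsto_intros)
        then show ?case by (intro lim_imp_Liminf[symmetric]) auto
      qed
    qed
    also have "\<dots> \<le> liminf (\<lambda>j. \<integral>\<^sup>+x. ennreal ((I (\<rho> j) x - I (\<rho> k) x)\<^sup>2) \<partial>M)"
      by (rule nn_integral_liminf) measurable
    also have "\<dots> \<le> limsup (\<lambda>j. \<integral>\<^sup>+x. ennreal ((I (\<rho> j) x - I (\<rho> k) x)\<^sup>2) \<partial>M)"
      by (rule Liminf_le_Limsup) simp
    also have "\<dots> \<le> ennreal (2 * (1/4)^k)"
      by (rule Limsup_bounded) (use near in \<open>auto simp: eventually_sequentially\<close>)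
    finally show ?thesis .
  qed
  have "(\<lambda>k. \<integral>\<^sup>+x. ennreal ((X x - I (\<rho> k) x)\<^sup>2) \<partial>M) \<longlonglongrightarrow> 0"
  proof (rule tendsto_sandwich[where f="\<lambda>_. 0" and h="\<lambda>k. ennreal (2 * (1/4)^k)"])
    have "(\<lambda>k. 2 * (1/4 :: real)^k) \<longlonglongrightarrow> 2 * 0"
      by (intro tendsto_intros LIMSEQ_realpow_zero) auto
    then show "(\<lambda>k. ennreal (2 * (1/4)^k)) \<longlonglongrightarrow> 0"
      using tendsto_ennrealI by fastforce
  qed (use bound in auto)
  then show thesis using that[OF Xm mono lim] by blast
qed

text \<open>Progressive measurability lives on \<open>{0..v}\<close> in time. Freezing the time
  argument at the ends gives a function on the whole line, to which Fubini against
  \<open>lborel\<close> applies.\<close>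

lemma clamp_measurable_restrict:
  fixes g :: "real \<times> 'a \<Rightarrow> 'b::topological_space"
  assumes g: "g \<in> restrict_space borel {0..v} \<Otimes>\<^sub>M M \<rightarrow>\<^sub>M borel" and v: "(0::real) \<le> v"
  shows "(\<lambda>(x, s). g (max 0 (min v s), x)) \<in> M \<Otimes>\<^sub>M borel \<rightarrow>\<^sub>M borel"
proof -
  have "(\<lambda>z. max 0 (min v (snd z))) \<in> M \<Otimes>\<^sub>M borel \<rightarrow>\<^sub>M restrict_space borel {0..v}"
    using v by (intro measurable_restrict_space2) auto
  then have "(\<lambda>z. (max 0 (min v (snd z)), fst z)) \<in> M \<Otimes>\<^sub>M borel \<rightarrow>\<^sub>M restrict_space borel {0..v} \<Otimes>\<^sub>M M"
    by measurable
  then show ?thesis using g by (simp add: measurable_compose[OF _ g] split_beta')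
qed

lemma indicator_measurable_restrict:
  fixes g :: "real \<times> 'a \<Rightarrow> 'b::{second_countable_topology, real_normed_vector}"
  assumes g: "g \<in> restrict_space borel {0..v} \<Otimes>\<^sub>M M \<rightarrow>\<^sub>M borel" and v: "(0::real) \<le> v"
    and S[measurable]: "S \<in> sets borel" and S_le: "S \<subseteq> {0..v}"
  shows "(\<lambda>(x, s). indicator S s *\<^sub>R g (s, x)) \<in> M \<Otimes>\<^sub>M borel \<rightarrow>\<^sub>M borel"
proof -
  have [measurable]: "(\<lambda>z. g (max 0 (min v (snd z)), fst z)) \<in> M \<Otimes>\<^sub>M borel \<rightarrow>\<^sub>M borel"
    using clamp_measurable_restrict[OF g v] by (simp add: split_beta')
  have "(\<lambda>(x, s). indicator S s *\<^sub>R g (s, x)) = (\<lambda>z. indicator S (snd z) *\<^sub>R g (max 0 (min v (snd z)), fst z))"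
    using S_le by (force simp: fun_eq_iff indicator_def)
  then show ?thesis by simp
qed

lemma power2_sum3_le: "(a + b + c :: real)\<^sup>2 \<le> 3 * (a\<^sup>2 + b\<^sup>2 + c\<^sup>2)"
proof -
  have "0 \<le> (a - b)\<^sup>2 + (b - c)\<^sup>2 + (a - c)\<^sup>2" by simp
  then show ?thesis by (simp add: power2_eq_square algebra_simps)
qed

lemma ennreal_norm_sum3_le:
  fixes a b c :: "'a::real_normed_vector"
  shows "ennreal ((norm (a + b + c))\<^sup>2) \<le> 3 * (ennreal ((norm a)\<^sup>2) + ennreal ((norm b)\<^sup>2) + ennreal ((norm c)\<^sup>2))"
proof -
  have "norm (a + b + c) \<le> norm a + norm b + norm c"
    using norm_triangle_ineq[of "a + b" c] norm_triangle_ineq[of a b] by linarith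
  then have "(norm (a + b + c))\<^sup>2 \<le> (norm a + norm b + norm c)\<^sup>2" by (rule power_mono) simp
  also have "\<dots> \<le> 3 * ((norm a)\<^sup>2 + (norm b)\<^sup>2 + (norm c)\<^sup>2)" by (rule power2_sum3_le)
  finally have "ennreal ((norm (a + b + c))\<^sup>2) \<le> ennreal (3 * ((norm a)\<^sup>2 + (norm b)\<^sup>2 + (norm c)\<^sup>2))"
    by (rule ennreal_leI)
  then show ?thesis by (simp add: ennreal_mult)
qed

section \<open>Construction and stability of the Ito integral on Wiener space\<close>

context wiener_space
begin

lemma measurable_pair_F_P:
  assumes "g \<in> F v \<Otimes>\<^sub>M N \<rightarrow>\<^sub>M L"
  shows "g \<in> P \<Otimes>\<^sub>M N \<rightarrow>\<^sub>M L"
proof -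
  have "(\<lambda>x. x) \<in> P \<rightarrow>\<^sub>M F v" by (rule measurable_F_P[OF measurable_ident_sets[OF refl]])
  then have "(\<lambda>z. (fst z, snd z)) \<in> P \<Otimes>\<^sub>M N \<rightarrow>\<^sub>M F v \<Otimes>\<^sub>M N"
    by (intro measurable_Pair measurable_compose[OF measurable_fst]) auto
  from measurable_compose[OF this assms] show ?thesis by simp
qed

lemma simple_integrand_adapted:
  assumes "simple_integrand T W u n r \<phi>" "k < n"
  shows "adapted_bounded (r k) (\<phi> k)"
  using assms by (auto simp: simple_integrand_def adapted_bounded_def)

lemma simple_integral_elem: "simple_integral n r \<phi> \<omega> = (\<Sum>k<n. elem_integral (\<phi> k) (r k) (r (Suc k)) \<omega>)"
  by (simp add: simple_integral_def elem_integral_def)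

lemma simple_integral_measurable:
  assumes "simple_integrand T W u n r \<phi>" "u \<le> T"
  shows "simple_integral n r \<phi> \<in> borel_measurable P"
  unfolding simple_integral_elem[abs_def]
proof (rule borel_measurable_sum)
  fix k assume "k \<in> {..<n}"
  then show "elem_integral (\<phi> k) (r k) (r (Suc k)) \<in> borel_measurable P"
    using assms simple_integrand_adapted[OF assms(1), of k]
    by (intro elem_integral_measurable) (auto simp: simple_integrand_def)
qed

lemma simple_process_measurable:
  assumes "simple_integrand T W u n r \<phi>"
  shows "(\<lambda>(\<omega>, s). simple_process n r \<phi> s \<omega>) \<in> P \<Otimes>\<^sub>M borel \<rightarrow>\<^sub>M borel"
proof -
  have "(\<lambda>z. indicator {r k<..r (Suc k)} (snd z) *\<^sub>R \<phi> k (fst z)) \<in> P \<Otimes>\<^sub>M borel \<rightarrow>\<^sub>M borel" if "k < n" for k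
  proof -
    have [measurable]: "\<phi> k \<in> borel_measurable P"
      using measurable_F_P[OF adapted_bounded_measurable[OF simple_integrand_adapted[OF assms that] order_refl]] .
    show ?thesis by measurable
  qed
  then show ?thesis
    unfolding simple_process_def split_beta' by (intro borel_measurable_sum) auto
qed

lemma simple_process_outside:
  assumes "simple_integrand T W u n r \<phi>" "s \<notin> {0..u}"
  shows "simple_process n r \<phi> s \<omega> = 0"
  unfolding simple_process_def
proof (intro sum.neutral ballI)
  fix k assume "k \<in> {..<n}"
  then have "0 \<le> r k" "r (Suc k) \<le> u" using assms(1) by (auto simp: simple_integrand_def)
  then have "s \<notin> {r k<..r (Suc k)}" using assms(2) by auto
  then show "indicator {r k<..r (Suc k)} s *\<^sub>R \<phi> k \<omega> = 0" by simp
qed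

text \<open>The two integrands form one family indexed by a disjoint sum, the second one with a
  minus sign, and \<open>elem_sum_isometry\<close> applies to this family.\<close>

lemma simple_integral_diff_isometry:
  assumes \<phi>: "simple_integrand T W u n r \<phi>" "u \<le> T" and \<psi>: "simple_integrand T W u' n' r' \<psi>" "u' \<le> T"
  shows "(\<integral>\<^sup>+\<omega>. ennreal ((simple_integral n r \<phi> \<omega> - simple_integral n' r' \<psi> \<omega>)\<^sup>2) \<partial>P)
    = (\<integral>\<^sup>+\<omega>. (\<integral>\<^sup>+s. ennreal ((norm (simple_process n r \<phi> s \<omega> - simple_process n' r' \<psi> s \<omega>))\<^sup>2) \<partial>lborel) \<partial>P)"
proof -
  let ?K = "{..<n} <+> {..<n'}"
  let ?f = "case_sum \<phi> (\<lambda>k \<omega>. - \<psi> k \<omega>)" and ?a = "case_sum r r'" and ?b = "case_sum (\<lambda>k. r (Suc k)) (\<lambda>k. r' (Suc k))"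
  have "(\<integral>\<^sup>+\<omega>. ennreal ((\<Sum>k\<in>?K. elem_integral (?f k) (?a k) (?b k) \<omega>)\<^sup>2) \<partial>P)
       = (\<integral>\<^sup>+\<omega>. (\<integral>\<^sup>+s. ennreal ((norm (\<Sum>k\<in>?K. indicator {?a k<..?b k} s *\<^sub>R ?f k \<omega>))\<^sup>2) \<partial>lborel) \<partial>P)"
  proof (rule elem_sum_isometry)
    show "adapted_bounded (?a k) (?f k)" if "k \<in> ?K" for k
      using that simple_integrand_adapted[OF \<phi>(1)] simple_integrand_adapted[OF \<psi>(1)]
      adapted_bounded_uminus[OF simple_integrand_adapted[OF \<psi>(1)]] by (auto split: sum.splits)
    show "0 \<le> ?a k \<and> ?a k \<le> ?b k \<and> ?b k \<le> T" if "k \<in> ?K" for k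
      using that \<phi> \<psi> by (auto simp: simple_integrand_def intro: order_trans)
  qed simp
  moreover have "(\<Sum>k\<in>?K. elem_integral (?f k) (?a k) (?b k) \<omega>)
      = simple_integral n r \<phi> \<omega> - simple_integral n' r' \<psi> \<omega>" for \<omega>
    by (simp add: sum.Plus simple_integral_elem elem_integral_def sum_negf)
  moreover have "(\<Sum>k\<in>?K. indicator {?a k<..?b k} s *\<^sub>R ?f k \<omega>)
      = simple_process n r \<phi> s \<omega> - simple_process n' r' \<psi> s \<omega>" for s \<omega>
    by (subst sum.Plus) (simp_all only: finite_lessThan simple_process_def sum.case comp_def
        scaleR_minus_right sum_negf diff_conv_add_uminus)
  ultimately show ?thesis by simp
qed

text \<open>The averages are simple integrands converging to \<open>H\<close>, and by the isometry
  their integrals are Cauchy. For the exponential moment, \<open>exp_moment_bound\<close> is applied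
  to twice the integrands, hence \<open>(2 * C)\<^sup>2 / 2 = 2 * C\<^sup>2\<close>, and Fatou
  passes to the limit. The case \<open>u = 0\<close> is separate because cell averages divide by
  \<open>u\<close>.\<close>

proposition ito_integral_exists:
  assumes u: "0 \<le> u" "u \<le> T"
    and C: "\<And>s \<omega>. s \<in> {0..u} \<Longrightarrow> \<omega> \<in> \<Omega> \<Longrightarrow> norm (H s \<omega>) \<le> C"
    and prog: "\<And>v. v \<in> {0..u} \<Longrightarrow> (\<lambda>(s, \<omega>). H s \<omega>) \<in> restrict_space borel {0..v} \<Otimes>\<^sub>M F v \<rightarrow>\<^sub>M borel"
  shows "\<exists>X. has_ito_integral T W u H X \<and> (\<integral>\<^sup>+\<omega>. ennreal (exp (2 * X \<omega>)) \<partial>P) \<le> ennreal (exp (2 * C\<^sup>2 * u))"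
proof (cases "u = 0")
  case True
  have "has_ito_integral T W u H (\<lambda>_. 0)"
    unfolding has_ito_integral_def
  proof (intro conjI exI)
    show "\<forall>m. simple_integrand T W u 0 (\<lambda>_. 0) (\<lambda>_ _. 0)" by (simp add: simple_integrand_def)
    have "(\<integral>\<^sup>+s\<in>{0..u}. g s \<partial>lborel) = 0" for g :: "real \<Rightarrow> ennreal"
    proof -
      have "AE s in lborel. g s * indicator {0..u} s = 0"
        using AE_lborel_singleton[of "0::real"] by (rule AE_mp) (use True in \<open>auto intro!: AE_I2 simp: indicator_def\<close>)
      then have "(\<integral>\<^sup>+s\<in>{0..u}. g s \<partial>lborel) = (\<integral>\<^sup>+s. 0 \<partial>(lborel :: real measure))" by (rule nn_integral_cong_AE)
      then show ?thesis by simp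
    qed
    then show "(\<lambda>m :: nat. \<integral>\<^sup>+\<omega>. (\<integral>\<^sup>+s\<in>{0..u}.
             ennreal ((norm (H s \<omega> - simple_process 0 (\<lambda>_. 0) (\<lambda>_ _. 0) s \<omega>))\<^sup>2) \<partial>lborel) \<partial>completion W) \<longlonglongrightarrow> 0"
      by simp
  qed (simp_all add: simple_integral_def)
  then show ?thesis using True by (intro exI[of _ "\<lambda>_. 0"]) (simp add: emeasure_space_1[simplified])
next
  case False
  then have u0: "0 < u" using u by simp
  have C0: "0 \<le> C"
  proof -
    obtain \<omega> where "\<omega> \<in> \<Omega>" using not_empty by auto
    then show ?thesis using order_trans[OF norm_ge_zero C[of 0 \<omega>]] u by auto
  qed
  define h where "h = (\<lambda>\<omega> s. H (max 0 (min u s)) \<omega>)"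
  have hpm: "(\<lambda>(\<omega>, s). h \<omega> s) \<in> P \<Otimes>\<^sub>M borel \<rightarrow>\<^sub>M borel"
  proof -
    have "(\<lambda>(\<omega>, s). h \<omega> s) \<in> F u \<Otimes>\<^sub>M borel \<rightarrow>\<^sub>M borel"
      using clamp_measurable_restrict[OF prog[of u] u(1)] u by (simp add: h_def)
    then show ?thesis by (rule measurable_pair_F_P)
  qed
  note [measurable] = hpm[unfolded split_beta']
  have hm: "h \<omega> \<in> borel_measurable borel" if "\<omega> \<in> \<Omega>" for \<omega>
    using measurable_compose[OF measurable_Pair1'[of \<omega> P borel] hpm] that by simp
  have hC: "norm (h \<omega> s) \<le> C" if "\<omega> \<in> \<Omega>" for \<omega> s
    unfolding h_def using u that by (intro C) auto
  define \<phi> where "\<phi> = (\<lambda>n k \<omega>. cell_average u n (h \<omega>) k)"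
  have \<phi>C: "norm (\<phi> n k \<omega>) \<le> C" if "\<omega> \<in> \<Omega>" for n k \<omega>
    unfolding \<phi>_def by (rule cell_average_bounded[OF hm[OF that] hC[OF that] u0])
  have \<phi>m: "\<phi> n k \<in> borel_measurable (F (grid u n k))" if k: "k < Suc n" for n k
  proof (cases "k = 0")
    case True
    then show ?thesis by (simp add: \<phi>_def cell_average_def)
  next
    case False
    let ?v = "grid u n k" and ?I = "{grid u n (k - 1)<..grid u n k}"
    have v: "?v \<in> {0..u}" using k u by (auto intro!: grid_nonneg grid_le)
    have I: "?I \<subseteq> {0..?v}" using grid_nonneg[of u n "k - 1"] u by auto
    \<comment> \<open>The preceding cell ends at \<open>?v\<close>, so progressive measurability at
      that time, and not only at \<open>u\<close>, makes the average measurable for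
      \<open>F ?v\<close>.\<close>
    have "(\<lambda>(\<omega>, s). indicator ?I s *\<^sub>R H s \<omega>) \<in> F ?v \<Otimes>\<^sub>M borel \<rightarrow>\<^sub>M borel"
      using indicator_measurable_restrict[OF prog[OF v] _ _ I] v by simp
    also have "(\<lambda>(\<omega>, s). indicator ?I s *\<^sub>R H s \<omega>) = (\<lambda>(\<omega>, s). indicator ?I s *\<^sub>R h \<omega> s)"
      using I v by (auto simp: fun_eq_iff h_def indicator_def)
    finally have "(\<lambda>(\<omega>, s). indicator ?I s *\<^sub>R h \<omega> s) \<in> borel_measurable (F ?v \<Otimes>\<^sub>M lborel)"
      by (simp cong: measurable_cong_sets)
    then have "(\<lambda>\<omega>. LBINT s. indicator ?I s *\<^sub>R h \<omega> s) \<in> borel_measurable (F ?v)"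
      by (rule lborel.borel_measurable_lebesgue_integral)
    then show ?thesis
      using False unfolding \<phi>_def cell_average_def set_lebesgue_integral_def by simp
  qed
  have simple: "simple_integrand T W u (Suc n) (grid u n) (\<phi> n)" for n
    unfolding simple_integrand_def
  proof (intro allI impI conjI)
    fix k assume k: "k < Suc n"
    show "0 \<le> grid u n k" "grid u n k \<le> grid u n (Suc k)" "grid u n (Suc k) \<le> u"
      using u k by (auto intro!: grid_nonneg grid_mono grid_le)
    show "\<phi> n k \<in> borel_measurable (F (grid u n k))" by (rule \<phi>m[OF k])
    show "bounded (\<phi> n k ` \<Omega>)" using \<phi>C by (auto simp: bounded_iff)
  qed
  define e where "e = (\<lambda>n s \<omega>. simple_process (Suc n) (grid u n) (\<phi> n) s \<omega>)"
  have e_avg: "e n s \<omega> = averaging u n (h \<omega>) s" for n s \<omega>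
    by (simp add: e_def simple_process_def averaging_def \<phi>_def)
  have em[measurable]: "(\<lambda>z. e n (snd z) (fst z)) \<in> P \<Otimes>\<^sub>M borel \<rightarrow>\<^sub>M borel" for n
    using simple_process_measurable[OF simple] by (simp add: e_def split_beta')
  define \<delta> where "\<delta> = (\<lambda>n. \<integral>\<^sup>+\<omega>. (\<integral>\<^sup>+s\<in>{0..u}. ennreal ((norm (h \<omega> s - e n s \<omega>))\<^sup>2) \<partial>lborel) \<partial>P)"
  have inner_m: "(\<lambda>\<omega>. \<integral>\<^sup>+s\<in>{0..u}. ennreal ((norm (h \<omega> s - e n s \<omega>))\<^sup>2) \<partial>lborel) \<in> borel_measurable P" for n
  proof (rule lborel.borel_measurable_nn_integral)
    have "(\<lambda>z. ennreal ((norm (h (fst z) (snd z) - e n (snd z) (fst z)))\<^sup>2) * indicator {0..u} (snd z)) \<in> borel_measurable (P \<Otimes>\<^sub>M borel)"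
      by measurable
    then show "(\<lambda>(\<omega>, s). ennreal ((norm (h \<omega> s - e n s \<omega>))\<^sup>2) * indicator {0..u} s) \<in> borel_measurable (P \<Otimes>\<^sub>M lborel)"
      by (simp add: split_beta' cong: measurable_cong_sets)
  qed
  have \<delta>0: "\<delta> \<longlonglongrightarrow> 0"
  proof -
    \<comment> \<open>For each path the averages converge in time; the bound on \<open>h\<close>
      dominates in \<open>\<omega>\<close>.\<close>
    have "\<delta> \<longlonglongrightarrow> (\<integral>\<^sup>+\<omega>. 0 \<partial>P)"
      unfolding \<delta>_def
    proof (rule nn_integral_dominated_convergence[where w="\<lambda>_. ennreal ((2 * C)\<^sup>2 * u)"])
      show "AE \<omega> in P. (\<integral>\<^sup>+s\<in>{0..u}. ennreal ((norm (h \<omega> s - e n s \<omega>))\<^sup>2) \<partial>lborel) \<le> ennreal ((2 * C)\<^sup>2 * u)" for n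
      proof (rule AE_I2)
        fix \<omega> assume "\<omega> \<in> space P"
        then have \<omega>: "\<omega> \<in> \<Omega>" by simp
        have "(\<integral>\<^sup>+s\<in>{0..u}. ennreal ((norm (h \<omega> s - e n s \<omega>))\<^sup>2) \<partial>lborel) \<le> (\<integral>\<^sup>+s. ennreal ((2 * C)\<^sup>2) * indicator {0..u} s \<partial>lborel)"
        proof (intro nn_integral_mono mult_right_mono ennreal_leI power_mono)
          show "norm (h \<omega> s - e n s \<omega>) \<le> 2 * C" for s
            using norm_triangle_ineq4[of "h \<omega> s" "e n s \<omega>"] hC[OF \<omega>, of s] averaging_bounded[OF hm[OF \<omega>] hC[OF \<omega>] u0, of n s]
            unfolding e_avg by simp
        qed auto
        also have "\<dots> = ennreal ((2 * C)\<^sup>2 * u)" using u by (simp add: nn_integral_cmult ennreal_mult)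
        finally show "(\<integral>\<^sup>+s\<in>{0..u}. ennreal ((norm (h \<omega> s - e n s \<omega>))\<^sup>2) \<partial>lborel) \<le> ennreal ((2 * C)\<^sup>2 * u)" .
      qed
      show "AE \<omega> in P. (\<lambda>n. \<integral>\<^sup>+s\<in>{0..u}. ennreal ((norm (h \<omega> s - e n s \<omega>))\<^sup>2) \<partial>lborel) \<longlonglongrightarrow> 0"
        unfolding e_avg by (rule AE_I2) (use averaging_tendsto_L2[OF hm hC u0] in simp)
      show "(\<integral>\<^sup>+\<omega>. ennreal ((2 * C)\<^sup>2 * u) \<partial>P) < \<infinity>"
        by (simp add: emeasure_space_1[simplified] ennreal_mult_less_top)
    qed (use inner_m in auto)
    then show ?thesis by simp
  qed
  define I where "I = (\<lambda>n. simple_integral (Suc n) (grid u n) (\<phi> n))"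
  have Im[measurable]: "I n \<in> borel_measurable P" for n
    unfolding I_def by (rule simple_integral_measurable[OF simple u(2)])
  have Cauchy: "(\<integral>\<^sup>+\<omega>. ennreal ((I n \<omega> - I m \<omega>)\<^sup>2) \<partial>P) \<le> 3 * \<delta> n + 3 * \<delta> m" for n m
  proof -
    have "(\<integral>\<^sup>+\<omega>. ennreal ((I n \<omega> - I m \<omega>)\<^sup>2) \<partial>P) = (\<integral>\<^sup>+\<omega>. (\<integral>\<^sup>+s. ennreal ((norm (e n s \<omega> - e m s \<omega>))\<^sup>2) \<partial>lborel) \<partial>P)"
      unfolding I_def e_def by (rule simple_integral_diff_isometry[OF simple u(2) simple u(2)])
    also have "\<dots> \<le> (\<integral>\<^sup>+\<omega>. (3 * (\<integral>\<^sup>+s\<in>{0..u}. ennreal ((norm (h \<omega> s - e n s \<omega>))\<^sup>2) \<partial>lborel)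
        + 3 * (\<integral>\<^sup>+s\<in>{0..u}. ennreal ((norm (h \<omega> s - e m s \<omega>))\<^sup>2) \<partial>lborel)) \<partial>P)"
    proof (rule nn_integral_mono)
      fix \<omega> assume "\<omega> \<in> space P"
      then have [measurable]: "h \<omega> \<in> borel_measurable borel" using hm by simp
      have [measurable]: "(\<lambda>s. e k s \<omega>) \<in> borel_measurable borel" for k
        unfolding e_avg by (rule averaging_measurable)
      have "(\<integral>\<^sup>+s. ennreal ((norm (e n s \<omega> - e m s \<omega>))\<^sup>2) \<partial>lborel)
          \<le> (\<integral>\<^sup>+s. 3 * (ennreal ((norm (h \<omega> s - e n s \<omega>))\<^sup>2) * indicator {0..u} s)
             + 3 * (ennreal ((norm (h \<omega> s - e m s \<omega>))\<^sup>2) * indicator {0..u} s) \<partial>lborel)"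
      proof (rule nn_integral_mono)
        fix s
        show "ennreal ((norm (e n s \<omega> - e m s \<omega>))\<^sup>2)
          \<le> 3 * (ennreal ((norm (h \<omega> s - e n s \<omega>))\<^sup>2) * indicator {0..u} s)
             + 3 * (ennreal ((norm (h \<omega> s - e m s \<omega>))\<^sup>2) * indicator {0..u} s)"
        proof (cases "s \<in> {0..u}")
          case True
          \<comment> \<open>The zero summand fits the difference of two terms into the inequality
            for three.\<close>
          have "e n s \<omega> - e m s \<omega> = (e n s \<omega> - h \<omega> s) + (h \<omega> s - e m s \<omega>) + 0" by simp
          then show ?thesis
            using ennreal_norm_sum3_le[of "e n s \<omega> - h \<omega> s" "h \<omega> s - e m s \<omega>" 0] True
            by (simp add: norm_minus_commute distrib_left)
        next
          case False
          then show ?thesis using simple_process_outside[OF simple] by (simp add: e_def)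
        qed
      qed
      also have "\<dots> = 3 * (\<integral>\<^sup>+s\<in>{0..u}. ennreal ((norm (h \<omega> s - e n s \<omega>))\<^sup>2) \<partial>lborel)
          + 3 * (\<integral>\<^sup>+s\<in>{0..u}. ennreal ((norm (h \<omega> s - e m s \<omega>))\<^sup>2) \<partial>lborel)"
        by (simp add: nn_integral_add nn_integral_cmult)
      finally show "(\<integral>\<^sup>+s. ennreal ((norm (e n s \<omega> - e m s \<omega>))\<^sup>2) \<partial>lborel)
          \<le> 3 * (\<integral>\<^sup>+s\<in>{0..u}. ennreal ((norm (h \<omega> s - e n s \<omega>))\<^sup>2) \<partial>lborel)
          + 3 * (\<integral>\<^sup>+s\<in>{0..u}. ennreal ((norm (h \<omega> s - e m s \<omega>))\<^sup>2) \<partial>lborel)" .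
    qed
    also have "\<dots> = 3 * \<delta> n + 3 * \<delta> m"
      unfolding \<delta>_def by (simp add: nn_integral_add nn_integral_cmult inner_m)
    finally show ?thesis .
  qed
  have \<delta>3: "(\<lambda>n. 3 * \<delta> n) \<longlonglongrightarrow> 0"
    using ennreal_tendsto_cmult[OF _ \<delta>0, of 3] by simp
  obtain X \<rho> where X[measurable]: "X \<in> borel_measurable P" and \<rho>: "strict_mono (\<rho> :: nat \<Rightarrow> nat)"
    and AE: "AE \<omega> in P. (\<lambda>k. I (\<rho> k) \<omega>) \<longlonglongrightarrow> X \<omega>"
    and L2: "(\<lambda>k. \<integral>\<^sup>+\<omega>. ennreal ((X \<omega> - I (\<rho> k) \<omega>)\<^sup>2) \<partial>P) \<longlonglongrightarrow> 0"
    using L2_Cauchy_limit[OF Im Cauchy \<delta>3] by blast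
  have "has_ito_integral T W u H X"
    unfolding has_ito_integral_def
  proof (intro conjI exI allI)
    show "simple_integrand T W u (Suc (\<rho> m)) (grid u (\<rho> m)) (\<phi> (\<rho> m))" for m by (rule simple)
    show "(\<lambda>m. \<integral>\<^sup>+\<omega>. ennreal ((X \<omega> - simple_integral (Suc (\<rho> m)) (grid u (\<rho> m)) (\<phi> (\<rho> m)) \<omega>)\<^sup>2) \<partial>P) \<longlonglongrightarrow> 0"
      using L2 by (simp add: I_def)
    have "(\<integral>\<^sup>+\<omega>. (\<integral>\<^sup>+s\<in>{0..u}. ennreal ((norm (H s \<omega> - simple_process (Suc (\<rho> m)) (grid u (\<rho> m)) (\<phi> (\<rho> m)) s \<omega>))\<^sup>2)
        \<partial>lborel) \<partial>P) = \<delta> (\<rho> m)" for m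
      unfolding \<delta>_def e_def by (intro nn_integral_cong) (auto simp: h_def indicator_def)
    then show "(\<lambda>m. \<integral>\<^sup>+\<omega>. (\<integral>\<^sup>+s\<in>{0..u}. ennreal ((norm (H s \<omega> - simple_process (Suc (\<rho> m)) (grid u (\<rho> m)) (\<phi> (\<rho> m)) s \<omega>))\<^sup>2)
        \<partial>lborel) \<partial>P) \<longlonglongrightarrow> 0"
      using LIMSEQ_subseq_LIMSEQ[OF \<delta>0 \<rho>] by (simp add: comp_def)
  qed (rule X)
  moreover have "(\<integral>\<^sup>+\<omega>. ennreal (exp (2 * X \<omega>)) \<partial>P) \<le> ennreal (exp (2 * C\<^sup>2 * u))"
  proof -
    have "(\<integral>\<^sup>+\<omega>. ennreal (exp (2 * X \<omega>)) \<partial>P) = (\<integral>\<^sup>+\<omega>. liminf (\<lambda>k. ennreal (exp (2 * I (\<rho> k) \<omega>))) \<partial>P)"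
    proof (rule nn_integral_cong_AE)
      show "AE \<omega> in P. ennreal (exp (2 * X \<omega>)) = liminf (\<lambda>k. ennreal (exp (2 * I (\<rho> k) \<omega>)))"
        using AE
      proof eventually_elim
        case (elim \<omega>)
        then have "(\<lambda>k. ennreal (exp (2 * I (\<rho> k) \<omega>))) \<longlonglongrightarrow> ennreal (exp (2 * X \<omega>))"
          by (intro tendsto_intros)
        then show ?case by (intro lim_imp_Liminf[symmetric]) auto
      qed
    qed
    also have "\<dots> \<le> liminf (\<lambda>k. \<integral>\<^sup>+\<omega>. ennreal (exp (2 * I (\<rho> k) \<omega>)) \<partial>P)"
      by (rule nn_integral_liminf) measurable
    also have "\<dots> \<le> limsup (\<lambda>k. \<integral>\<^sup>+\<omega>. ennreal (exp (2 * I (\<rho> k) \<omega>)) \<partial>P)"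
      by (rule Liminf_le_Limsup) simp
    also have "\<dots> \<le> ennreal (exp (2 * C\<^sup>2 * u))"
    proof (rule Limsup_bounded, rule always_eventually, rule allI)
      fix k
      let ?n = "\<rho> k"
      have "(\<integral>\<^sup>+\<omega>. ennreal (exp (\<Sum>j<Suc ?n. (2 *\<^sub>R \<phi> ?n j \<omega>) \<bullet> (\<omega> (grid u ?n (Suc j)) - \<omega> (grid u ?n j)))) \<partial>P)
          \<le> ennreal (exp ((2 * C)\<^sup>2 / 2 * (\<Sum>j<Suc ?n. grid u ?n (Suc j) - grid u ?n j)))"
      proof (rule exp_moment_bound)
        fix j assume j: "j < Suc ?n"
        show "0 \<le> grid u ?n j \<and> grid u ?n j \<le> grid u ?n (Suc j) \<and> grid u ?n (Suc j) \<le> T"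
          using u j grid_le[of u "Suc j" ?n] by (auto intro!: grid_nonneg grid_mono)
        show "(\<lambda>\<omega>. 2 *\<^sub>R \<phi> ?n j \<omega>) \<in> borel_measurable (F (grid u ?n j))"
          using \<phi>m[OF j] by simp
        show "norm (2 *\<^sub>R \<phi> ?n j \<omega>) \<le> 2 * C" if "\<omega> \<in> \<Omega>" for \<omega> using \<phi>C[OF that, of ?n j] by simp
      qed
      also have "(\<Sum>j<Suc ?n. grid u ?n (Suc j) - grid u ?n j) = u"
        using sum_lessThan_telescope[of "grid u ?n" "Suc ?n"] by simp
      also have "(2 * C)\<^sup>2 / 2 * u = 2 * C\<^sup>2 * u" by (simp add: power2_eq_square)
      finally show "(\<integral>\<^sup>+\<omega>. ennreal (exp (2 * I ?n \<omega>)) \<partial>P) \<le> ennreal (exp (2 * C\<^sup>2 * u))"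
        by (simp only: I_def simple_integral_def sum_distrib_left inner_scaleR_left)
    qed
    finally show ?thesis .
  qed
  ultimately show ?thesis by blast
qed

text \<open>Both integrals are compared through approximating simple integrals, whose difference
  obeys the isometry, and the simple processes are compared through the integrands extended by zero,
  so the horizons may differ. Each comparison splits into three terms and costs a factor
  \<open>3\<close>, hence \<open>9\<close>. For equal integrands the right side vanishes, so any two
  versions agree almost surely.\<close>

proposition ito_integral_stability:
  assumes u: "u \<le> T" and u': "u' \<le> T"
    and H: "(\<lambda>(\<omega>, s). indicator {0..u} s *\<^sub>R H s \<omega>) \<in> P \<Otimes>\<^sub>M borel \<rightarrow>\<^sub>M borel"
    and H': "(\<lambda>(\<omega>, s). indicator {0..u'} s *\<^sub>R H' s \<omega>) \<in> P \<Otimes>\<^sub>M borel \<rightarrow>\<^sub>M borel"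
    and X: "has_ito_integral T W u H X" and X': "has_ito_integral T W u' H' X'"
  shows "(\<integral>\<^sup>+\<omega>. ennreal ((X \<omega> - X' \<omega>)\<^sup>2) \<partial>P)
    \<le> 9 * (\<integral>\<^sup>+\<omega>. (\<integral>\<^sup>+s. ennreal ((norm (indicator {0..u} s *\<^sub>R H s \<omega> - indicator {0..u'} s *\<^sub>R H' s \<omega>))\<^sup>2) \<partial>lborel) \<partial>P)"
proof -
  obtain n r \<phi> where \<phi>: "\<And>m. simple_integrand T W u (n m) (r m) (\<phi> m)"
    and e0: "(\<lambda>m. \<integral>\<^sup>+\<omega>. (\<integral>\<^sup>+s\<in>{0..u}. ennreal ((norm (H s \<omega> - simple_process (n m) (r m) (\<phi> m) s \<omega>))\<^sup>2) \<partial>lborel) \<partial>P) \<longlonglongrightarrow> 0"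
    and I0: "(\<lambda>m. \<integral>\<^sup>+\<omega>. ennreal ((X \<omega> - simple_integral (n m) (r m) (\<phi> m) \<omega>)\<^sup>2) \<partial>P) \<longlonglongrightarrow> 0"
    and Xm[measurable]: "X \<in> borel_measurable P"
    using X unfolding has_ito_integral_def by blast
  obtain n' r' \<psi> where \<psi>: "\<And>m. simple_integrand T W u' (n' m) (r' m) (\<psi> m)"
    and e0': "(\<lambda>m. \<integral>\<^sup>+\<omega>. (\<integral>\<^sup>+s\<in>{0..u'}. ennreal ((norm (H' s \<omega> - simple_process (n' m) (r' m) (\<psi> m) s \<omega>))\<^sup>2) \<partial>lborel) \<partial>P) \<longlonglongrightarrow> 0"
    and I0': "(\<lambda>m. \<integral>\<^sup>+\<omega>. ennreal ((X' \<omega> - simple_integral (n' m) (r' m) (\<psi> m) \<omega>)\<^sup>2) \<partial>P) \<longlonglongrightarrow> 0"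
    and Xm'[measurable]: "X' \<in> borel_measurable P"
    using X' unfolding has_ito_integral_def by blast
  define I where "I = (\<lambda>m. simple_integral (n m) (r m) (\<phi> m))"
  define I' where "I' = (\<lambda>m. simple_integral (n' m) (r' m) (\<psi> m))"
  define e where "e = (\<lambda>m s \<omega>. simple_process (n m) (r m) (\<phi> m) s \<omega>)"
  define e' where "e' = (\<lambda>m s \<omega>. simple_process (n' m) (r' m) (\<psi> m) s \<omega>)"
  define K where "K = (\<lambda>s \<omega>. indicator {0..u} s *\<^sub>R H s \<omega>)"
  define K' where "K' = (\<lambda>s \<omega>. indicator {0..u'} s *\<^sub>R H' s \<omega>)"
  have [measurable]: "I m \<in> borel_measurable P" "I' m \<in> borel_measurable P" for m
    unfolding I_def I'_def using simple_integral_measurable \<phi> \<psi> u u' by blast+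
  have [measurable]: "(\<lambda>z. e m (snd z) (fst z)) \<in> P \<Otimes>\<^sub>M lborel \<rightarrow>\<^sub>M borel" "(\<lambda>z. e' m (snd z) (fst z)) \<in> P \<Otimes>\<^sub>M lborel \<rightarrow>\<^sub>M borel" for m
    using simple_process_measurable[OF \<phi>] simple_process_measurable[OF \<psi>]
    by (simp_all add: e_def e'_def split_beta' cong: measurable_cong_sets)
  have [measurable]: "(\<lambda>z. K (snd z) (fst z)) \<in> P \<Otimes>\<^sub>M lborel \<rightarrow>\<^sub>M borel" "(\<lambda>z. K' (snd z) (fst z)) \<in> P \<Otimes>\<^sub>M lborel \<rightarrow>\<^sub>M borel"
    using H H' by (simp_all add: K_def K'_def split_beta' cong: measurable_cong_sets)
  define a where "a = (\<lambda>m. \<integral>\<^sup>+\<omega>. (\<integral>\<^sup>+s. ennreal ((norm (e m s \<omega> - K s \<omega>))\<^sup>2) \<partial>lborel) \<partial>P)"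
  define a' where "a' = (\<lambda>m. \<integral>\<^sup>+\<omega>. (\<integral>\<^sup>+s. ennreal ((norm (K' s \<omega> - e' m s \<omega>))\<^sup>2) \<partial>lborel) \<partial>P)"
  define b where "b = (\<integral>\<^sup>+\<omega>. (\<integral>\<^sup>+s. ennreal ((norm (K s \<omega> - K' s \<omega>))\<^sup>2) \<partial>lborel) \<partial>P)"
  define c where "c = (\<lambda>m. \<integral>\<^sup>+\<omega>. ennreal ((X \<omega> - I m \<omega>)\<^sup>2) \<partial>P)"
  define c' where "c' = (\<lambda>m. \<integral>\<^sup>+\<omega>. ennreal ((I' m \<omega> - X' \<omega>)\<^sup>2) \<partial>P)"
  have a0: "a \<longlonglongrightarrow> 0"
  proof -
    have "a m = (\<integral>\<^sup>+\<omega>. (\<integral>\<^sup>+s\<in>{0..u}. ennreal ((norm (H s \<omega> - simple_process (n m) (r m) (\<phi> m) s \<omega>))\<^sup>2) \<partial>lborel) \<partial>P)" for m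
      unfolding a_def e_def K_def
      using simple_process_outside[OF \<phi>] by (intro nn_integral_cong) (auto simp: indicator_def norm_minus_commute)
    then have "a = (\<lambda>m. \<integral>\<^sup>+\<omega>. (\<integral>\<^sup>+s\<in>{0..u}. ennreal ((norm (H s \<omega> - simple_process (n m) (r m) (\<phi> m) s \<omega>))\<^sup>2) \<partial>lborel) \<partial>P)"
      by (rule ext)
    then show ?thesis using e0 by (simp only:)
  qed
  have a0': "a' \<longlonglongrightarrow> 0"
  proof -
    have "a' m = (\<integral>\<^sup>+\<omega>. (\<integral>\<^sup>+s\<in>{0..u'}. ennreal ((norm (H' s \<omega> - simple_process (n' m) (r' m) (\<psi> m) s \<omega>))\<^sup>2) \<partial>lborel) \<partial>P)" for m
      unfolding a'_def e'_def K'_def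
      using simple_process_outside[OF \<psi>] by (intro nn_integral_cong) (auto simp: indicator_def)
    then have "a' = (\<lambda>m. \<integral>\<^sup>+\<omega>. (\<integral>\<^sup>+s\<in>{0..u'}. ennreal ((norm (H' s \<omega> - simple_process (n' m) (r' m) (\<psi> m) s \<omega>))\<^sup>2) \<partial>lborel) \<partial>P)"
      by (rule ext)
    then show ?thesis using e0' by (simp only:)
  qed
  have c0: "c \<longlonglongrightarrow> 0" using I0 by (simp add: c_def I_def)
  have c0': "c' \<longlonglongrightarrow> 0" using I0' by (simp add: c'_def I'_def power2_commute)
  have iso: "(\<integral>\<^sup>+\<omega>. ennreal ((I m \<omega> - I' m \<omega>)\<^sup>2) \<partial>P) \<le> 3 * (a m + b + a' m)" for m
  proof -
    have "(\<integral>\<^sup>+\<omega>. ennreal ((I m \<omega> - I' m \<omega>)\<^sup>2) \<partial>P) = (\<integral>\<^sup>+\<omega>. (\<integral>\<^sup>+s. ennreal ((norm (e m s \<omega> - e' m s \<omega>))\<^sup>2) \<partial>lborel) \<partial>P)"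
      unfolding I_def I'_def e_def e'_def by (rule simple_integral_diff_isometry[OF \<phi> u \<psi> u'])
    also have "\<dots> \<le> (\<integral>\<^sup>+\<omega>. (\<integral>\<^sup>+s. 3 * (ennreal ((norm (e m s \<omega> - K s \<omega>))\<^sup>2) + ennreal ((norm (K s \<omega> - K' s \<omega>))\<^sup>2)
        + ennreal ((norm (K' s \<omega> - e' m s \<omega>))\<^sup>2)) \<partial>lborel) \<partial>P)"
    proof (intro nn_integral_mono)
      fix \<omega> s
      have "e m s \<omega> - e' m s \<omega> = (e m s \<omega> - K s \<omega>) + (K s \<omega> - K' s \<omega>) + (K' s \<omega> - e' m s \<omega>)" by simp
      then show "ennreal ((norm (e m s \<omega> - e' m s \<omega>))\<^sup>2) \<le> 3 * (ennreal ((norm (e m s \<omega> - K s \<omega>))\<^sup>2)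
          + ennreal ((norm (K s \<omega> - K' s \<omega>))\<^sup>2) + ennreal ((norm (K' s \<omega> - e' m s \<omega>))\<^sup>2))"
        using ennreal_norm_sum3_le by metis
    qed
    also have "\<dots> = (\<integral>\<^sup>+\<omega>. 3 * ((\<integral>\<^sup>+s. ennreal ((norm (e m s \<omega> - K s \<omega>))\<^sup>2) \<partial>lborel)
        + (\<integral>\<^sup>+s. ennreal ((norm (K s \<omega> - K' s \<omega>))\<^sup>2) \<partial>lborel)
        + (\<integral>\<^sup>+s. ennreal ((norm (K' s \<omega> - e' m s \<omega>))\<^sup>2) \<partial>lborel)) \<partial>P)"
    proof (rule nn_integral_cong)
      fix \<omega> assume \<omega>: "\<omega> \<in> space P"
      have "(\<lambda>s. (\<omega>, s)) \<in> lborel \<rightarrow>\<^sub>M P \<Otimes>\<^sub>M lborel" using \<omega> by measurable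
      note p = measurable_compose[OF this]
      have [measurable]: "(\<lambda>s. e m s \<omega>) \<in> borel_measurable lborel" "(\<lambda>s. e' m s \<omega>) \<in> borel_measurable lborel"
        "(\<lambda>s. K s \<omega>) \<in> borel_measurable lborel" "(\<lambda>s. K' s \<omega>) \<in> borel_measurable lborel"
        using p[of "\<lambda>z. e m (snd z) (fst z)"] p[of "\<lambda>z. e' m (snd z) (fst z)"]
          p[of "\<lambda>z. K (snd z) (fst z)"] p[of "\<lambda>z. K' (snd z) (fst z)"] by simp_all
      show "(\<integral>\<^sup>+s. 3 * (ennreal ((norm (e m s \<omega> - K s \<omega>))\<^sup>2) + ennreal ((norm (K s \<omega> - K' s \<omega>))\<^sup>2)
          + ennreal ((norm (K' s \<omega> - e' m s \<omega>))\<^sup>2)) \<partial>lborel)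
        = 3 * ((\<integral>\<^sup>+s. ennreal ((norm (e m s \<omega> - K s \<omega>))\<^sup>2) \<partial>lborel)
          + (\<integral>\<^sup>+s. ennreal ((norm (K s \<omega> - K' s \<omega>))\<^sup>2) \<partial>lborel)
          + (\<integral>\<^sup>+s. ennreal ((norm (K' s \<omega> - e' m s \<omega>))\<^sup>2) \<partial>lborel))"
        by (simp add: nn_integral_cmult nn_integral_add)
    qed
    also have "\<dots> = 3 * (a m + b + a' m)"
      unfolding a_def b_def a'_def
      by (simp add: nn_integral_cmult nn_integral_add)
    finally show ?thesis .
  qed
  have main: "(\<integral>\<^sup>+\<omega>. ennreal ((X \<omega> - X' \<omega>)\<^sup>2) \<partial>P) \<le> 3 * (c m + 3 * (a m + b + a' m) + c' m)" for m
  proof -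
    have "(\<integral>\<^sup>+\<omega>. ennreal ((X \<omega> - X' \<omega>)\<^sup>2) \<partial>P) \<le> (\<integral>\<^sup>+\<omega>. 3 * (ennreal ((X \<omega> - I m \<omega>)\<^sup>2)
        + ennreal ((I m \<omega> - I' m \<omega>)\<^sup>2) + ennreal ((I' m \<omega> - X' \<omega>)\<^sup>2)) \<partial>P)"
    proof (rule nn_integral_mono)
      fix \<omega>
      show "ennreal ((X \<omega> - X' \<omega>)\<^sup>2) \<le> 3 * (ennreal ((X \<omega> - I m \<omega>)\<^sup>2)
          + ennreal ((I m \<omega> - I' m \<omega>)\<^sup>2) + ennreal ((I' m \<omega> - X' \<omega>)\<^sup>2))"
        using ennreal_norm_sum3_le[of "X \<omega> - I m \<omega>" "I m \<omega> - I' m \<omega>" "I' m \<omega> - X' \<omega>"] by simp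
    qed
    also have "\<dots> = 3 * (c m + (\<integral>\<^sup>+\<omega>. ennreal ((I m \<omega> - I' m \<omega>)\<^sup>2) \<partial>P) + c' m)"
      unfolding c_def c'_def by (simp add: nn_integral_cmult nn_integral_add)
    also have "\<dots> \<le> 3 * (c m + 3 * (a m + b + a' m) + c' m)"
      by (intro mult_left_mono add_mono iso) auto
    finally show ?thesis .
  qed
  have "(\<lambda>m. 3 * (c m + 3 * (a m + b + a' m) + c' m)) \<longlonglongrightarrow> 3 * (0 + 3 * (0 + b + 0) + 0)"
    by (intro ennreal_tendsto_cmult tendsto_add a0 a0' c0 c0' tendsto_const) auto
  then have "(\<integral>\<^sup>+\<omega>. ennreal ((X \<omega> - X' \<omega>)\<^sup>2) \<partial>P) \<le> 3 * (0 + 3 * (0 + b + 0) + 0)"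
    by (rule Lim_bounded2) (use main in auto)
  then show ?thesis by (simp add: b_def K_def K'_def mult.assoc[symmetric])
qed

end

section \<open>The space of stopped paths\<close>

lemma path_spaceD:
  assumes "\<omega> \<in> path_space T"
  shows "continuous_on {0..T} \<omega>" "\<omega> 0 = 0" "\<omega> \<in> extensional {0..T}"
  using assms by (auto simp: path_space_def)

lemma continuous_on_stopped:
  fixes \<omega> :: "real \<Rightarrow> real ^ 'd"
  assumes "\<omega> \<in> path_space T" "t \<in> {0..T}"
  shows "continuous_on {0..T} (\<lambda>s. \<omega> (min t s))"
  using assms(2) by (intro continuous_on_compose2[OF path_spaceD(1)[OF assms(1)]] continuous_intros) auto

context
  fixes T :: real
  assumes T: "0 \<le> T"
begin

lemma path_norm_upper:
  assumes "continuous_on {0..T} D" "s \<in> {0..T}"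
  shows "norm (D s) \<le> path_norm T D"
  unfolding path_norm_def
proof (rule cSUP_upper[OF assms(2)])
  have "compact ((\<lambda>s. norm (D s)) ` {0..T})"
    using assms(1) by (intro compact_continuous_image continuous_intros) auto
  then show "bdd_above ((\<lambda>s. norm (D s)) ` {0..T})"
    by (rule bounded_imp_bdd_above[OF compact_imp_bounded])
qed

lemma path_norm_least: "(\<And>s. s \<in> {0..T} \<Longrightarrow> norm (D s) \<le> c) \<Longrightarrow> path_norm T D \<le> c"
  unfolding path_norm_def using T by (intro cSUP_least) auto

lemma path_norm_nonneg: "continuous_on {0..T} D \<Longrightarrow> 0 \<le> path_norm T D"
  using order_trans[OF norm_ge_zero path_norm_upper[of D 0]] T by simp

lemma path_dist_nonneg:
  assumes "t \<in> {0..T}" "\<omega> \<in> path_space T" "t' \<in> {0..T}" "\<omega>' \<in> path_space T"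
  shows "0 \<le> path_dist T (t, \<omega>) (t', \<omega>')"
  using assms unfolding path_dist_def
  by (auto intro!: add_nonneg_nonneg path_norm_nonneg continuous_on_diff continuous_on_stopped)

lemma path_dist_time:
  assumes "t \<in> {0..T}" "\<omega> \<in> path_space T" "t' \<in> {0..T}" "\<omega>' \<in> path_space T"
  shows "sqrt \<bar>t - t'\<bar> \<le> path_dist T (t, \<omega>) (t', \<omega>')"
  using path_norm_nonneg[OF continuous_on_diff[OF continuous_on_stopped continuous_on_stopped], of \<omega> t \<omega>' t'] assms
  by (simp add: path_dist_def)

lemma path_dist_commute: "path_dist T x y = path_dist T y x"
  by (auto simp: path_dist_def path_norm_def abs_minus_commute norm_minus_commute split: prod.splits)

lemma path_dist_triangle:
  assumes "t \<in> {0..T}" "\<omega> \<in> path_space T" "t' \<in> {0..T}" "\<omega>' \<in> path_space T" "t'' \<in> {0..T}" "\<omega>'' \<in> path_space T"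
  shows "path_dist T (t, \<omega>) (t'', \<omega>'') \<le> path_dist T (t, \<omega>) (t', \<omega>') + path_dist T (t', \<omega>') (t'', \<omega>'')"
proof -
  let ?N = "\<lambda>t \<omega> t' \<omega>'. path_norm T (\<lambda>s. \<omega> (min t s) - \<omega>' (min t' s))"
  have "\<bar>t - t''\<bar> \<le> \<bar>t - t'\<bar> + \<bar>t' - t''\<bar>" by simp
  then have "sqrt \<bar>t - t''\<bar> \<le> sqrt (\<bar>t - t'\<bar> + \<bar>t' - t''\<bar>)" by simp
  also have "\<dots> \<le> sqrt \<bar>t - t'\<bar> + sqrt \<bar>t' - t''\<bar>" by (rule sqrt_add_le_add_sqrt) auto
  finally have 1: "sqrt \<bar>t - t''\<bar> \<le> sqrt \<bar>t - t'\<bar> + sqrt \<bar>t' - t''\<bar>" .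
  have "?N t \<omega> t'' \<omega>'' \<le> ?N t \<omega> t' \<omega>' + ?N t' \<omega>' t'' \<omega>''"
  proof (rule path_norm_least)
    fix s assume s: "s \<in> {0..T}"
    have "norm (\<omega> (min t s) - \<omega>'' (min t'' s)) \<le> norm (\<omega> (min t s) - \<omega>' (min t' s)) + norm (\<omega>' (min t' s) - \<omega>'' (min t'' s))"
      using norm_triangle_ineq[of "\<omega> (min t s) - \<omega>' (min t' s)" "\<omega>' (min t' s) - \<omega>'' (min t'' s)"] by simp
    also have "\<dots> \<le> ?N t \<omega> t' \<omega>' + ?N t' \<omega>' t'' \<omega>''"
      using assms s
      by (intro add_mono path_norm_upper[of "\<lambda>s. \<omega> (min t s) - \<omega>' (min t' s)"]
          path_norm_upper[of "\<lambda>s. \<omega>' (min t' s) - \<omega>'' (min t'' s)"] continuous_on_diff continuous_on_stopped)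
    finally show "norm (\<omega> (min t s) - \<omega>'' (min t'' s)) \<le> ?N t \<omega> t' \<omega>' + ?N t' \<omega>' t'' \<omega>''" .
  qed
  with 1 show ?thesis by (simp add: path_dist_def)
qed

end

lemma Rats_vec_dense:
  obtains Q :: "(real ^ 'd) set" where "countable Q" "\<And>x e. 0 < e \<Longrightarrow> \<exists>y\<in>Q. norm (y - x) < e"
proof -
  obtain Q :: "(real ^ 'd) set" where Q: "countable Q" "\<And>X. open X \<Longrightarrow> X \<noteq> {} \<Longrightarrow> \<exists>d\<in>Q. d \<in> X"
    using countable_dense_exists by blast
  have "\<exists>y\<in>Q. norm (y - x) < e" if "0 < e" for x e
    using Q(2)[of "ball x e"] that by (auto simp: dist_norm norm_minus_commute)
  with Q(1) show thesis by (rule that)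
qed

section \<open>Separability, measurable distances, shifted coefficients\<close>

context wiener_space
begin

lemma T_nonneg: "0 \<le> T" using T_pos by simp

abbreviation "S \<equiv> {0..T} \<times> \<Omega>"

text \<open>Stopped paths are approximated uniformly by step functions with values in a countable dense
  set; those step functions are not paths themselves, so one path is selected near each of them.\<close>

lemma path_separable:
  "\<exists>x :: nat \<Rightarrow> real \<times> (real \<Rightarrow> real ^ 'd).
    (\<forall>n. x n \<in> S) \<and> (\<forall>z\<in>S. \<forall>e>0. \<exists>n. path_dist T z (x n) < e)"
proof -
  obtain Q :: "(real ^ 'd) set" where Q: "countable Q" "\<And>x e. 0 < e \<Longrightarrow> \<exists>y\<in>Q. norm (y - x) < e"
    by (rule Rats_vec_dense) blast
  \<comment> \<open>A code stands for a time \<open>q\<close> and a step function with values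
    \<open>l\<close> on cells of length \<open>T / m\<close>; the last entry is the
    tolerance.\<close>
  define near where "near = (\<lambda>(q :: real, m :: nat, l :: (real ^ 'd) list, e :: real).
     {(t, \<omega>). (t, \<omega>) \<in> S \<and> \<bar>t - q\<bar> < e \<and> (\<forall>s\<in>{0..T}. norm (\<omega> (min t s) - l ! nat \<lfloor>s * real m / T\<rfloor>) \<le> e)})"
  define codes where "codes = (\<rat> :: real set) \<times> (UNIV :: nat set) \<times> lists Q \<times> (\<rat> :: real set)"
  have cc: "countable codes"
    unfolding codes_def using Q by (intro countable_SIGMA countable_lists countable_rat) auto
  define D where "D = (\<lambda>c. SOME z. z \<in> near c) ` {c \<in> codes. near c \<noteq> {}}"
  have D: "countable D" unfolding D_def using cc by (intro countable_image countable_subset[OF _ cc]) auto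
  have DS: "D \<subseteq> S"
  proof
    fix z assume "z \<in> D"
    then obtain c where "c \<in> codes" "near c \<noteq> {}" "z = (SOME z. z \<in> near c)"
      unfolding D_def by blast
    then have "z \<in> near c" by (simp add: some_in_eq)
    then show "z \<in> S" by (auto simp: near_def split: prod.splits)
  qed
  have dense: "\<exists>y\<in>D. path_dist T z y < e" if z: "z \<in> S" and e: "0 < e" for z e
  proof -
    obtain t \<omega> where zt: "z = (t, \<omega>)" "t \<in> {0..T}" "\<omega> \<in> \<Omega>" using z by auto
    \<comment> \<open>Two points near the same code are within \<open>2 * \<epsilon>\<close> of each
      other, in time and in path. Below \<open>e / 8\<close> this keeps the path part under
      \<open>e / 4\<close>, and below \<open>e\<^sup>2 / 32\<close> it keeps the square root of the
      time part within \<open>e / 4\<close>.\<close>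
    obtain \<epsilon> where \<epsilon>: "\<epsilon> \<in> \<rat>" "0 < \<epsilon>" "\<epsilon> < min (e / 8) (e\<^sup>2 / 32)"
      using Rats_dense_in_real[of 0 "min (e / 8) (e\<^sup>2 / 32)"] e by auto
    obtain q where q: "q \<in> \<rat>" "\<bar>t - q\<bar> < \<epsilon>"
      using Rats_dense_in_real[of t "t + \<epsilon>"] \<epsilon> by (auto simp: abs_if)
    let ?w = "\<lambda>s. \<omega> (min t s)"
    have "uniformly_continuous_on {0..T} ?w"
      by (rule compact_uniformly_continuous[OF continuous_on_stopped[OF zt(3,2)]]) simp
    then obtain d where d: "0 < d" "\<And>s s'. s \<in> {0..T} \<Longrightarrow> s' \<in> {0..T} \<Longrightarrow> dist s' s < d \<Longrightarrow> dist (?w s') (?w s) < \<epsilon> / 2"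
      unfolding uniformly_continuous_on_def using \<epsilon>(2) by (metis half_gt_zero)
    obtain m :: nat where m: "T / d < real m" using reals_Archimedean2 by blast
    have m0: "0 < real m" using m d T_pos by (meson divide_pos_pos less_trans)
    have md: "T / real m < d" using m d m0 by (simp add: field_simps)
    have "\<exists>y\<in>Q. norm (y - ?w (real j * T / real m)) < \<epsilon> / 2" for j
      by (rule Q(2)) (use \<epsilon>(2) in simp)
    then obtain y where y: "\<And>j. y j \<in> Q" "\<And>j. norm (y j - ?w (real j * T / real m)) < \<epsilon> / 2" by metis
    \<comment> \<open>The cell index \<open>m\<close> occurs at \<open>s = T\<close>, hence the list
      has \<open>m + 1\<close> entries.\<close>
    define l where "l = map y [0..<Suc m]"
    define c where "c = (q, m, l, \<epsilon>)"
    have c: "c \<in> codes" using q \<epsilon> y by (auto simp: c_def codes_def l_def)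
    have "z \<in> near c"
    proof -
      have "norm (?w s - l ! nat \<lfloor>s * real m / T\<rfloor>) \<le> \<epsilon>" if s: "s \<in> {0..T}" for s
      proof -
        define j where "j = nat \<lfloor>s * real m / T\<rfloor>"
        have nn: "0 \<le> s * real m / T" using s T_pos by simp
        have j1: "real j \<le> s * real m / T" "s * real m / T < real j + 1"
          using nn by (auto simp: j_def of_nat_nat)
        have "s * real m / T \<le> real m" using s T_pos m0 by (simp add: field_simps)
        then have jm: "j < Suc m" using j1 by linarith
        have j2: "real j * T / real m \<le> s" using j1(1) T_pos m0 by (simp add: field_simps)
        have j3: "s < real j * T / real m + T / real m" using j1(2) T_pos m0 by (simp add: field_simps)
        have "dist s (real j * T / real m) < d" using j2 j3 md by (simp add: dist_real_def)
        moreover have "real j * T / real m \<in> {0..T}" using j2 s T_pos by auto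
        ultimately have "norm (?w s - ?w (real j * T / real m)) < \<epsilon> / 2"
          using d(2)[OF _ s, of "real j * T / real m"] by (simp add: dist_norm)
        then have "norm (?w s - y j) \<le> \<epsilon>"
          using y(2)[of j] norm_triangle_ineq4[of "?w s - ?w (real j * T / real m)" "y j - ?w (real j * T / real m)"] by simp
        moreover have "l ! j = y j" using jm by (simp add: l_def del: upt_Suc)
        ultimately show ?thesis by (simp add: j_def)
      qed
      then show ?thesis using zt q by (simp add: near_def c_def)
    qed
    then have ne: "near c \<noteq> {}" by auto
    define x where "x = (SOME z. z \<in> near c)"
    have xn: "x \<in> near c" unfolding x_def using ne by (simp add: some_in_eq)
    have xD: "x \<in> D" unfolding D_def x_def using c ne by blast
    obtain t' \<omega>' where xt: "x = (t', \<omega>')" by (cases x)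
    have x1: "t' \<in> {0..T}" "\<omega>' \<in> \<Omega>" "\<bar>t' - q\<bar> < \<epsilon>"
      "\<And>s. s \<in> {0..T} \<Longrightarrow> norm (\<omega>' (min t' s) - l ! nat \<lfloor>s * real m / T\<rfloor>) \<le> \<epsilon>"
      using xn xt by (auto simp: near_def c_def)
    have z1: "\<And>s. s \<in> {0..T} \<Longrightarrow> norm (\<omega> (min t s) - l ! nat \<lfloor>s * real m / T\<rfloor>) \<le> \<epsilon>"
      using \<open>z \<in> near c\<close> zt by (auto simp: near_def c_def)
    have "path_norm T (\<lambda>s. \<omega> (min t s) - \<omega>' (min t' s)) \<le> 2 * \<epsilon>"
    proof (rule path_norm_least[OF T_nonneg])
      fix s assume "s \<in> {0..T}"
      from z1[OF this] x1(4)[OF this] show "norm (\<omega> (min t s) - \<omega>' (min t' s)) \<le> 2 * \<epsilon>"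
        using norm_triangle_ineq4[of "\<omega> (min t s) - l ! nat \<lfloor>s * real m / T\<rfloor>" "\<omega>' (min t' s) - l ! nat \<lfloor>s * real m / T\<rfloor>"]
        by simp
    qed
    moreover have "sqrt \<bar>t - t'\<bar> \<le> e / 4"
    proof (rule real_le_lsqrt)
      have "\<bar>t - t'\<bar> \<le> 2 * \<epsilon>" using q x1(3) by linarith
      then show "\<bar>t - t'\<bar> \<le> (e / 4)\<^sup>2" using \<epsilon> by (simp add: power2_eq_square)
    qed (use e in auto)
    ultimately have "path_dist T z x < e" using \<epsilon> e by (simp add: path_dist_def zt xt)
    then show ?thesis using xD by blast
  qed
  have "continuous_on {0..T} (\<lambda>s\<in>{0..T}. 0 :: real ^ 'd)"
    by (rule continuous_on_eq[OF continuous_on_const]) simp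
  then have "(0, \<lambda>s\<in>{0..T}. 0) \<in> S" using T_pos by (simp add: path_space_def)
  then have "D \<noteq> {}" using dense[of _ 1] by fastforce
  then have r: "range (from_nat_into D) = D" using D by simp
  show ?thesis
  proof (intro exI[of _ "from_nat_into D"] conjI allI ballI impI)
    show "from_nat_into D n \<in> S" for n using r DS by blast
    show "\<exists>n. path_dist T z (from_nat_into D n) < e" if "z \<in> S" "0 < e" for z e
      using dense[OF that] r by (metis rangeE)
  qed
qed

lemma modulus_tendsto:
  assumes "modulus_of_continuity \<rho>" "0 < e"
  obtains d where "0 < d" "\<And>x. 0 \<le> x \<Longrightarrow> x \<le> d \<Longrightarrow> \<rho> x < e"
proof -
  have "(\<rho> \<longlongrightarrow> 0) (at_right 0)" and mono: "mono_on {0..} \<rho>" using assms by (auto simp: modulus_of_continuity_def)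
  from order_tendstoD(2)[OF this(1) assms(2)] have "\<forall>\<^sub>F x in at_right 0. \<rho> x < e" .
  then obtain b where b: "0 < b" "\<And>y. 0 < y \<Longrightarrow> y < b \<Longrightarrow> \<rho> y < e"
    by (auto simp: eventually_at_right_field)
  show thesis
  proof (rule that[of "b / 2"])
    fix x assume "0 \<le> x" "x \<le> b / 2"
    then have "\<rho> x \<le> \<rho> (b / 2)" using mono by (intro mono_onD[OF mono]) auto
    also have "\<dots> < e" using b by simp
    finally show "\<rho> x < e" .
  qed (use b in simp)
qed

text \<open>The coefficients are measurable for the augmented filtration only, and \<open>\<omega>' \<mapsto> \<omega> \<otimes>\<^sub>t \<omega>'\<close> need
  not pull null sets back to null sets. It is the modulus of continuity that makes the shifted
  coefficients measurable: they are limits of coefficients at countably many fixed points, for which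
  only the measurability in the action matters.\<close>

lemma coeff_comp_measurable:
  fixes g :: "real \<Rightarrow> (real \<Rightarrow> real ^ 'd) \<Rightarrow> 'a::topological_space \<Rightarrow> 'b::{real_normed_vector, second_countable_topology}"
  assumes \<rho>: "modulus_of_continuity \<rho>" and g: "coeff_has_modulus T A \<rho> g"
    and sect: "\<And>t \<omega>. t \<in> {0..T} \<Longrightarrow> \<omega> \<in> \<Omega> \<Longrightarrow> g t \<omega> \<in> restrict_space borel A \<rightarrow>\<^sub>M borel"
    and z: "\<And>m. m \<in> space M \<Longrightarrow> (\<tau> m, p m) \<in> S"
    and dm: "\<And>y. y \<in> S \<Longrightarrow> (\<lambda>m. path_dist T (\<tau> m, p m) y) \<in> borel_measurable M"
    and a: "a \<in> M \<rightarrow>\<^sub>M restrict_space borel A"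
  shows "(\<lambda>m. g (\<tau> m) (p m) (a m)) \<in> borel_measurable M"
proof -
  obtain x :: "nat \<Rightarrow> real \<times> (real \<Rightarrow> real ^ 'd)"
    where "\<forall>n. x n \<in> S" and "\<forall>z\<in>S. \<forall>e>0. \<exists>n. path_dist T z (x n) < e"
    using path_separable by (elim exE conjE)
  then have x: "x n \<in> S" "z \<in> S \<Longrightarrow> 0 < e \<Longrightarrow> \<exists>n. path_dist T z (x n) < e" for n z e
    by auto
  \<comment> \<open>The index of the first dense point within \<open>1 / (n + 1)\<close>: a
    measurable choice with countably many values.\<close>
  define k where "k = (\<lambda>n m. LEAST j. path_dist T (\<tau> m, p m) (x j) < 1 / real (Suc n))"
  have [measurable]: "(\<lambda>m. path_dist T (\<tau> m, p m) (x j)) \<in> borel_measurable M" for j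
    by (rule dm[OF x(1)])
  have [measurable]: "k n \<in> M \<rightarrow>\<^sub>M count_space UNIV" for n
    unfolding k_def by measurable
  have kd: "path_dist T (\<tau> m, p m) (x (k n m)) < 1 / real (Suc n)" if "m \<in> space M" for n m
    unfolding k_def by (rule LeastI_ex) (rule x(2)[OF z[OF that]], simp)
  show ?thesis
  proof (rule borel_measurable_LIMSEQ_metric)
    show "(\<lambda>m. g (fst (x (k n m))) (snd (x (k n m))) (a m)) \<in> borel_measurable M" for n
    proof (rule measurable_compose_countable[where g="k n" and f="\<lambda>j m. g (fst (x j)) (snd (x j)) (a m)"])
      fix j
      have "fst (x j) \<in> {0..T}" "snd (x j) \<in> \<Omega>" using x(1)[of j] by auto
      from measurable_compose[OF a sect[OF this]]
      show "(\<lambda>m. g (fst (x j)) (snd (x j)) (a m)) \<in> borel_measurable M" .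
    qed measurable
    fix m assume m: "m \<in> space M"
    show "(\<lambda>n. g (fst (x (k n m))) (snd (x (k n m))) (a m)) \<longlonglongrightarrow> g (\<tau> m) (p m) (a m)"
    proof (rule tendstoI)
      fix e :: real assume "0 < e"
      obtain d where d: "0 < d" "\<And>y. 0 \<le> y \<Longrightarrow> y \<le> d \<Longrightarrow> \<rho> y < e"
        using modulus_tendsto[OF \<rho> \<open>0 < e\<close>] by blast
      have "(\<lambda>n. 1 / real (Suc n)) \<longlonglongrightarrow> 0"
        using LIMSEQ_inverse_real_of_nat by (simp add: inverse_eq_divide)
      then have "\<forall>\<^sub>F n in sequentially. 1 / real (Suc n) < d" using d(1) by (rule order_tendstoD(2))
      then show "\<forall>\<^sub>F n in sequentially. dist (g (fst (x (k n m))) (snd (x (k n m))) (a m)) (g (\<tau> m) (p m) (a m)) < e"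
      proof eventually_elim
        case (elim n)
        obtain t \<omega> where xt: "x (k n m) = (t, \<omega>)" "t \<in> {0..T}" "\<omega> \<in> \<Omega>" using x(1)[of "k n m"] by auto
        have am: "a m \<in> A" using measurable_space[OF a m] by (simp add: space_restrict_space)
        have zm: "\<tau> m \<in> {0..T}" "p m \<in> \<Omega>" using z[OF m] by auto
        have "norm (g (\<tau> m) (p m) (a m) - g t \<omega> (a m)) \<le> \<rho> (path_dist T (\<tau> m, p m) (t, \<omega>))"
          using g zm xt am unfolding coeff_has_modulus_def by blast
        also have "\<dots> < e"
          using kd[OF m, of n] elim xt zm by (intro d(2) path_dist_nonneg[OF T_nonneg]) auto
        finally show ?case by (simp add: xt dist_norm norm_minus_commute)
      qed
    qed
  qed
qed

text \<open>The retraction of the line onto \<open>{0..T}\<close>. It makes a path continuous on all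
  reals, so that suprema and inequalities can be tested at rational times even if \<open>T\<close>
  is irrational.\<close>

definition clamp_time :: "real \<Rightarrow> real" where
  "clamp_time s = max 0 (min T s)"

lemma clamp_time: "clamp_time s \<in> {0..T}" and clamp_time_id: "s \<in> {0..T} \<Longrightarrow> clamp_time s = s"
  using T_nonneg by (auto simp: clamp_time_def)

lemma continuous_clamp: "continuous_on {0..T} D \<Longrightarrow> continuous_on UNIV (\<lambda>s. D (clamp_time s))"
proof (rule continuous_on_compose2[of "{0..T}" D])
  show "continuous_on UNIV clamp_time"
    unfolding clamp_time_def[abs_def] by (intro continuous_on_max continuous_on_min continuous_on_const continuous_on_id)
qed (use clamp_time in auto)

lemma continuous_le_of_Rats:
  fixes h :: "real \<Rightarrow> real"
  assumes "continuous_on UNIV h" "\<And>q. q \<in> \<rat> \<Longrightarrow> h q \<le> c"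
  shows "h s \<le> c"
  using continuous_le_on_closure[of \<rat> h s c] assms by (simp add: Rats_closure_real)

lemma path_norm_Rats:
  assumes "continuous_on {0..T} D"
  shows "path_norm T D = (SUP q\<in>\<rat>. norm (D (clamp_time q)))"
proof (rule antisym)
  have bdd: "bdd_above ((\<lambda>q. norm (D (clamp_time q))) ` \<rat>)"
    using path_norm_upper[OF T_nonneg assms] clamp_time by (auto intro!: bdd_aboveI2)
  show "path_norm T D \<le> (SUP q\<in>\<rat>. norm (D (clamp_time q)))"
  proof (rule path_norm_least[OF T_nonneg])
    fix s assume s: "s \<in> {0..T}"
    have "norm (D (clamp_time s)) \<le> (SUP q\<in>\<rat>. norm (D (clamp_time q)))"
    proof (rule continuous_le_of_Rats[of "\<lambda>s. norm (D (clamp_time s))"])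
      show "continuous_on UNIV (\<lambda>s. norm (D (clamp_time s)))"
        by (intro continuous_on_norm continuous_clamp assms)
    qed (rule cSUP_upper[OF _ bdd])
    then show "norm (D s) \<le> (SUP q\<in>\<rat>. norm (D (clamp_time q)))" using clamp_time_id[OF s] by simp
  qed
  show "(SUP q\<in>\<rat>. norm (D (clamp_time q))) \<le> path_norm T D"
    using path_norm_upper[OF T_nonneg assms] clamp_time by (intro cSUP_least) auto
qed

text \<open>Continuity reduces the supremum to rational times, and \<open>p m\<close> enters only
  through its values up to time \<open>\<tau> m\<close>. This is what later makes distances
  measurable at a stopping time.\<close>

lemma path_dist_measurable:
  assumes z: "\<And>m. m \<in> space M \<Longrightarrow> (\<tau> m, p m) \<in> S" and y: "y \<in> S"
    and \<tau>[measurable]: "\<tau> \<in> borel_measurable M"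
    and p: "\<And>q. q \<in> {0..T} \<Longrightarrow> (\<lambda>m. p m (min (\<tau> m) q)) \<in> borel_measurable M"
  shows "(\<lambda>m. path_dist T (\<tau> m, p m) y) \<in> borel_measurable M"
proof -
  obtain t \<omega> where yt: "y = (t, \<omega>)" "t \<in> {0..T}" "\<omega> \<in> \<Omega>" using y by auto
  let ?D = "\<lambda>m s. p m (min (\<tau> m) s) - \<omega> (min t s)"
  have cont: "continuous_on {0..T} (?D m)" if "m \<in> space M" for m
    using z[OF that] yt by (intro continuous_on_diff continuous_on_stopped) auto
  have [measurable]: "(\<lambda>m. SUP q\<in>\<rat>. norm (?D m (clamp_time q))) \<in> borel_measurable M"
  proof (rule borel_measurable_cSUP)
    show "(\<lambda>m. norm (?D m (clamp_time q))) \<in> borel_measurable M" for q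
      using p[OF clamp_time[of q]] by measurable
    show "bdd_above ((\<lambda>q. norm (?D m (clamp_time q))) ` \<rat>)" if "m \<in> space M" for m
      using path_norm_upper[OF T_nonneg cont[OF that]] clamp_time by (auto intro!: bdd_aboveI2)
  qed (auto intro: countable_rat)
  have "(\<lambda>m. sqrt \<bar>\<tau> m - t\<bar> + (SUP q\<in>\<rat>. norm (?D m (clamp_time q)))) \<in> borel_measurable M"
    by measurable
  then show ?thesis
    by (rule measurable_cong[THEN iffD1, rotated]) (simp add: path_dist_def yt path_norm_Rats[OF cont])
qed

text \<open>The two branches of the concatenation merge because \<open>\<omega>'\<close> starts at
  \<open>0\<close>.\<close>

lemma concat_path_eq:
  assumes "t \<in> {0..T}" "\<omega>' \<in> \<Omega>" "r \<in> {0..T}"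
  shows "concat_path T t \<omega> \<omega>' r = \<omega> (min t r) + \<omega>' (max 0 (r - t))"
  using assms path_spaceD(2)[OF assms(2)] by (auto simp: concat_path_def min_def max_def)

lemma concat_path_in:
  assumes "t \<in> {0..T}" "\<omega> \<in> \<Omega>" "\<omega>' \<in> \<Omega>"
  shows "concat_path T t \<omega> \<omega>' \<in> \<Omega>"
proof -
  have "continuous_on {0..T} (\<lambda>r. \<omega> (min t r) + \<omega>' (max 0 (r - t)))"
    using assms(1) by (intro continuous_on_add continuous_on_stopped assms
        continuous_on_compose2[OF path_spaceD(1)[OF assms(3)]] continuous_intros) auto
  then have "continuous_on {0..T} (concat_path T t \<omega> \<omega>')"
    by (rule continuous_on_eq) (simp add: concat_path_eq[OF assms(1,3)])
  moreover have "concat_path T t \<omega> \<omega>' 0 = 0"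
    using concat_path_eq[OF assms(1,3), of 0 \<omega>] assms path_spaceD(2)[OF assms(2)] path_spaceD(2)[OF assms(3)] by simp
  ultimately show ?thesis by (simp add: path_space_def concat_path_def)
qed

text \<open>Stopping at \<open>t + s\<close> sees \<open>\<omega>'\<close> only up to time
  \<open>s\<close>, so shifted coefficients remain adapted to the filtration of the appended
  path.\<close>

lemma concat_path_stopped:
  assumes "t \<in> {0..T}" "\<omega>' \<in> \<Omega>" "r \<in> {0..T}" "0 \<le> s" "t + s \<le> T"
  shows "concat_path T t \<omega> \<omega>' (min (t + s) r) = \<omega> (min t r) + \<omega>' (max 0 (min s (r - t)))"
proof -
  have "min (t + s) r \<in> {0..T}" using assms by auto
  moreover have "min t (min (t + s) r) = min t r" "min (t + s) r - t = min s (r - t)" using assms by auto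
  ultimately show ?thesis using concat_path_eq[OF assms(1,2)] by simp
qed

definition osc_le :: "real \<Rightarrow> real \<Rightarrow> (real \<Rightarrow> real ^ 'd) \<Rightarrow> bool" where
  "osc_le \<kappa> h w \<longleftrightarrow> (\<forall>r\<in>{0..T}. \<forall>r'\<in>{0..T}. \<bar>r - r'\<bar> \<le> h \<longrightarrow> norm (w r - w r') \<le> \<kappa>)"

lemma osc_le_mono: "osc_le \<kappa> h w \<Longrightarrow> h' \<le> h \<Longrightarrow> osc_le \<kappa> h' w"
  unfolding osc_le_def by force

text \<open>At each time the two concatenations differ by the difference of the stopped paths plus
  an increment of \<open>w\<close> between times at most \<open>\<bar>t - t'\<bar>\<close> apart,
  because the same \<open>w\<close> is appended with different delays.\<close>

lemma
  assumes "t \<in> {0..T}" "\<omega> \<in> \<Omega>" "t' \<in> {0..T}" "\<omega>' \<in> \<Omega>" "w \<in> \<Omega>"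
    and osc: "osc_le \<kappa> \<bar>t - t'\<bar> w"
  shows path_norm_concat_le:
      "path_norm T (\<lambda>r. concat_path T t \<omega> w r - concat_path T t' \<omega>' w r) \<le> path_dist T (t, \<omega>) (t', \<omega>') + \<kappa>"
    and path_dist_concat_le:
      "\<And>s. 0 \<le> s \<Longrightarrow> t + s \<le> T \<Longrightarrow> t' + s \<le> T \<Longrightarrow>
        path_dist T (t + s, concat_path T t \<omega> w) (t' + s, concat_path T t' \<omega>' w) \<le> path_dist T (t, \<omega>) (t', \<omega>') + \<kappa>"
proof -
  \<comment> \<open>The times \<open>u\<close> and \<open>u'\<close> are free so that the estimate
    serves both the whole concatenations and the stopped ones.\<close>
  have N: "norm ((\<omega> (min t r) + w u) - (\<omega>' (min t' r) + w u'))
      \<le> path_norm T (\<lambda>s. \<omega> (min t s) - \<omega>' (min t' s)) + \<kappa>"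
    if "r \<in> {0..T}" "u \<in> {0..T}" "u' \<in> {0..T}" "\<bar>u - u'\<bar> \<le> \<bar>t - t'\<bar>" for r u u'
  proof -
    have "norm ((\<omega> (min t r) + w u) - (\<omega>' (min t' r) + w u')) \<le> norm (\<omega> (min t r) - \<omega>' (min t' r)) + norm (w u - w u')"
      using norm_triangle_ineq[of "\<omega> (min t r) - \<omega>' (min t' r)" "w u - w u'"] by (simp add: algebra_simps)
    also have "\<dots> \<le> path_norm T (\<lambda>s. \<omega> (min t s) - \<omega>' (min t' s)) + \<kappa>"
      using assms that osc[unfolded osc_le_def, rule_format, of u u']
      by (intro add_mono path_norm_upper[of T "\<lambda>s. \<omega> (min t s) - \<omega>' (min t' s)"] T_nonneg continuous_on_diff continuous_on_stopped)
    finally show ?thesis .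
  qed
  have sq: "0 \<le> sqrt \<bar>t - t'\<bar>" by simp
  have "path_norm T (\<lambda>r. concat_path T t \<omega> w r - concat_path T t' \<omega>' w r)
      \<le> path_norm T (\<lambda>s. \<omega> (min t s) - \<omega>' (min t' s)) + \<kappa>"
  proof (rule path_norm_least[OF T_nonneg])
    fix r assume r: "r \<in> {0..T}"
    then show "norm (concat_path T t \<omega> w r - concat_path T t' \<omega>' w r)
        \<le> path_norm T (\<lambda>s. \<omega> (min t s) - \<omega>' (min t' s)) + \<kappa>"
      unfolding concat_path_eq[OF assms(1,5) r] concat_path_eq[OF assms(3,5) r]
      using assms(1,3) by (intro N) auto
  qed
  then show "path_norm T (\<lambda>r. concat_path T t \<omega> w r - concat_path T t' \<omega>' w r) \<le> path_dist T (t, \<omega>) (t', \<omega>') + \<kappa>"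
    using sq unfolding path_dist_def split by linarith
  fix s assume s: "0 \<le> s" "t + s \<le> T" "t' + s \<le> T"
  have "path_norm T (\<lambda>r. concat_path T t \<omega> w (min (t + s) r) - concat_path T t' \<omega>' w (min (t' + s) r))
      \<le> path_norm T (\<lambda>s. \<omega> (min t s) - \<omega>' (min t' s)) + \<kappa>"
  proof (rule path_norm_least[OF T_nonneg])
    fix r assume r: "r \<in> {0..T}"
    then show "norm (concat_path T t \<omega> w (min (t + s) r) - concat_path T t' \<omega>' w (min (t' + s) r))
        \<le> path_norm T (\<lambda>s. \<omega> (min t s) - \<omega>' (min t' s)) + \<kappa>"
      unfolding concat_path_stopped[OF assms(1,5) r s(1,2)] concat_path_stopped[OF assms(3,5) r s(1,3)]
      using assms(1,3) s by (intro N) auto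
  qed
  then show "path_dist T (t + s, concat_path T t \<omega> w) (t' + s, concat_path T t' \<omega>' w) \<le> path_dist T (t, \<omega>) (t', \<omega>') + \<kappa>"
    by (simp add: path_dist_def)
qed

lemma measurable_ident_F_raw: "(\<lambda>\<omega>. \<omega>) \<in> F v \<rightarrow>\<^sub>M F0 v"
  by (rule measurable_raw_F[OF measurable_ident_sets[OF refl]])

text \<open>At time \<open>s\<close> the distances needed by \<open>coeff_comp_measurable\<close>
  depend on \<open>w\<close> only up to \<open>s \<le> v\<close>, so the shifted coefficient with
  the control inserted is progressive in the time of \<open>w\<close>, which starts at
  \<open>0\<close>.\<close>

lemma shift_coeff_measurable:
  fixes g :: "real \<Rightarrow> (real \<Rightarrow> real ^ 'd) \<Rightarrow> 'a::topological_space \<Rightarrow> 'b::{real_normed_vector, second_countable_topology}"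
  assumes \<rho>: "modulus_of_continuity \<rho>" and g: "coeff_has_modulus T A \<rho> g"
    and sect: "\<And>t \<omega>. t \<in> {0..T} \<Longrightarrow> \<omega> \<in> \<Omega> \<Longrightarrow> g t \<omega> \<in> restrict_space borel A \<rightarrow>\<^sub>M borel"
    and t: "t \<in> {0..T}" and \<omega>: "\<omega> \<in> \<Omega>" and v: "v \<in> {0..T - t}"
    and a: "(\<lambda>(s, w). \<alpha> s w) \<in> restrict_space borel {0..v} \<Otimes>\<^sub>M F v \<rightarrow>\<^sub>M restrict_space borel A"
  shows "(\<lambda>(s, w). shift_coeff T t \<omega> g s w (\<alpha> s w)) \<in> restrict_space borel {0..v} \<Otimes>\<^sub>M F v \<rightarrow>\<^sub>M borel"
proof -
  let ?M = "restrict_space borel {0..v} \<Otimes>\<^sub>M F v"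
  have sp: "s \<in> {0..v}" "w \<in> \<Omega>" if "(s, w) \<in> space ?M" for s w
    using that by (auto simp: space_pair_measure space_restrict_space)
  have z: "(t + fst m, concat_path T t \<omega> (snd m)) \<in> S" if m: "m \<in> space ?M" for m
    using sp[of "fst m" "snd m"] m t \<omega> v by (auto intro!: concat_path_in)
  have "fst \<in> ?M \<rightarrow>\<^sub>M restrict_space borel {0..v}" by simp
  then have fm[measurable]: "fst \<in> borel_measurable ?M" by (simp add: measurable_restrict_space2_iff)
  have "(\<lambda>m. g (t + fst m) (concat_path T t \<omega> (snd m)) (\<alpha> (fst m) (snd m))) \<in> borel_measurable ?M"
  proof (rule coeff_comp_measurable[OF \<rho> g sect z])
    show "(\<lambda>m. \<alpha> (fst m) (snd m)) \<in> ?M \<rightarrow>\<^sub>M restrict_space borel A" using a by (simp add: split_beta')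
    fix y assume y: "y \<in> S"
    show "(\<lambda>m. path_dist T (t + fst m, concat_path T t \<omega> (snd m)) y) \<in> borel_measurable ?M"
    proof (rule path_dist_measurable[OF z y])
      show "(\<lambda>m. t + fst m) \<in> borel_measurable ?M" by measurable
      fix q assume q: "q \<in> {0..T}"
      have "(\<lambda>m. snd m (max 0 (min (fst m) (q - t)))) \<in> borel_measurable ?M"
      proof (rule path_eval_measurable)
        show "snd \<in> ?M \<rightarrow>\<^sub>M F0 v" by (rule measurable_compose[OF measurable_snd measurable_ident_F_raw])
        show "max 0 (min (fst m) (q - t)) \<in> {0..v}" if "m \<in> space ?M" for m
          using sp[of "fst m" "snd m"] that v by auto
      qed (use v t in \<open>auto intro!: borel_measurable_max borel_measurable_min fm\<close>)
      then have "(\<lambda>m. \<omega> (min t q) + snd m (max 0 (min (fst m) (q - t)))) \<in> borel_measurable ?M"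
        by measurable
      then show "(\<lambda>m. concat_path T t \<omega> (snd m) (min (t + fst m) q)) \<in> borel_measurable ?M"
      proof (rule measurable_cong[THEN iffD1, rotated])
        fix m assume "m \<in> space ?M"
        then show "\<omega> (min t q) + snd m (max 0 (min (fst m) (q - t))) = concat_path T t \<omega> (snd m) (min (t + fst m) q)"
          using sp[of "fst m" "snd m"] v by (subst concat_path_stopped[OF t _ q]) auto
      qed
    qed
  qed
  then show ?thesis by (simp add: shift_coeff_def split_beta')
qed

lemma coeff_section_measurable:
  assumes "prog_measurable_coeff T W A g" "t \<in> {0..T}" "\<omega> \<in> \<Omega>"
  shows "g t \<omega> \<in> restrict_space borel A \<rightarrow>\<^sub>M borel"
proof -
  have g: "(\<lambda>(s, \<omega>, a). g s \<omega> a) \<in> restrict_space borel {0..T} \<Otimes>\<^sub>M F T \<Otimes>\<^sub>M restrict_space borel A \<rightarrow>\<^sub>M borel"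
    using assms(1) T_nonneg by (auto simp: prog_measurable_coeff_def)
  have "(\<lambda>a. (t, \<omega>, a)) \<in> restrict_space borel A \<rightarrow>\<^sub>M restrict_space borel {0..T} \<Otimes>\<^sub>M F T \<Otimes>\<^sub>M restrict_space borel A"
    using assms by (intro measurable_Pair measurable_const measurable_ident_sets) (auto simp: space_restrict_space)
  from measurable_compose[OF this g] show ?thesis by simp
qed

text \<open>Every path is uniformly continuous, so the sets \<open>G m\<close> of paths with
  oscillation at most \<open>\<kappa>\<close> at scale \<open>1 / (m + 1)\<close> increase to the
  whole space, and continuity of measure applies. Rational times make these sets measurable.\<close>

lemma osc_small:
  assumes "0 < \<kappa>" "0 < p"
  obtains h G where "0 < h" "G \<in> sets P" "prob (\<Omega> - G) < p"
    "\<And>w. w \<in> G \<Longrightarrow> osc_le \<kappa> h w"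
proof -
  \<comment> \<open>Truncating the displacement turns the constraint
    \<open>\<bar>r - r'\<bar> \<le> 1 / (m + 1)\<close> into a quantifier over all rationals, with a
    continuous dependence on \<open>x\<close>.\<close>
  define c where "c = (\<lambda>m :: nat. \<lambda>x :: real. max (- (1 / real (Suc m))) (min (1 / real (Suc m)) x))"
  define G where "G = (\<lambda>m. {w \<in> \<Omega>. \<forall>q\<in>\<rat>. \<forall>x\<in>\<rat>. norm (w (clamp_time q) - w (clamp_time (q + c m x))) \<le> \<kappa>})"
  have coord: "(\<lambda>w. w (clamp_time s)) \<in> borel_measurable P" for s
    by (rule measurable_F_P[OF measurable_raw_F[OF coord_raw[OF clamp_time]]]) (use clamp_time in auto)
  have GP: "G m \<in> sets P" for m
  proof -
    have "{w \<in> space P. \<forall>q\<in>\<rat>. \<forall>x\<in>\<rat>. norm (w (clamp_time q) - w (clamp_time (q + c m x))) \<le> \<kappa>} \<in> sets P"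
    proof (intro sets.sets_Collect_countable_All' countable_rat)
      fix q x
      have "(\<lambda>w. norm (w (clamp_time q) - w (clamp_time (q + c m x)))) \<in> borel_measurable P"
        by (intro borel_measurable_norm[THEN measurable_compose[rotated]] borel_measurable_diff coord)
      then show "{w \<in> space P. norm (w (clamp_time q) - w (clamp_time (q + c m x))) \<le> \<kappa>} \<in> sets P"
        by measurable
    qed
    then show ?thesis by (simp add: G_def)
  qed
  have full: "norm (w (clamp_time q) - w (clamp_time (q + c m x))) \<le> \<kappa>" if w: "w \<in> G m" for w m q x
  proof -
    have wc: "continuous_on UNIV (\<lambda>s. w (clamp_time s))"
      using w by (intro continuous_clamp path_spaceD(1)) (auto simp: G_def)
    have cc: "continuous_on UNIV (c m)" unfolding c_def by (intro continuous_intros)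
    have 1: "norm (w (clamp_time q) - w (clamp_time (q + c m x))) \<le> \<kappa>" if "q \<in> \<rat>" for q x
    proof (rule continuous_le_of_Rats[of "\<lambda>x. norm (w (clamp_time q) - w (clamp_time (q + c m x)))"])
      show "continuous_on UNIV (\<lambda>x. norm (w (clamp_time q) - w (clamp_time (q + c m x))))"
        by (intro continuous_intros continuous_on_compose2[OF wc] cc) auto
    qed (use w that in \<open>auto simp: G_def\<close>)
    show ?thesis
    proof (rule continuous_le_of_Rats[of "\<lambda>q. norm (w (clamp_time q) - w (clamp_time (q + c m x)))"])
      show "continuous_on UNIV (\<lambda>q. norm (w (clamp_time q) - w (clamp_time (q + c m x))))"
        by (intro continuous_intros continuous_on_compose2[OF wc]) auto
    qed (rule 1)
  qed
  have osc: "norm (w r - w r') \<le> \<kappa>"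
    if "w \<in> G m" "r \<in> {0..T}" "r' \<in> {0..T}" "\<bar>r - r'\<bar> \<le> 1 / real (Suc m)" for w m r r'
  proof -
    have "c m (r' - r) = r' - r" using that(4) unfolding c_def by (auto simp: abs_if split: if_splits)
    then show ?thesis using full[OF that(1), of r "r' - r"] that(2,3) by (simp add: clamp_time_id)
  qed
  have inc: "incseq G"
  proof (rule incseq_SucI, rule subsetI)
    fix m w assume w: "w \<in> G m"
    have "norm (w (clamp_time q) - w (clamp_time (q + c (Suc m) x))) \<le> \<kappa>" for q x
    proof -
      have "1 / real (Suc (Suc m)) \<le> 1 / real (Suc m)" "0 < 1 / real (Suc (Suc m))"
        by (simp_all add: frac_le)
      then have "c m (c (Suc m) x) = c (Suc m) x" unfolding c_def by linarith
      then show ?thesis using full[OF w, of q "c (Suc m) x"] by simp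
    qed
    then show "w \<in> G (Suc m)" using w by (auto simp: G_def)
  qed
  have UN: "(\<Union>m. G m) = \<Omega>"
  proof (rule antisym)
    show "\<Omega> \<subseteq> (\<Union>m. G m)"
    proof
      fix w :: "real \<Rightarrow> real ^ 'd" assume w: "w \<in> \<Omega>"
      have "uniformly_continuous_on {0..T} w"
        by (rule compact_uniformly_continuous[OF path_spaceD(1)[OF w]]) simp
      then obtain d where d: "0 < d" "\<And>s s'. s \<in> {0..T} \<Longrightarrow> s' \<in> {0..T} \<Longrightarrow> dist s' s < d \<Longrightarrow> dist (w s') (w s) < \<kappa>"
        unfolding uniformly_continuous_on_def using assms(1) by metis
      obtain m where m: "1 / real (Suc m) < d"
        using reals_Archimedean[OF d(1)] by (auto simp: inverse_eq_divide)
      have "norm (w (clamp_time q) - w (clamp_time (q + c m x))) \<le> \<kappa>" for q x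
      proof -
        have "\<bar>c m x\<bar> \<le> 1 / real (Suc m)" unfolding c_def by (auto simp: max_def min_def abs_if)
        then have "dist (clamp_time q) (clamp_time (q + c m x)) < d"
          using m unfolding clamp_time_def dist_real_def by linarith
        from d(2)[OF clamp_time clamp_time this] show ?thesis by (simp add: dist_norm)
      qed
      then show "w \<in> (\<Union>m. G m)" using w by (auto simp: G_def)
    qed
  qed (auto simp: G_def)
  have "(\<lambda>m. prob (G m)) \<longlonglongrightarrow> prob (\<Union>m. G m)"
    using GP by (intro finite_Lim_measure_incseq inc) auto
  then have "(\<lambda>m. prob (G m)) \<longlonglongrightarrow> 1" using UN prob_space by simp
  then have "\<forall>\<^sub>F m in sequentially. 1 - p < prob (G m)" using assms(2) by (intro order_tendstoD(1)) auto
  then obtain m where m: "1 - p < prob (G m)" by (auto simp: eventually_sequentially)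
  have "prob (\<Omega> - G m) = 1 - prob (G m)" using prob_compl[OF GP[of m]] by simp
  then show thesis using m GP osc[of _ m] by (intro that[of "1 / real (Suc m)" "G m"]) (auto simp: osc_le_def)
qed

end

section \<open>Shifted coefficients\<close>

lemma borel_measurable_vec:
  fixes f :: "'m \<Rightarrow> 'e::euclidean_space ^ 'n"
  assumes "\<And>i. (\<lambda>x. f x $ i) \<in> borel_measurable M"
  shows "f \<in> borel_measurable M"
proof (subst borel_measurable_euclidean_space, rule ballI)
  fix b :: "'e ^ 'n" assume "b \<in> Basis"
  then obtain i u where b: "b = axis i u" "u \<in> Basis" by (auto simp: Basis_vec_def)
  have "(\<lambda>x. f x $ i \<bullet> u) \<in> borel_measurable M" using assms[of i] by measurable
  then show "(\<lambda>x. f x \<bullet> b) \<in> borel_measurable M" by (simp add: b inner_axis)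
qed

text \<open>The tangent inequality makes \<open>exp\<close> Lipschitz between two points with its
  larger value as constant; the sum of both values keeps the bound symmetric.\<close>

lemma abs_exp_diff_le: "\<bar>exp x - exp y\<bar> \<le> (exp x + exp y) * \<bar>x - y\<bar>" for x y :: real
proof (cases x y rule: linorder_le_cases)
  case le
  have "1 + (x - y) \<le> exp (x - y)" by (rule exp_ge_add_one_self)
  then have "exp y * (1 + (x - y)) \<le> exp y * exp (x - y)" by (intro mult_left_mono) auto
  then have "exp y - exp x \<le> exp y * (y - x)" by (simp flip: exp_add add: algebra_simps)
  also have "\<dots> \<le> (exp x + exp y) * (y - x)" using le by (intro mult_right_mono) auto
  finally show ?thesis using le by simp
next
  case ge
  have "1 + (y - x) \<le> exp (y - x)" by (rule exp_ge_add_one_self)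
  then have "exp x * (1 + (y - x)) \<le> exp x * exp (y - x)" by (intro mult_left_mono) auto
  then have "exp x - exp y \<le> exp x * (x - y)" by (simp flip: exp_add add: algebra_simps)
  also have "\<dots> \<le> (exp x + exp y) * (x - y)" using ge by (intro mult_right_mono) auto
  finally show ?thesis using ge by simp
qed

lemma integrable_indicator_Icc[simp]: "integrable lborel (indicator {x..y :: real} :: real \<Rightarrow> real)"
  by (rule integrable_real_indicator) (simp_all add: emeasure_lborel_Icc_eq)

text \<open>Used with \<open>a\<close> small, so that factors known to be merely bounded in L2 carry
  a small weight while differences carry the large one.\<close>

lemma weighted_AM_GM: "x * y \<le> a * x\<^sup>2 + y\<^sup>2 / a" if "0 < a" for x y a :: real
proof -
  have "0 \<le> (a * x - y)\<^sup>2 + (a * x)\<^sup>2 + y\<^sup>2" by simp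
  then have "a * (x * y) \<le> a * (a * x\<^sup>2 + y\<^sup>2 / a)"
    using that by (simp add: power2_eq_square algebra_simps)
  then show ?thesis using that by simp
qed

lemma power2_sum_le: "(x + y :: real)\<^sup>2 \<le> 2 * x\<^sup>2 + 2 * y\<^sup>2"
proof -
  have "0 \<le> (x - y)\<^sup>2" by simp
  then show ?thesis by (simp add: power2_eq_square algebra_simps)
qed

text \<open>Meant for \<open>G\<close> a set of paths with small oscillation: a sharp bound there
  and a crude one elsewhere, which is charged only with the probability of the exceptional
  set.\<close>

lemma (in prob_space) nn_integral_le_good_bad:
  assumes G: "G \<in> sets M" and p: "prob (space M - G) \<le> p" and nn: "0 \<le> c1" "0 \<le> c2"
    and good: "\<And>x. x \<in> G \<Longrightarrow> \<Phi> x \<le> ennreal c1" and all: "\<And>x. x \<in> space M \<Longrightarrow> \<Phi> x \<le> ennreal c2"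
  shows "(\<integral>\<^sup>+x. \<Phi> x \<partial>M) \<le> ennreal (c1 + c2 * p)"
proof -
  have "(\<integral>\<^sup>+x. \<Phi> x \<partial>M) \<le> (\<integral>\<^sup>+x. ennreal c1 + ennreal c2 * indicator (space M - G) x \<partial>M)"
  proof (rule nn_integral_mono)
    fix x assume "x \<in> space M"
    then show "\<Phi> x \<le> ennreal c1 + ennreal c2 * indicator (space M - G) x"
      using good[of x] all[of x] by (cases "x \<in> G") (auto intro: add_increasing)
  qed
  also have "\<dots> = ennreal c1 + ennreal c2 * ennreal (prob (space M - G))"
    using G by (subst nn_integral_add) (auto simp: nn_integral_cmult emeasure_space_1 emeasure_eq_measure prob_space)
  also have "\<dots> = ennreal (c1 + c2 * prob (space M - G))"
    using nn by (simp add: ennreal_mult ennreal_plus)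
  also have "\<dots> \<le> ennreal (c1 + c2 * p)"
    using p nn by (intro ennreal_leI add_left_mono mult_left_mono)
  finally show ?thesis .
qed

section \<open>Coefficients with a control inserted\<close>

locale game = wiener_space T W for T :: real and W :: "(real \<Rightarrow> real ^ 'd) measure" +
  fixes A :: "'n::finite \<Rightarrow> 'e::euclidean_space set"
    and b :: "real \<Rightarrow> (real \<Rightarrow> real ^ 'd) \<Rightarrow> 'e ^ 'n \<Rightarrow> real ^ 'd"
    and f :: "real \<Rightarrow> (real \<Rightarrow> real ^ 'd) \<Rightarrow> 'e ^ 'n \<Rightarrow> real ^ 'n"
    and \<xi> :: "(real \<Rightarrow> real ^ 'd) \<Rightarrow> real ^ 'n"
    and \<rho> :: "real \<Rightarrow> real" and C :: real
  assumes \<rho>: "modulus_of_continuity \<rho>" and C_nonneg: "0 \<le> C"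
    and b_prog: "prog_measurable_coeff T W (profiles A) b"
    and b_mod: "coeff_has_modulus T (profiles A) \<rho> b"
    and b_bound: "\<And>t \<omega> a. t \<in> {0..T} \<Longrightarrow> \<omega> \<in> path_space T \<Longrightarrow> a \<in> profiles A \<Longrightarrow> norm (b t \<omega> a) \<le> C"
    and f_prog: "prog_measurable_coeff T W (profiles A) f"
    and f_mod: "coeff_has_modulus T (profiles A) \<rho> f"
    and f_bound: "\<And>t \<omega> a. t \<in> {0..T} \<Longrightarrow> \<omega> \<in> path_space T \<Longrightarrow> a \<in> profiles A \<Longrightarrow> norm (f t \<omega> a) \<le> C"
    and \<xi>_mod: "\<And>\<omega> \<omega>'. \<omega> \<in> path_space T \<Longrightarrow> \<omega>' \<in> path_space T \<Longrightarrow>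
           norm (\<xi> \<omega> - \<xi> \<omega>') \<le> \<rho> (path_norm T (\<lambda>s. \<omega> s - \<omega>' s))"
    and \<xi>_bound: "\<And>\<omega>. \<omega> \<in> path_space T \<Longrightarrow> norm (\<xi> \<omega>) \<le> C"
begin

text \<open>Lets \<open>b\<close> and \<open>f\<close>, which have different codomains, share the
  same estimates.\<close>

definition good_coeff :: "(real \<Rightarrow> (real \<Rightarrow> real ^ 'd) \<Rightarrow> 'e ^ 'n \<Rightarrow> 'b::euclidean_space) \<Rightarrow> bool" where
  "good_coeff g \<longleftrightarrow> prog_measurable_coeff T W (profiles A) g \<and> coeff_has_modulus T (profiles A) \<rho> g \<and>
     (\<forall>t\<in>{0..T}. \<forall>\<omega>\<in>\<Omega>. \<forall>a\<in>profiles A. norm (g t \<omega> a) \<le> C)"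

lemma good_b: "good_coeff b" and good_f: "good_coeff f"
  using b_prog b_mod b_bound f_prog f_mod f_bound by (auto simp: good_coeff_def)

abbreviation "CP \<equiv> control_profiles T W A"

lemma control_profile_measurable:
  assumes "\<alpha> \<in> CP" "v \<in> {0..T}"
  shows "(\<lambda>(s, w). \<alpha> s w) \<in> restrict_space borel {0..v} \<Otimes>\<^sub>M F v \<rightarrow>\<^sub>M restrict_space borel (profiles A)"
proof (rule measurable_restrict_space2)
  have comp: "(\<lambda>(s, w). \<alpha> s w $ i) \<in> restrict_space borel {0..v} \<Otimes>\<^sub>M F v \<rightarrow>\<^sub>M restrict_space borel (A i)" for i
    using assms unfolding control_profiles_def controls_def prog_measurable_def by blast
  have "(\<lambda>z. case_prod \<alpha> z $ i) \<in> borel_measurable (restrict_space borel {0..v} \<Otimes>\<^sub>M F v)" for i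
    using comp[of i] by (simp add: measurable_restrict_space2_iff split_beta')
  then show "(\<lambda>(s, w). \<alpha> s w) \<in> borel_measurable (restrict_space borel {0..v} \<Otimes>\<^sub>M F v)"
    by (rule borel_measurable_vec)
  show "(\<lambda>(s, w). \<alpha> s w) \<in> space (restrict_space borel {0..v} \<Otimes>\<^sub>M F v) \<rightarrow> profiles A"
  proof
    fix z assume z: "z \<in> space (restrict_space borel {0..v} \<Otimes>\<^sub>M F v)"
    have "\<alpha> (fst z) (snd z) $ i \<in> A i" for i
      using measurable_space[OF comp[of i] z] by (simp add: space_restrict_space split_beta')
    then show "(case z of (s, w) \<Rightarrow> \<alpha> s w) \<in> profiles A" by (simp add: profiles_def split_beta')
  qed
qed

lemma control_profile_in:
  assumes "\<alpha> \<in> CP" "s \<in> {0..T}" "w \<in> \<Omega>"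
  shows "\<alpha> s w \<in> profiles A"
  using measurable_space[OF control_profile_measurable[OF assms(1), of T], of "(s, w)"] assms T_nonneg
  by (simp add: space_pair_measure space_restrict_space)

lemma deviate_control_profile:
  assumes "\<alpha> \<in> CP" "\<beta> \<in> controls T W (A i)"
  shows "deviate \<alpha> i \<beta> \<in> CP"
  unfolding control_profiles_def
proof (rule CollectI, rule allI)
  fix j
  show "(\<lambda>s \<omega>. deviate \<alpha> i \<beta> s \<omega> $ j) \<in> controls T W (A j)"
    using assms by (cases "j = i") (auto simp: deviate_def control_profiles_def)
qed

text \<open>Setting the coefficient to zero beyond the remaining horizon \<open>T - t\<close> puts
  integrands for different starting times on one time axis, so that they can be subtracted.\<close>

definition ext_coeff where
  "ext_coeff g t \<omega> \<alpha> s w = indicator {0..T - t} s *\<^sub>R shift_coeff T t \<omega> g s w (\<alpha> s w)"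

context
  fixes g :: "real \<Rightarrow> (real \<Rightarrow> real ^ 'd) \<Rightarrow> 'e ^ 'n \<Rightarrow> 'b::euclidean_space"
  assumes g: "good_coeff g"
begin

lemma coeff_prog:
  assumes "(t, \<omega>) \<in> S" "\<alpha> \<in> CP" "v \<in> {0..T - t}"
  shows "(\<lambda>(s, w). shift_coeff T t \<omega> g s w (\<alpha> s w)) \<in> restrict_space borel {0..v} \<Otimes>\<^sub>M F v \<rightarrow>\<^sub>M borel"
proof (rule shift_coeff_measurable[OF \<rho> _ _ _ _ assms(3)])
  show "coeff_has_modulus T (profiles A) \<rho> g" using g by (simp add: good_coeff_def)
  show "g t \<omega> \<in> restrict_space borel (profiles A) \<rightarrow>\<^sub>M borel" if "t \<in> {0..T}" "\<omega> \<in> \<Omega>" for t \<omega>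
    using g that by (intro coeff_section_measurable) (simp_all add: good_coeff_def)
  show "(\<lambda>(s, w). \<alpha> s w) \<in> restrict_space borel {0..v} \<Otimes>\<^sub>M F v \<rightarrow>\<^sub>M restrict_space borel (profiles A)"
    using assms by (intro control_profile_measurable) auto
qed (use assms in auto)

lemma coeff_bound:
  assumes "(t, \<omega>) \<in> S" "\<alpha> \<in> CP" "s \<in> {0..T - t}" "w \<in> \<Omega>"
  shows "norm (shift_coeff T t \<omega> g s w (\<alpha> s w)) \<le> C"
proof -
  have "\<alpha> s w \<in> profiles A" using assms by (intro control_profile_in) auto
  moreover have "concat_path T t \<omega> w \<in> \<Omega>" using assms by (intro concat_path_in) auto
  moreover have "t + s \<in> {0..T}" using assms by auto
  ultimately show ?thesis using g by (simp add: shift_coeff_def good_coeff_def)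
qed

lemma ext_coeff_bound:
  assumes "(t, \<omega>) \<in> S" "\<alpha> \<in> CP" "w \<in> \<Omega>"
  shows "norm (ext_coeff g t \<omega> \<alpha> s w) \<le> C * indicator {0..T} s"
  using coeff_bound[OF assms(1,2) _ assms(3), of s] assms(1) C_nonneg by (auto simp: ext_coeff_def indicator_def)

lemma ext_coeff_measurable_F:
  assumes "(t, \<omega>) \<in> S" "\<alpha> \<in> CP"
  shows "(\<lambda>(w, s). ext_coeff g t \<omega> \<alpha> s w) \<in> F (T - t) \<Otimes>\<^sub>M borel \<rightarrow>\<^sub>M borel"
  using indicator_measurable_restrict[OF coeff_prog[OF assms, of "T - t"], of "{0..T - t}"] assms(1)
  by (simp add: ext_coeff_def)

lemma ext_coeff_measurable:
  assumes "(t, \<omega>) \<in> S" "\<alpha> \<in> CP"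
  shows "(\<lambda>(w, s). ext_coeff g t \<omega> \<alpha> s w) \<in> P \<Otimes>\<^sub>M borel \<rightarrow>\<^sub>M borel"
  using ext_coeff_measurable_F[OF assms] by (rule measurable_pair_F_P)

lemma ext_coeff_measurable_path:
  assumes "(t, \<omega>) \<in> S" "\<alpha> \<in> CP" "w \<in> \<Omega>"
  shows "(\<lambda>s. ext_coeff g t \<omega> \<alpha> s w) \<in> borel_measurable borel"
  using measurable_compose[OF measurable_Pair1'[of w P borel] ext_coeff_measurable[OF assms(1,2)]] assms(3) by simp

text \<open>On the common horizon both coefficients are evaluated at the same action, so the modulus
  applies whatever the control is. Between the two horizons only one integrand survives, and it is
  bounded by \<open>C\<close>.\<close>

lemma ext_coeff_diff:
  assumes z: "(t, \<omega>) \<in> S" "(t', \<omega>') \<in> S" and \<alpha>: "\<alpha> \<in> CP" and w: "w \<in> \<Omega>"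
    and osc: "osc_le \<kappa> \<bar>t - t'\<bar> w"
    and R: "\<And>x. 0 \<le> x \<Longrightarrow> x \<le> path_dist T (t, \<omega>) (t', \<omega>') + \<kappa> \<Longrightarrow> \<rho> x \<le> e" and e: "0 \<le> e"
  shows "norm (ext_coeff g t \<omega> \<alpha> s w - ext_coeff g t' \<omega>' \<alpha> s w)
    \<le> e * indicator {0..T} s + C * indicator {T - max t t'..T - min t t'} s"
proof (cases "s \<in> {0..T - max t t'}")
  case True
  then have s: "s \<in> {0..T - t}" "s \<in> {0..T - t'}" "s \<in> {0..T}" using z by auto
  have a: "\<alpha> s w \<in> profiles A" using s \<alpha> w by (intro control_profile_in) auto
  have c: "concat_path T t \<omega> w \<in> \<Omega>" "concat_path T t' \<omega>' w \<in> \<Omega>"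
    using z w by (auto intro!: concat_path_in)
  have ts: "t + s \<in> {0..T}" "t' + s \<in> {0..T}" using s z by auto
  let ?d = "path_dist T (t + s, concat_path T t \<omega> w) (t' + s, concat_path T t' \<omega>' w)"
  have "norm (ext_coeff g t \<omega> \<alpha> s w - ext_coeff g t' \<omega>' \<alpha> s w) \<le> \<rho> ?d"
    using g a c ts s unfolding good_coeff_def coeff_has_modulus_def by (simp add: ext_coeff_def shift_coeff_def)
  also have "\<dots> \<le> e"
  proof (rule R)
    show "0 \<le> ?d" using c ts by (intro path_dist_nonneg T_nonneg) auto
    show "?d \<le> path_dist T (t, \<omega>) (t', \<omega>') + \<kappa>"
      using z w osc s by (intro path_dist_concat_le) auto
  qed
  also have "e \<le> e * indicator {0..T} s + C * indicator {T - max t t'..T - min t t'} s"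
    using s C_nonneg by simp
  finally show ?thesis .
next
  case False
  show ?thesis
  proof (cases "s \<in> {0..T - t} \<or> s \<in> {0..T - t'}")
    case True
    have "norm (ext_coeff g t \<omega> \<alpha> s w - ext_coeff g t' \<omega>' \<alpha> s w) \<le> C"
      using coeff_bound[OF z(1) \<alpha> _ w, of s] coeff_bound[OF z(2) \<alpha> _ w, of s] True False C_nonneg
      by (cases "s \<in> {0..T - t}"; cases "s \<in> {0..T - t'}") (auto simp: ext_coeff_def)
    moreover have "s \<in> {T - max t t'..T - min t t'}" using True False by auto
    ultimately show ?thesis using e by (simp add: add_increasing)
  next
    case False
    then show ?thesis using e C_nonneg by (simp add: ext_coeff_def)
  qed
qed

lemma ext_coeff_integrable:
  assumes "(t, \<omega>) \<in> S" "\<alpha> \<in> CP" "w \<in> \<Omega>"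
  shows "integrable lborel (\<lambda>s. ext_coeff g t \<omega> \<alpha> s w)"
proof (rule Bochner_Integration.integrable_bound)
  show "integrable lborel (\<lambda>s. C * indicator {0..T} s)" by simp
  show "(\<lambda>s. ext_coeff g t \<omega> \<alpha> s w) \<in> borel_measurable lborel"
    using ext_coeff_measurable_path[OF assms] by simp
  show "AE s in lborel. norm (ext_coeff g t \<omega> \<alpha> s w) \<le> norm (C * indicator {0..T} s)"
    using ext_coeff_bound[OF assms] C_nonneg by (intro AE_I2) simp
qed

lemma ext_coeff_integrable_sq:
  assumes "(t, \<omega>) \<in> S" "\<alpha> \<in> CP" "w \<in> \<Omega>"
  shows "integrable lborel (\<lambda>s. (norm (ext_coeff g t \<omega> \<alpha> s w))\<^sup>2)"
proof (rule Bochner_Integration.integrable_bound)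
  show "integrable lborel (\<lambda>s. C\<^sup>2 * indicator {0..T} s)" by simp
  show "(\<lambda>s. (norm (ext_coeff g t \<omega> \<alpha> s w))\<^sup>2) \<in> borel_measurable lborel"
    using ext_coeff_measurable_path[OF assms] by simp
  show "AE s in lborel. norm ((norm (ext_coeff g t \<omega> \<alpha> s w))\<^sup>2) \<le> norm (C\<^sup>2 * indicator {0..T} s)"
  proof (rule AE_I2)
    fix s
    have "(norm (ext_coeff g t \<omega> \<alpha> s w))\<^sup>2 \<le> (C * indicator {0..T} s)\<^sup>2"
      by (intro power_mono ext_coeff_bound assms) simp
    then show "norm ((norm (ext_coeff g t \<omega> \<alpha> s w))\<^sup>2) \<le> norm (C\<^sup>2 * indicator {0..T} s)"
      by (cases "s \<in> {0..T}") auto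
  qed
qed

text \<open>The first two bounds hold for every path and serve on the exceptional set; the last two
  use small oscillation. In the fourth, the factors \<open>2\<close> come from squaring a sum of two
  terms.\<close>

lemma ext_coeff_diff_integral:
  assumes z: "(t, \<omega>) \<in> S" "(t', \<omega>') \<in> S" and \<alpha>: "\<alpha> \<in> CP" and w: "w \<in> \<Omega>"
  shows "(LBINT s. norm (ext_coeff g t \<omega> \<alpha> s w - ext_coeff g t' \<omega>' \<alpha> s w)) \<le> 2 * C * T" (is ?all)
    and "(\<integral>\<^sup>+s. ennreal ((norm (ext_coeff g t \<omega> \<alpha> s w - ext_coeff g t' \<omega>' \<alpha> s w))\<^sup>2) \<partial>lborel) \<le> ennreal (4 * C\<^sup>2 * T)" (is ?allsq)
    and "\<And>e \<kappa>. osc_le \<kappa> \<bar>t - t'\<bar> w \<Longrightarrow>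
      (\<And>x. 0 \<le> x \<Longrightarrow> x \<le> path_dist T (t, \<omega>) (t', \<omega>') + \<kappa> \<Longrightarrow> \<rho> x \<le> e) \<Longrightarrow> 0 \<le> e \<Longrightarrow>
      (LBINT s. norm (ext_coeff g t \<omega> \<alpha> s w - ext_coeff g t' \<omega>' \<alpha> s w)) \<le> e * T + C * \<bar>t - t'\<bar>"
    and "\<And>e \<kappa>. osc_le \<kappa> \<bar>t - t'\<bar> w \<Longrightarrow>
      (\<And>x. 0 \<le> x \<Longrightarrow> x \<le> path_dist T (t, \<omega>) (t', \<omega>') + \<kappa> \<Longrightarrow> \<rho> x \<le> e) \<Longrightarrow> 0 \<le> e \<Longrightarrow>
      (\<integral>\<^sup>+s. ennreal ((norm (ext_coeff g t \<omega> \<alpha> s w - ext_coeff g t' \<omega>' \<alpha> s w))\<^sup>2) \<partial>lborel) \<le> ennreal (2 * e\<^sup>2 * T + 2 * C\<^sup>2 * \<bar>t - t'\<bar>)"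
proof -
  let ?D = "\<lambda>s. ext_coeff g t \<omega> \<alpha> s w - ext_coeff g t' \<omega>' \<alpha> s w"
  have int: "integrable lborel (\<lambda>s. norm (?D s))"
    by (intro integrable_norm Bochner_Integration.integrable_diff ext_coeff_integrable z \<alpha> w)
  have bd: "norm (?D s) \<le> 2 * C * indicator {0..T} s" for s
    using norm_triangle_ineq4[of "ext_coeff g t \<omega> \<alpha> s w" "ext_coeff g t' \<omega>' \<alpha> s w"]
      ext_coeff_bound[OF z(1) \<alpha> w, of s] ext_coeff_bound[OF z(2) \<alpha> w, of s] by linarith
  have "(LBINT s. norm (?D s)) \<le> (LBINT s. 2 * C * indicator {0..T} s)"
    by (rule integral_mono[OF int]) (use bd in auto)
  then show ?all using T_nonneg by simp
  have "(\<integral>\<^sup>+s. ennreal ((norm (?D s))\<^sup>2) \<partial>lborel) \<le> (\<integral>\<^sup>+s. ennreal (4 * C\<^sup>2) * indicator {0..T} s \<partial>lborel)"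
  proof (rule nn_integral_mono)
    fix s
    have "(norm (?D s))\<^sup>2 \<le> (2 * C * indicator {0..T} s)\<^sup>2" using bd by (rule power_mono) simp
    then show "ennreal ((norm (?D s))\<^sup>2) \<le> ennreal (4 * C\<^sup>2) * indicator {0..T} s"
      by (cases "s \<in> {0..T}") (auto intro!: ennreal_leI simp: power_mult_distrib)
  qed
  also have "\<dots> = ennreal (4 * C\<^sup>2 * T)"
    using T_nonneg by (simp add: nn_integral_cmult ennreal_mult)
  finally show ?allsq .
  fix e \<kappa> :: real
  assume A: "osc_le \<kappa> \<bar>t - t'\<bar> w"
    "\<And>x. 0 \<le> x \<Longrightarrow> x \<le> path_dist T (t, \<omega>) (t', \<omega>') + \<kappa> \<Longrightarrow> \<rho> x \<le> e" and e: "0 \<le> e"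
  let ?B = "{T - max t t'..T - min t t'}"
  have len: "T - min t t' - (T - max t t') = \<bar>t - t'\<bar>" by (simp add: max_def min_def)
  have le: "T - max t t' \<le> T - min t t'" by simp
  note D = ext_coeff_diff[OF z \<alpha> w A e]
  have "(LBINT s. norm (?D s)) \<le> (LBINT s. e * indicator {0..T} s + C * indicator ?B s)"
    by (rule integral_mono[OF int]) (use D in auto)
  also have "\<dots> = e * T + C * \<bar>t - t'\<bar>"
    using T_nonneg le by (subst Bochner_Integration.integral_add) (auto simp: len[simplified])
  finally show "(LBINT s. norm (?D s)) \<le> e * T + C * \<bar>t - t'\<bar>" .
  have "(\<integral>\<^sup>+s. ennreal ((norm (?D s))\<^sup>2) \<partial>lborel)
      \<le> (\<integral>\<^sup>+s. ennreal (2 * e\<^sup>2) * indicator {0..T} s + ennreal (2 * C\<^sup>2) * indicator ?B s \<partial>lborel)"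
  proof (rule nn_integral_mono)
    fix s
    have "(norm (?D s))\<^sup>2 \<le> (e * indicator {0..T} s + C * indicator ?B s)\<^sup>2"
      by (rule power_mono[OF D norm_ge_zero])
    also have "\<dots> \<le> 2 * (e * indicator {0..T} s)\<^sup>2 + 2 * (C * indicator ?B s)\<^sup>2" by (rule power2_sum_le)
    also have "\<dots> = 2 * e\<^sup>2 * indicator {0..T} s + 2 * C\<^sup>2 * indicator ?B s"
      by (simp add: indicator_def power_mult_distrib)
    finally have "ennreal ((norm (?D s))\<^sup>2) \<le> ennreal (2 * e\<^sup>2 * indicator {0..T} s + 2 * C\<^sup>2 * indicator ?B s)"
      by (rule ennreal_leI)
    also have "\<dots> = ennreal (2 * e\<^sup>2) * indicator {0..T} s + ennreal (2 * C\<^sup>2) * indicator ?B s"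
      by (auto simp: indicator_def ennreal_plus[symmetric] simp del: ennreal_plus)
    finally show "ennreal ((norm (?D s))\<^sup>2) \<le> ennreal (2 * e\<^sup>2) * indicator {0..T} s + ennreal (2 * C\<^sup>2) * indicator ?B s" .
  qed
  also have "\<dots> = ennreal (2 * e\<^sup>2) * ennreal T + ennreal (2 * C\<^sup>2) * ennreal \<bar>t - t'\<bar>"
    using T_nonneg le len by (simp add: nn_integral_add nn_integral_cmult)
  also have "\<dots> = ennreal (2 * e\<^sup>2 * T + 2 * C\<^sup>2 * \<bar>t - t'\<bar>)"
    using T_nonneg by (simp add: ennreal_mult ennreal_plus)
  finally show "(\<integral>\<^sup>+s. ennreal ((norm (?D s))\<^sup>2) \<partial>lborel) \<le> ennreal (2 * e\<^sup>2 * T + 2 * C\<^sup>2 * \<bar>t - t'\<bar>)" .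
qed

end

lemma stopped_path_in:
  assumes "(t, \<omega>) \<in> S"
  shows "(\<lambda>s\<in>{0..T}. \<omega> (min t s)) \<in> \<Omega>"
proof -
  have "continuous_on {0..T} (\<lambda>s\<in>{0..T}. \<omega> (min t s))"
    using continuous_on_stopped[of \<omega> T t] assms by (auto intro: continuous_on_eq)
  then show ?thesis using assms T_nonneg path_spaceD(2)[of \<omega> T] by (auto simp: path_space_def)
qed

text \<open>The terminal payoff meets the same obstacle as the coefficients, so it is disguised as
  one: a function of the stopped path with a dummy real action, evaluated at time \<open>T\<close>,
  where stopping changes nothing.\<close>

lemma terminal_measurable:
  assumes "(t, \<omega>) \<in> S"
  shows "(\<lambda>w. \<xi> (concat_path T t \<omega> w)) \<in> borel_measurable P"
proof -
  define g where "g = (\<lambda>t \<omega> (a :: real). \<xi> (\<lambda>s\<in>{0..T}. \<omega> (min t s)))"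
  have mono: "mono_on {0..} \<rho>" using \<rho> by (simp add: modulus_of_continuity_def)
  have mod: "coeff_has_modulus T UNIV \<rho> g"
    unfolding coeff_has_modulus_def
  proof (intro ballI)
    fix t t' \<omega> \<omega>' and a :: real assume z: "t \<in> {0..T}" "t' \<in> {0..T}" "\<omega> \<in> \<Omega>" "\<omega>' \<in> \<Omega>"
    have eq: "path_norm T (\<lambda>s. (\<lambda>s\<in>{0..T}. \<omega> (min t s)) s - (\<lambda>s\<in>{0..T}. \<omega>' (min t' s)) s)
        = path_norm T (\<lambda>s. \<omega> (min t s) - \<omega>' (min t' s))"
      unfolding path_norm_def by (intro SUP_cong) auto
    have "norm (g t \<omega> a - g t' \<omega>' a) \<le> \<rho> (path_norm T (\<lambda>s. \<omega> (min t s) - \<omega>' (min t' s)))"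
      unfolding g_def eq[symmetric] using z by (intro \<xi>_mod stopped_path_in) auto
    also have "\<dots> \<le> \<rho> (path_dist T (t, \<omega>) (t', \<omega>'))"
      using z path_norm_nonneg[OF T_nonneg continuous_on_diff[OF continuous_on_stopped continuous_on_stopped], of \<omega> t \<omega>' t']
      by (intro mono_onD[OF mono]) (auto simp: path_dist_def intro: add_nonneg_nonneg)
    finally show "norm (g t \<omega> a - g t' \<omega>' a) \<le> \<rho> (path_dist T (t, \<omega>) (t', \<omega>'))" .
  qed
  have z: "(T, concat_path T t \<omega> w) \<in> S" if "w \<in> space P" for w
    using assms that T_nonneg by (auto intro!: concat_path_in)
  have dm: "(\<lambda>w. path_dist T (T, concat_path T t \<omega> w) y) \<in> borel_measurable P" if "y \<in> S" for y
  proof (rule path_dist_measurable[OF z that])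
    fix q assume q: "q \<in> {0..T}"
    have "(\<lambda>w. w (max 0 (q - t))) \<in> borel_measurable P"
      using q assms by (intro measurable_F_P[of _ T] measurable_raw_F coord_raw) auto
    then have "(\<lambda>w. \<omega> (min t q) + w (max 0 (q - t))) \<in> borel_measurable P" by measurable
    then show "(\<lambda>w. concat_path T t \<omega> w (min T q)) \<in> borel_measurable P"
      by (rule measurable_cong[THEN iffD1, rotated]) (use q assms in \<open>auto simp: concat_path_eq\<close>)
  qed auto
  have "(\<lambda>w. g T (concat_path T t \<omega> w) 0) \<in> borel_measurable P"
  proof (rule coeff_comp_measurable[OF \<rho> mod, where a="\<lambda>_. 0"])
    show "g t \<omega> \<in> restrict_space borel UNIV \<rightarrow>\<^sub>M borel" for t \<omega>
      unfolding g_def by simp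
  qed (use z dm in auto)
  moreover have "g T (concat_path T t \<omega> w) a = \<xi> (concat_path T t \<omega> w)" for w a
    unfolding g_def by (intro arg_cong[where f=\<xi>]) (auto simp: concat_path_def fun_eq_iff)
  ultimately show ?thesis by simp
qed

end

section \<open>Uniform continuity of the costs\<close>

context game
begin

definition drift_integral where
  "drift_integral t \<omega> \<alpha> = ito_integral T W (T - t) (\<lambda>s w. shift_coeff T t \<omega> b s w (\<alpha> s w))"

definition drift_energy where
  "drift_energy t \<omega> \<alpha> w = (LBINT s. (norm (ext_coeff b t \<omega> \<alpha> s w))\<^sup>2)"

definition dens where
  "dens t \<omega> \<alpha> w = exp (drift_integral t \<omega> \<alpha> w - 1 / 2 * drift_energy t \<omega> \<alpha> w)"

definition pay :: "real \<Rightarrow> (real \<Rightarrow> real ^ 'd) \<Rightarrow> (real \<Rightarrow> (real \<Rightarrow> real ^ 'd) \<Rightarrow> 'e ^ 'n) \<Rightarrow> (real \<Rightarrow> real ^ 'd) \<Rightarrow> real ^ 'n" where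
  "pay t \<omega> \<alpha> w = \<xi> (concat_path T t \<omega> w) + (LBINT s. ext_coeff f t \<omega> \<alpha> s w)"

text \<open>The exponential moment bound of \<open>ito_integral_exists\<close> at the longest
  horizon, uniform over starting points and controls.\<close>

definition "K = exp (2 * C\<^sup>2 * T)"

text \<open>\<open>ito_integral\<close> is an arbitrary version, while the moment bound is known for
  the version that was constructed. Stability with equal integrands identifies the two almost
  surely.\<close>

lemma drift_integral:
  assumes z: "(t, \<omega>) \<in> S" and \<alpha>: "\<alpha> \<in> CP"
  shows has_drift_integral:
      "has_ito_integral T W (T - t) (\<lambda>s w. shift_coeff T t \<omega> b s w (\<alpha> s w)) (drift_integral t \<omega> \<alpha>)"
    and drift_integral_measurable: "drift_integral t \<omega> \<alpha> \<in> borel_measurable P"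
    and exp_drift_integral: "(\<integral>\<^sup>+w. ennreal (exp (2 * drift_integral t \<omega> \<alpha> w)) \<partial>P) \<le> ennreal K"
proof -
  let ?H = "\<lambda>s w. shift_coeff T t \<omega> b s w (\<alpha> s w)"
  have t: "0 \<le> T - t" "T - t \<le> T" using z by auto
  obtain X where X: "has_ito_integral T W (T - t) ?H X"
    and e: "(\<integral>\<^sup>+w. ennreal (exp (2 * X w)) \<partial>P) \<le> ennreal (exp (2 * C\<^sup>2 * (T - t)))"
    using ito_integral_exists[OF t coeff_bound[OF good_b z \<alpha>] coeff_prog[OF good_b z \<alpha>]] by blast
  show H: "has_ito_integral T W (T - t) ?H (drift_integral t \<omega> \<alpha>)"
    unfolding drift_integral_def ito_integral_def
    by (rule someI[where P="has_ito_integral T W (T - t) ?H"]) (rule X)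
  then show m[measurable]: "drift_integral t \<omega> \<alpha> \<in> borel_measurable P"
    unfolding has_ito_integral_def by blast
  have [measurable]: "X \<in> borel_measurable P" using X unfolding has_ito_integral_def by blast
  have meas: "(\<lambda>(w, s). indicator {0..T - t} s *\<^sub>R ?H s w) \<in> P \<Otimes>\<^sub>M borel \<rightarrow>\<^sub>M borel"
    using ext_coeff_measurable[OF good_b z \<alpha>] by (simp add: ext_coeff_def)
  have "(\<integral>\<^sup>+w. ennreal ((drift_integral t \<omega> \<alpha> w - X w)\<^sup>2) \<partial>P) = 0"
    using ito_integral_stability[OF t(2) t(2) meas meas H X] by simp
  then have "AE w in P. ennreal ((drift_integral t \<omega> \<alpha> w - X w)\<^sup>2) = 0"
    by (subst (asm) nn_integral_0_iff_AE) auto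
  then have "AE w in P. drift_integral t \<omega> \<alpha> w = X w"
    by eventually_elim (simp add: ennreal_eq_0_iff power2_less_eq_zero_iff)
  then have "(\<integral>\<^sup>+w. ennreal (exp (2 * drift_integral t \<omega> \<alpha> w)) \<partial>P) = (\<integral>\<^sup>+w. ennreal (exp (2 * X w)) \<partial>P)"
    by (intro nn_integral_cong_AE) (auto elim!: eventually_mono)
  also have "\<dots> \<le> ennreal K"
    unfolding K_def using z by (intro order_trans[OF e] ennreal_leI) (auto intro: mult_left_mono)
  finally show "(\<integral>\<^sup>+w. ennreal (exp (2 * drift_integral t \<omega> \<alpha> w)) \<partial>P) \<le> ennreal K" .
qed

lemma drift_energy:
  assumes z: "(t, \<omega>) \<in> S" and \<alpha>: "\<alpha> \<in> CP"
  shows drift_energy_measurable: "drift_energy t \<omega> \<alpha> \<in> borel_measurable P"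
    and drift_energy_nonneg: "0 \<le> drift_energy t \<omega> \<alpha> w"
proof -
  have "(\<lambda>z. (norm (ext_coeff b t \<omega> \<alpha> (snd z) (fst z)))\<^sup>2) \<in> borel_measurable (P \<Otimes>\<^sub>M lborel)"
    using ext_coeff_measurable[OF good_b z \<alpha>] by (simp add: split_beta' cong: measurable_cong_sets)
  then show "drift_energy t \<omega> \<alpha> \<in> borel_measurable P"
    unfolding drift_energy_def by (intro lborel.borel_measurable_lebesgue_integral) (simp add: split_beta')
  show "0 \<le> drift_energy t \<omega> \<alpha> w" unfolding drift_energy_def by (rule Bochner_Integration.integral_nonneg) simp
qed

text \<open>The energy is nonnegative, so dropping it only increases the density, and the square is
  dominated by the exponential of twice the stochastic integral.\<close>

lemma dens:
  assumes z: "(t, \<omega>) \<in> S" and \<alpha>: "\<alpha> \<in> CP"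
  shows dens_measurable: "dens t \<omega> \<alpha> \<in> borel_measurable P"
    and dens_L2: "(\<integral>\<^sup>+w. ennreal ((dens t \<omega> \<alpha> w)\<^sup>2) \<partial>P) \<le> ennreal K"
    and dens_integrable: "integrable P (dens t \<omega> \<alpha>)"
proof -
  note [measurable] = drift_integral_measurable[OF z \<alpha>] drift_energy_measurable[OF z \<alpha>]
  show m[measurable]: "dens t \<omega> \<alpha> \<in> borel_measurable P" unfolding dens_def[abs_def] by measurable
  have "(\<integral>\<^sup>+w. ennreal ((dens t \<omega> \<alpha> w)\<^sup>2) \<partial>P) \<le> (\<integral>\<^sup>+w. ennreal (exp (2 * drift_integral t \<omega> \<alpha> w)) \<partial>P)"
  proof (intro nn_integral_mono ennreal_leI)
    fix w
    have "(dens t \<omega> \<alpha> w)\<^sup>2 = exp (2 * (drift_integral t \<omega> \<alpha> w - 1 / 2 * drift_energy t \<omega> \<alpha> w))"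
      unfolding dens_def exp_double ..
    also have "\<dots> \<le> exp (2 * drift_integral t \<omega> \<alpha> w)" using drift_energy_nonneg[OF z \<alpha>, of w] by simp
    finally show "(dens t \<omega> \<alpha> w)\<^sup>2 \<le> exp (2 * drift_integral t \<omega> \<alpha> w)" .
  qed
  also have "\<dots> \<le> ennreal K" by (rule exp_drift_integral[OF z \<alpha>])
  finally show L2: "(\<integral>\<^sup>+w. ennreal ((dens t \<omega> \<alpha> w)\<^sup>2) \<partial>P) \<le> ennreal K" .
  have "integrable P (\<lambda>w. (dens t \<omega> \<alpha> w)\<^sup>2)"
    using L2 by (intro integrableI_bounded) (auto intro: order_le_less_trans)
  then have "integrable P (\<lambda>w. dens t \<omega> \<alpha> w * 1)"
    by (intro integrable_mult_of_sq) auto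
  then show "integrable P (dens t \<omega> \<alpha>)" by simp
qed

lemma pay:
  assumes z: "(t, \<omega>) \<in> S" and \<alpha>: "\<alpha> \<in> CP"
  shows pay_measurable: "pay t \<omega> \<alpha> \<in> borel_measurable P"
    and pay_bound: "w \<in> \<Omega> \<Longrightarrow> norm (pay t \<omega> \<alpha> w) \<le> C * (1 + T)"
proof -
  have "(\<lambda>z. ext_coeff f t \<omega> \<alpha> (snd z) (fst z)) \<in> borel_measurable (P \<Otimes>\<^sub>M lborel)"
    using ext_coeff_measurable[OF good_f z \<alpha>] by (simp add: split_beta' cong: measurable_cong_sets)
  then have "(\<lambda>w. LBINT s. ext_coeff f t \<omega> \<alpha> s w) \<in> borel_measurable P"
    by (intro lborel.borel_measurable_lebesgue_integral) (simp add: split_beta')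
  then show "pay t \<omega> \<alpha> \<in> borel_measurable P"
    unfolding pay_def[abs_def] by (intro borel_measurable_add terminal_measurable z)
  assume w: "w \<in> \<Omega>"
  have "norm (LBINT s. ext_coeff f t \<omega> \<alpha> s w) \<le> (LBINT s. norm (ext_coeff f t \<omega> \<alpha> s w))"
    by (rule integral_norm_bound)
  also have "\<dots> \<le> (LBINT s. C * indicator {0..T} s)"
    by (intro integral_mono integrable_norm ext_coeff_integrable good_f z \<alpha> w ext_coeff_bound) simp
  also have "\<dots> = C * T" using T_nonneg by simp
  finally have "norm (LBINT s. ext_coeff f t \<omega> \<alpha> s w) \<le> C * T" .
  moreover have "norm (\<xi> (concat_path T t \<omega> w)) \<le> C"
    using z w by (intro \<xi>_bound concat_path_in) auto
  ultimately show "norm (pay t \<omega> \<alpha> w) \<le> C * (1 + T)"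
    unfolding pay_def using norm_triangle_ineq[of "\<xi> (concat_path T t \<omega> w)" "LBINT s. ext_coeff f t \<omega> \<alpha> s w"]
    by (simp add: distrib_left)
qed

text \<open>The controlled measures at different points are replaced by densities under the single
  measure \<open>P\<close>, so that costs can be subtracted inside one integral.\<close>

lemma cost_eq:
  assumes z: "(t, \<omega>) \<in> S" and \<alpha>: "\<alpha> \<in> CP"
  shows "cost T W b f \<xi> t \<omega> \<alpha> $ i = (\<integral>w. dens t \<omega> \<alpha> w * pay t \<omega> \<alpha> w $ i \<partial>P)"
proof -
  have energy: "(LBINT s:{0..T - t}. (norm (shift_coeff T t \<omega> b s w (\<alpha> s w)))\<^sup>2) = drift_energy t \<omega> \<alpha> w" for w
    unfolding drift_energy_def set_lebesgue_integral_def ext_coeff_def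
    by (intro Bochner_Integration.integral_cong) (auto simp: indicator_def)
  have cm: "controlled_measure T W b t \<omega> \<alpha> = density P (\<lambda>w. ennreal (dens t \<omega> \<alpha> w))"
    unfolding controlled_measure_def Let_def energy dens_def drift_integral_def ..
  have payi: "\<xi> (concat_path T t \<omega> w) $ i + (LBINT s:{0..T - t}. shift_coeff T t \<omega> f s w (\<alpha> s w) $ i) = pay t \<omega> \<alpha> w $ i"
    if w: "w \<in> \<Omega>" for w
  proof -
    have "(LBINT s. ext_coeff f t \<omega> \<alpha> s w) $ i = (LBINT s. ext_coeff f t \<omega> \<alpha> s w $ i)"
      by (rule integral_bounded_linear[OF bounded_linear_vec_nth ext_coeff_integrable[OF good_f z \<alpha> w], symmetric])
    also have "\<dots> = (LBINT s:{0..T - t}. shift_coeff T t \<omega> f s w (\<alpha> s w) $ i)"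
      by (simp add: set_lebesgue_integral_def ext_coeff_def)
    finally show ?thesis by (simp add: pay_def)
  qed
  have [measurable]: "(\<lambda>w. pay t \<omega> \<alpha> w $ i) \<in> borel_measurable P"
    by (rule measurable_compose[OF pay_measurable[OF z \<alpha>] borel_measurable_vec_nth])
  have "cost T W b f \<xi> t \<omega> \<alpha> $ i = (\<integral>w. \<xi> (concat_path T t \<omega> w) $ i
      + (LBINT s:{0..T - t}. shift_coeff T t \<omega> f s w (\<alpha> s w) $ i) \<partial>density P (\<lambda>w. ennreal (dens t \<omega> \<alpha> w)))"
    by (simp add: cost_def cm)
  also have "\<dots> = (\<integral>w. pay t \<omega> \<alpha> w $ i \<partial>density P (\<lambda>w. ennreal (dens t \<omega> \<alpha> w)))"
    by (intro Bochner_Integration.integral_cong) (auto simp: payi)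
  also have "\<dots> = (\<integral>w. dens t \<omega> \<alpha> w *\<^sub>R pay t \<omega> \<alpha> w $ i \<partial>P)"
    by (rule integral_density[OF _ dens_measurable[OF z \<alpha>]]) (auto simp: dens_def)
  finally show ?thesis by simp
qed

lemma cost_integrand_integrable:
  assumes z: "(t, \<omega>) \<in> S" and \<alpha>: "\<alpha> \<in> CP"
  shows "integrable P (\<lambda>w. dens t \<omega> \<alpha> w * pay t \<omega> \<alpha> w $ i)"
proof (rule Bochner_Integration.integrable_bound)
  show "integrable P (\<lambda>w. dens t \<omega> \<alpha> w * (C * (1 + T)))"
    using dens_integrable[OF z \<alpha>] by simp
  show "(\<lambda>w. dens t \<omega> \<alpha> w * pay t \<omega> \<alpha> w $ i) \<in> borel_measurable P"
    by (intro borel_measurable_times dens_measurable z \<alpha> measurable_compose[OF pay_measurable[OF z \<alpha>] borel_measurable_vec_nth])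
  show "AE w in P. norm (dens t \<omega> \<alpha> w * pay t \<omega> \<alpha> w $ i) \<le> norm (dens t \<omega> \<alpha> w * (C * (1 + T)))"
  proof (rule AE_I2)
    fix w assume "w \<in> space P"
    then have "\<bar>pay t \<omega> \<alpha> w $ i\<bar> \<le> C * (1 + T)"
      using pay_bound[OF z \<alpha>, of w] component_le_norm_cart[of "pay t \<omega> \<alpha> w" i] by simp
    then show "norm (dens t \<omega> \<alpha> w * pay t \<omega> \<alpha> w $ i) \<le> norm (dens t \<omega> \<alpha> w * (C * (1 + T)))"
      using C_nonneg T_nonneg by (auto simp: abs_mult intro!: mult_left_mono)
  qed
qed

text \<open>The weight \<open>a\<close> is chosen small first, so that the terms without a difference are negligible; then the
  remaining terms are made small by letting the two points approach each other.\<close>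

lemma cost_integrand_diff:
  fixes a Z Z' y y' X X' E E' B :: real
  assumes "0 < a" "0 \<le> B" "\<bar>y'\<bar> \<le> B" and Z: "Z = exp (X - 1 / 2 * E)" "Z' = exp (X' - 1 / 2 * E')"
  shows "\<bar>Z * y - Z' * y'\<bar> \<le> a * (1 + 2 * B) * Z\<^sup>2 + a * (2 * B) * Z'\<^sup>2
    + 1 / a * (y - y')\<^sup>2 + (2 * B) / a * (X - X')\<^sup>2 + (2 * B) / a * (E - E')\<^sup>2"
proof -
  have pos: "0 < Z" "0 < Z'" by (auto simp: Z)
  have 1: "Z * \<bar>y - y'\<bar> \<le> a * Z\<^sup>2 + \<bar>y - y'\<bar>\<^sup>2 / a" by (rule weighted_AM_GM) fact
  define D where "D = (X - X') - 1 / 2 * (E - E')"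
  have "X - 1 / 2 * E - (X' - 1 / 2 * E') = D" by (simp add: D_def field_simps)
  \<comment> \<open>The exponential is not globally Lipschitz; the factor \<open>Z + Z'\<close>
    takes the place of the constant, and its second moment is controlled.\<close>
  then have "\<bar>Z - Z'\<bar> \<le> (Z + Z') * \<bar>D\<bar>"
    using abs_exp_diff_le[of "X - 1 / 2 * E" "X' - 1 / 2 * E'"] by (simp only: Z)
  also have "\<dots> \<le> a * (Z + Z')\<^sup>2 + \<bar>D\<bar>\<^sup>2 / a" by (rule weighted_AM_GM) fact
  also have "\<dots> \<le> a * (2 * Z\<^sup>2 + 2 * Z'\<^sup>2) + (2 * (X - X')\<^sup>2 + 2 * (E - E')\<^sup>2) / a"
  proof (intro add_mono mult_left_mono divide_right_mono)
    show "(Z + Z')\<^sup>2 \<le> 2 * Z\<^sup>2 + 2 * Z'\<^sup>2" by (rule power2_sum_le)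
    have "\<bar>D\<bar>\<^sup>2 \<le> 2 * (X - X')\<^sup>2 + 2 * (- (1 / 2 * (E - E')))\<^sup>2"
      using power2_sum_le[of "X - X'" "- (1 / 2 * (E - E'))"] by (simp add: D_def)
    also have "2 * (- (1 / 2 * (E - E')))\<^sup>2 = 1 / 2 * (E - E')\<^sup>2"
      by (simp add: power2_eq_square)
    also have "\<dots> \<le> 2 * (E - E')\<^sup>2" by (rule mult_right_mono) auto
    finally show "\<bar>D\<bar>\<^sup>2 \<le> 2 * (X - X')\<^sup>2 + 2 * (E - E')\<^sup>2" by simp
  qed (use assms in auto)
  finally have 2: "\<bar>Z - Z'\<bar> \<le> a * (2 * Z\<^sup>2 + 2 * Z'\<^sup>2) + (2 * (X - X')\<^sup>2 + 2 * (E - E')\<^sup>2) / a" .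
  have "Z * y - Z' * y' = Z * (y - y') + (Z - Z') * y'" by (simp add: algebra_simps)
  then have "\<bar>Z * y - Z' * y'\<bar> \<le> Z * \<bar>y - y'\<bar> + \<bar>Z - Z'\<bar> * \<bar>y'\<bar>"
    using abs_triangle_ineq[of "Z * (y - y')" "(Z - Z') * y'"] pos by (simp add: abs_mult)
  also have "\<dots> \<le> (a * Z\<^sup>2 + \<bar>y - y'\<bar>\<^sup>2 / a) + (a * (2 * Z\<^sup>2 + 2 * Z'\<^sup>2) + (2 * (X - X')\<^sup>2 + 2 * (E - E')\<^sup>2) / a) * B"
    using 1 2 assms by (intro add_mono mult_mono) auto
  also have "\<dots> = a * (1 + 2 * B) * Z\<^sup>2 + a * (2 * B) * Z'\<^sup>2
    + 1 / a * (y - y')\<^sup>2 + (2 * B) / a * (X - X')\<^sup>2 + (2 * B) / a * (E - E')\<^sup>2"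
    using assms(1) by (simp add: field_simps)
  finally show ?thesis .
qed

text \<open>Energies are compared by factoring the difference of squares, where the sum of the two
  norms is at most \<open>2 * C\<close>. Again two bounds hold for all paths and two under small
  oscillation.\<close>

lemma pathwise_diff:
  assumes z: "(t, \<omega>) \<in> S" "(t', \<omega>') \<in> S" and \<alpha>: "\<alpha> \<in> CP" and w: "w \<in> \<Omega>"
  shows "\<bar>pay t \<omega> \<alpha> w $ i - pay t' \<omega>' \<alpha> w $ i\<bar> \<le> 2 * C * (1 + T)" (is ?pay)
    and "\<bar>drift_energy t \<omega> \<alpha> w - drift_energy t' \<omega>' \<alpha> w\<bar> \<le> 2 * C * (2 * C * T)" (is ?energy)
    and "\<And>e \<kappa>. osc_le \<kappa> \<bar>t - t'\<bar> w \<Longrightarrow>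
      (\<And>x. 0 \<le> x \<Longrightarrow> x \<le> path_dist T (t, \<omega>) (t', \<omega>') + \<kappa> \<Longrightarrow> \<rho> x \<le> e) \<Longrightarrow> 0 \<le> e \<Longrightarrow>
      \<bar>pay t \<omega> \<alpha> w $ i - pay t' \<omega>' \<alpha> w $ i\<bar> \<le> e + (e * T + C * \<bar>t - t'\<bar>)"
    and "\<And>e \<kappa>. osc_le \<kappa> \<bar>t - t'\<bar> w \<Longrightarrow>
      (\<And>x. 0 \<le> x \<Longrightarrow> x \<le> path_dist T (t, \<omega>) (t', \<omega>') + \<kappa> \<Longrightarrow> \<rho> x \<le> e) \<Longrightarrow> 0 \<le> e \<Longrightarrow>
      \<bar>drift_energy t \<omega> \<alpha> w - drift_energy t' \<omega>' \<alpha> w\<bar> \<le> 2 * C * (e * T + C * \<bar>t - t'\<bar>)"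
proof -
  have comp: "\<bar>x $ i - y $ i\<bar> \<le> norm (x - y)" for x y :: "real ^ 'n"
    using component_le_norm_cart[of "x - y" i] by simp
  have "norm (pay t \<omega> \<alpha> w - pay t' \<omega>' \<alpha> w) \<le> 2 * C * (1 + T)"
    using norm_triangle_ineq4[of "pay t \<omega> \<alpha> w" "pay t' \<omega>' \<alpha> w"] pay_bound[OF z(1) \<alpha> w] pay_bound[OF z(2) \<alpha> w] by simp
  then show ?pay using comp order_trans by blast
  let ?D = "\<lambda>s. ext_coeff b t \<omega> \<alpha> s w - ext_coeff b t' \<omega>' \<alpha> s w"
  have intD: "integrable lborel (\<lambda>s. norm (?D s))"
    by (intro integrable_norm Bochner_Integration.integrable_diff ext_coeff_integrable good_b z \<alpha> w)
  have energy: "\<bar>drift_energy t \<omega> \<alpha> w - drift_energy t' \<omega>' \<alpha> w\<bar> \<le> 2 * C * (LBINT s. norm (?D s))"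
  proof -
    let ?a = "\<lambda>s. norm (ext_coeff b t \<omega> \<alpha> s w)" and ?b = "\<lambda>s. norm (ext_coeff b t' \<omega>' \<alpha> s w)"
    have ia: "integrable lborel (\<lambda>s. (?a s)\<^sup>2)" and ib: "integrable lborel (\<lambda>s. (?b s)\<^sup>2)"
      by (intro ext_coeff_integrable_sq good_b z \<alpha> w)+
    have "drift_energy t \<omega> \<alpha> w - drift_energy t' \<omega>' \<alpha> w = (LBINT s. (?a s)\<^sup>2 - (?b s)\<^sup>2)"
      unfolding drift_energy_def by (rule Bochner_Integration.integral_diff[OF ia ib, symmetric])
    then have "\<bar>drift_energy t \<omega> \<alpha> w - drift_energy t' \<omega>' \<alpha> w\<bar> \<le> (LBINT s. \<bar>(?a s)\<^sup>2 - (?b s)\<^sup>2\<bar>)"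
      using integral_norm_bound[of lborel "\<lambda>s. (?a s)\<^sup>2 - (?b s)\<^sup>2"] by simp
    also have "\<dots> \<le> (LBINT s. 2 * C * norm (?D s))"
    proof (rule integral_mono)
      show "integrable lborel (\<lambda>s. \<bar>(?a s)\<^sup>2 - (?b s)\<^sup>2\<bar>)"
        by (intro integrable_abs Bochner_Integration.integrable_diff ia ib)
      show "integrable lborel (\<lambda>s. 2 * C * norm (?D s))" using intD by simp
      fix s
      have ind: "C * indicator {0..T} s \<le> C" using C_nonneg by (simp add: indicator_def)
      have "?a s \<le> C" "?b s \<le> C"
        using ext_coeff_bound[OF good_b z(1) \<alpha> w, of s] ext_coeff_bound[OF good_b z(2) \<alpha> w, of s] ind by linarith+
      then have "\<bar>?a s + ?b s\<bar> * \<bar>?a s - ?b s\<bar> \<le> 2 * C * norm (?D s)"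
        by (intro mult_mono norm_triangle_ineq3) (use C_nonneg in auto)
      then show "\<bar>(?a s)\<^sup>2 - (?b s)\<^sup>2\<bar> \<le> 2 * C * norm (?D s)"
        by (simp add: power2_eq_square square_diff_square_factored abs_mult)
    qed
    finally show ?thesis by simp
  qed
  have C2: "0 \<le> 2 * C" using C_nonneg by simp
  show ?energy
    by (rule order_trans[OF energy]) (intro mult_left_mono ext_coeff_diff_integral(1) good_b z \<alpha> w C2)
  fix e \<kappa> :: real
  assume A: "osc_le \<kappa> \<bar>t - t'\<bar> w"
    "\<And>x. 0 \<le> x \<Longrightarrow> x \<le> path_dist T (t, \<omega>) (t', \<omega>') + \<kappa> \<Longrightarrow> \<rho> x \<le> e" and e: "0 \<le> e"
  show "\<bar>drift_energy t \<omega> \<alpha> w - drift_energy t' \<omega>' \<alpha> w\<bar> \<le> 2 * C * (e * T + C * \<bar>t - t'\<bar>)"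
    by (rule order_trans[OF energy]) (intro mult_left_mono ext_coeff_diff_integral(3)[OF good_b z \<alpha> w A e] C2)
  have cz: "concat_path T t \<omega> w \<in> \<Omega>" "concat_path T t' \<omega>' w \<in> \<Omega>" using z w by (auto intro!: concat_path_in)
  let ?N = "path_norm T (\<lambda>r. concat_path T t \<omega> w r - concat_path T t' \<omega>' w r)"
  have "norm (\<xi> (concat_path T t \<omega> w) - \<xi> (concat_path T t' \<omega>' w)) \<le> \<rho> ?N"
    by (rule \<xi>_mod[OF cz])
  also have "\<dots> \<le> e"
  proof (rule A(2))
    show "0 \<le> ?N" by (intro path_norm_nonneg T_nonneg continuous_on_diff path_spaceD(1) cz)
    show "?N \<le> path_dist T (t, \<omega>) (t', \<omega>') + \<kappa>" using z w A(1) by (intro path_norm_concat_le) auto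
  qed
  finally have 1: "norm (\<xi> (concat_path T t \<omega> w) - \<xi> (concat_path T t' \<omega>' w)) \<le> e" .
  have "norm ((LBINT s. ext_coeff f t \<omega> \<alpha> s w) - (LBINT s. ext_coeff f t' \<omega>' \<alpha> s w))
      = norm (LBINT s. ext_coeff f t \<omega> \<alpha> s w - ext_coeff f t' \<omega>' \<alpha> s w)"
    by (subst Bochner_Integration.integral_diff) (auto intro!: ext_coeff_integrable good_f z \<alpha> w)
  also have "\<dots> \<le> (LBINT s. norm (ext_coeff f t \<omega> \<alpha> s w - ext_coeff f t' \<omega>' \<alpha> s w))"
    by (rule integral_norm_bound)
  also have "\<dots> \<le> e * T + C * \<bar>t - t'\<bar>" by (rule ext_coeff_diff_integral(3)[OF good_f z \<alpha> w A e])
  finally have 2: "norm ((LBINT s. ext_coeff f t \<omega> \<alpha> s w) - (LBINT s. ext_coeff f t' \<omega>' \<alpha> s w)) \<le> e * T + C * \<bar>t - t'\<bar>" .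
  have "norm (pay t \<omega> \<alpha> w - pay t' \<omega>' \<alpha> w) \<le> e + (e * T + C * \<bar>t - t'\<bar>)"
    using norm_triangle_ineq[of "\<xi> (concat_path T t \<omega> w) - \<xi> (concat_path T t' \<omega>' w)"
        "(LBINT s. ext_coeff f t \<omega> \<alpha> s w) - (LBINT s. ext_coeff f t' \<omega>' \<alpha> s w)"] 1 2
    by (simp add: pay_def algebra_simps)
  then show "\<bar>pay t \<omega> \<alpha> w $ i - pay t' \<omega>' \<alpha> w $ i\<bar> \<le> e + (e * T + C * \<bar>t - t'\<bar>)"
    using comp order_trans by blast
qed

text \<open>The constant in front of \<open>a\<close> in \<open>cost_diff_le\<close>. With payoffs
  bounded by \<open>B = C * (1 + T)\<close>, the weights \<open>1 + 2 * B\<close> and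
  \<open>2 * B\<close> of the two squared densities add up, each density having second moment at
  most \<open>K\<close>.\<close>

definition "M\<^sub>1 = (1 + 4 * (C * (1 + T))) * K"

text \<open>The constant in front of \<open>e / a\<close>: contributions of payoff, stochastic
  integral and energy, in this order, the last two with the weight \<open>2 * B\<close>. In each of
  the three, the final summand comes from the exceptional set.\<close>

definition "M\<^sub>2 = (1 + T + C)\<^sup>2 + (2 * C * (1 + T))\<^sup>2
  + 2 * (C * (1 + T)) * (9 * (2 * T + 2 * C\<^sup>2 + 4 * C\<^sup>2 * T))
  + 2 * (C * (1 + T)) * ((2 * C * (T + C))\<^sup>2 + (2 * C * (2 * C * T))\<^sup>2)"

text \<open>A single \<open>e\<close> bounds the time lag, the modulus and the probability of the
  exceptional set. The weight \<open>a\<close> is still free, and the constants depend on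
  \<open>C\<close> and \<open>T\<close> only, not on the control.\<close>

lemma cost_diff_le:
  assumes z: "(t, \<omega>) \<in> S" "(t', \<omega>') \<in> S" and \<alpha>: "\<alpha> \<in> CP"
    and G: "G \<in> sets P" "prob (\<Omega> - G) \<le> e"
    and osc: "\<And>w. w \<in> G \<Longrightarrow> osc_le \<kappa> \<bar>t - t'\<bar> w"
    and R: "\<And>x. 0 \<le> x \<Longrightarrow> x \<le> path_dist T (t, \<omega>) (t', \<omega>') + \<kappa> \<Longrightarrow> \<rho> x \<le> e"
    and e: "0 \<le> e" "e \<le> 1" and tt: "\<bar>t - t'\<bar> \<le> e" and a: "0 < a"
  shows "\<bar>cost T W b f \<xi> t \<omega> \<alpha> $ i - cost T W b f \<xi> t' \<omega>' \<alpha> $ i\<bar> \<le> a * M\<^sub>1 + e / a * M\<^sub>2"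
proof -
  define B where "B = C * (1 + T)"
  have B: "0 \<le> B" using C_nonneg T_nonneg by (simp add: B_def)
  let ?Z = "dens t \<omega> \<alpha>" and ?Z' = "dens t' \<omega>' \<alpha>"
  let ?y = "\<lambda>w. pay t \<omega> \<alpha> w $ i" and ?y' = "\<lambda>w. pay t' \<omega>' \<alpha> w $ i"
  let ?X = "drift_integral t \<omega> \<alpha>" and ?X' = "drift_integral t' \<omega>' \<alpha>"
  let ?E = "drift_energy t \<omega> \<alpha>" and ?E' = "drift_energy t' \<omega>' \<alpha>"
  note [measurable] = dens_measurable[OF z(1) \<alpha>] dens_measurable[OF z(2) \<alpha>]
    measurable_compose[OF pay_measurable[OF z(1) \<alpha>] borel_measurable_vec_nth[of i]]
    measurable_compose[OF pay_measurable[OF z(2) \<alpha>] borel_measurable_vec_nth[of i]]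
    drift_integral_measurable[OF z(1) \<alpha>] drift_integral_measurable[OF z(2) \<alpha>]
    drift_energy_measurable[OF z(1) \<alpha>] drift_energy_measurable[OF z(2) \<alpha>]
  have G\<Omega>: "w \<in> \<Omega>" if "w \<in> G" for w using sets.sets_into_space[OF G(1)] that by auto
  have G': "prob (space P - G) \<le> e" using G(2) by simp
  \<comment> \<open>Here \<open>e \<le> 1\<close> enters: the quadratic terms from the good set are
    absorbed into terms linear in \<open>e\<close>.\<close>
  have esq: "e\<^sup>2 \<le> e" using e by (simp add: power2_eq_square mult_left_le)
  have esq_add: "(e * x)\<^sup>2 + y * e \<le> e * (x\<^sup>2 + y)" for x y
    using mult_right_mono[OF esq, of "x\<^sup>2"] by (simp add: power_mult_distrib algebra_simps)
  have i1: "(\<integral>\<^sup>+w. ennreal ((?y w - ?y' w)\<^sup>2) \<partial>P) \<le> ennreal (e * ((1 + T + C)\<^sup>2 + (2 * C * (1 + T))\<^sup>2))"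
  proof -
    have "(\<integral>\<^sup>+w. ennreal ((?y w - ?y' w)\<^sup>2) \<partial>P) \<le> ennreal ((e * (1 + T + C))\<^sup>2 + (2 * C * (1 + T))\<^sup>2 * e)"
    proof (rule nn_integral_le_good_bad[OF G(1) G'])
      fix w assume w: "w \<in> G"
      have "\<bar>?y w - ?y' w\<bar> \<le> e + (e * T + C * \<bar>t - t'\<bar>)"
        by (rule pathwise_diff(3)[OF z \<alpha> G\<Omega>[OF w] osc[OF w] R e(1)])
      also have "\<dots> \<le> e * (1 + T + C)" using mult_left_mono[OF tt C_nonneg] by (simp add: algebra_simps)
      finally have "\<bar>?y w - ?y' w\<bar>\<^sup>2 \<le> (e * (1 + T + C))\<^sup>2" by (rule power_mono) simp
      then show "ennreal ((?y w - ?y' w)\<^sup>2) \<le> ennreal ((e * (1 + T + C))\<^sup>2)" by (simp add: ennreal_leI)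
    next
      fix w assume "w \<in> space P"
      then have "\<bar>?y w - ?y' w\<bar> \<le> 2 * C * (1 + T)" by (intro pathwise_diff(1) z \<alpha>) simp
      then have "\<bar>?y w - ?y' w\<bar>\<^sup>2 \<le> (2 * C * (1 + T))\<^sup>2" by (rule power_mono) simp
      then show "ennreal ((?y w - ?y' w)\<^sup>2) \<le> ennreal ((2 * C * (1 + T))\<^sup>2)" by (simp add: ennreal_leI)
    qed auto
    also have "(e * (1 + T + C))\<^sup>2 + (2 * C * (1 + T))\<^sup>2 * e \<le> e * ((1 + T + C)\<^sup>2 + (2 * C * (1 + T))\<^sup>2)"
      by (rule esq_add)
    finally show ?thesis by (simp add: ennreal_leI)
  qed
  \<comment> \<open>The two stochastic integrals have different horizons, which the stability
    estimate allows; its factor \<open>9\<close> reappears in the constant.\<close>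
  have i2: "(\<integral>\<^sup>+w. ennreal ((?X w - ?X' w)\<^sup>2) \<partial>P) \<le> ennreal (e * (9 * (2 * T + 2 * C\<^sup>2 + 4 * C\<^sup>2 * T)))"
  proof -
    have m: "(\<lambda>(w, s). indicator {0..T - t} s *\<^sub>R shift_coeff T t \<omega> b s w (\<alpha> s w)) \<in> P \<Otimes>\<^sub>M borel \<rightarrow>\<^sub>M borel"
      "(\<lambda>(w, s). indicator {0..T - t'} s *\<^sub>R shift_coeff T t' \<omega>' b s w (\<alpha> s w)) \<in> P \<Otimes>\<^sub>M borel \<rightarrow>\<^sub>M borel"
      using ext_coeff_measurable[OF good_b z(1) \<alpha>] ext_coeff_measurable[OF good_b z(2) \<alpha>] by (simp_all add: ext_coeff_def)
    have "T - t \<le> T" "T - t' \<le> T" using z by auto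
    from ito_integral_stability[OF this m has_drift_integral[OF z(1) \<alpha>] has_drift_integral[OF z(2) \<alpha>]]
    have "(\<integral>\<^sup>+w. ennreal ((?X w - ?X' w)\<^sup>2) \<partial>P)
        \<le> 9 * (\<integral>\<^sup>+w. (\<integral>\<^sup>+s. ennreal ((norm (ext_coeff b t \<omega> \<alpha> s w - ext_coeff b t' \<omega>' \<alpha> s w))\<^sup>2) \<partial>lborel) \<partial>P)"
      by (simp add: ext_coeff_def)
    also have "\<dots> \<le> 9 * ennreal ((2 * e\<^sup>2 * T + 2 * C\<^sup>2 * e) + 4 * C\<^sup>2 * T * e)"
    proof (intro mult_left_mono nn_integral_le_good_bad[OF G(1) G'])
      fix w assume w: "w \<in> G"
      have "(\<integral>\<^sup>+s. ennreal ((norm (ext_coeff b t \<omega> \<alpha> s w - ext_coeff b t' \<omega>' \<alpha> s w))\<^sup>2) \<partial>lborel)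
          \<le> ennreal (2 * e\<^sup>2 * T + 2 * C\<^sup>2 * \<bar>t - t'\<bar>)"
        by (rule ext_coeff_diff_integral(4)[OF good_b z \<alpha> G\<Omega>[OF w] osc[OF w] R e(1)])
      also have "\<dots> \<le> ennreal (2 * e\<^sup>2 * T + 2 * C\<^sup>2 * e)"
        using tt by (intro ennreal_leI add_left_mono mult_left_mono) auto
      finally show "(\<integral>\<^sup>+s. ennreal ((norm (ext_coeff b t \<omega> \<alpha> s w - ext_coeff b t' \<omega>' \<alpha> s w))\<^sup>2) \<partial>lborel)
          \<le> ennreal (2 * e\<^sup>2 * T + 2 * C\<^sup>2 * e)" .
    next
      fix w assume "w \<in> space P"
      then show "(\<integral>\<^sup>+s. ennreal ((norm (ext_coeff b t \<omega> \<alpha> s w - ext_coeff b t' \<omega>' \<alpha> s w))\<^sup>2) \<partial>lborel)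
          \<le> ennreal (4 * C\<^sup>2 * T)" by (intro ext_coeff_diff_integral(2) good_b z \<alpha>) simp
    qed (use T_nonneg e in auto)
    also have "\<dots> = ennreal (9 * ((2 * e\<^sup>2 * T + 2 * C\<^sup>2 * e) + 4 * C\<^sup>2 * T * e))"
    proof -
      have "9 * ennreal x = ennreal (9 * x)" if "0 \<le> x" for x using that by (simp add: ennreal_mult)
      then show ?thesis using T_nonneg e by simp
    qed
    also have "9 * ((2 * e\<^sup>2 * T + 2 * C\<^sup>2 * e) + 4 * C\<^sup>2 * T * e) \<le> e * (9 * (2 * T + 2 * C\<^sup>2 + 4 * C\<^sup>2 * T))"
      using mult_right_mono[OF esq T_nonneg] by (simp add: algebra_simps)
    finally show ?thesis by (simp add: ennreal_leI)
  qed
  have i3: "(\<integral>\<^sup>+w. ennreal ((?E w - ?E' w)\<^sup>2) \<partial>P) \<le> ennreal (e * ((2 * C * (T + C))\<^sup>2 + (2 * C * (2 * C * T))\<^sup>2))"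
  proof -
    have "(\<integral>\<^sup>+w. ennreal ((?E w - ?E' w)\<^sup>2) \<partial>P) \<le> ennreal ((e * (2 * C * (T + C)))\<^sup>2 + (2 * C * (2 * C * T))\<^sup>2 * e)"
    proof (rule nn_integral_le_good_bad[OF G(1) G'])
      fix w assume w: "w \<in> G"
      have "\<bar>?E w - ?E' w\<bar> \<le> 2 * C * (e * T + C * \<bar>t - t'\<bar>)"
        by (rule pathwise_diff(4)[OF z \<alpha> G\<Omega>[OF w] osc[OF w] R e(1)])
      also have "\<dots> \<le> 2 * C * (e * T + C * e)"
        using tt C_nonneg by (intro mult_left_mono add_left_mono) auto
      also have "\<dots> = e * (2 * C * (T + C))" by (simp add: algebra_simps)
      finally have "\<bar>?E w - ?E' w\<bar>\<^sup>2 \<le> (e * (2 * C * (T + C)))\<^sup>2" by (rule power_mono) simp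
      then show "ennreal ((?E w - ?E' w)\<^sup>2) \<le> ennreal ((e * (2 * C * (T + C)))\<^sup>2)" by (simp add: ennreal_leI)
    next
      fix w assume "w \<in> space P"
      then have "\<bar>?E w - ?E' w\<bar> \<le> 2 * C * (2 * C * T)" by (intro pathwise_diff(2) z \<alpha>) simp
      then have "\<bar>?E w - ?E' w\<bar>\<^sup>2 \<le> (2 * C * (2 * C * T))\<^sup>2" by (rule power_mono) simp
      then show "ennreal ((?E w - ?E' w)\<^sup>2) \<le> ennreal ((2 * C * (2 * C * T))\<^sup>2)" by (simp add: ennreal_leI)
    qed auto
    also have "(e * (2 * C * (T + C)))\<^sup>2 + (2 * C * (2 * C * T))\<^sup>2 * e \<le> e * ((2 * C * (T + C))\<^sup>2 + (2 * C * (2 * C * T))\<^sup>2)"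
      by (rule esq_add)
    finally show ?thesis by (simp add: ennreal_leI)
  qed
  have "ennreal \<bar>cost T W b f \<xi> t \<omega> \<alpha> $ i - cost T W b f \<xi> t' \<omega>' \<alpha> $ i\<bar>
      = ennreal (norm (\<integral>w. ?Z w * ?y w - ?Z' w * ?y' w \<partial>P))"
    unfolding cost_eq[OF z(1) \<alpha>] cost_eq[OF z(2) \<alpha>]
    by (subst Bochner_Integration.integral_diff) (auto intro!: cost_integrand_integrable z \<alpha>)
  also have "\<dots> \<le> (\<integral>\<^sup>+w. ennreal (norm (?Z w * ?y w - ?Z' w * ?y' w)) \<partial>P)"
    by (intro integral_norm_bound_ennreal Bochner_Integration.integrable_diff cost_integrand_integrable z \<alpha>)
  also have "\<dots> \<le> (\<integral>\<^sup>+w. ennreal (a * (1 + 2 * B)) * ennreal ((?Z w)\<^sup>2) + ennreal (a * (2 * B)) * ennreal ((?Z' w)\<^sup>2)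
      + ennreal (1 / a) * ennreal ((?y w - ?y' w)\<^sup>2) + ennreal (2 * B / a) * ennreal ((?X w - ?X' w)\<^sup>2)
      + ennreal (2 * B / a) * ennreal ((?E w - ?E' w)\<^sup>2) \<partial>P)"
  proof (rule nn_integral_mono)
    fix w assume "w \<in> space P"
    then have "\<bar>?y' w\<bar> \<le> B"
      using pay_bound[OF z(2) \<alpha>, of w] component_le_norm_cart[of "pay t' \<omega>' \<alpha> w" i] by (simp add: B_def)
    from cost_integrand_diff[OF a B this dens_def dens_def, of t \<omega> \<alpha> w "?y w"]
    have "ennreal (norm (?Z w * ?y w - ?Z' w * ?y' w)) \<le> ennreal (a * (1 + 2 * B) * (?Z w)\<^sup>2 + a * (2 * B) * (?Z' w)\<^sup>2
        + 1 / a * (?y w - ?y' w)\<^sup>2 + 2 * B / a * (?X w - ?X' w)\<^sup>2 + 2 * B / a * (?E w - ?E' w)\<^sup>2)"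
      by (intro ennreal_leI) simp
    also have "\<dots> = ennreal (a * (1 + 2 * B)) * ennreal ((?Z w)\<^sup>2) + ennreal (a * (2 * B)) * ennreal ((?Z' w)\<^sup>2)
      + ennreal (1 / a) * ennreal ((?y w - ?y' w)\<^sup>2) + ennreal (2 * B / a) * ennreal ((?X w - ?X' w)\<^sup>2)
      + ennreal (2 * B / a) * ennreal ((?E w - ?E' w)\<^sup>2)"
      using a B by (simp add: ennreal_mult[symmetric] ennreal_plus[symmetric] del: ennreal_plus)
    finally show "ennreal (norm (?Z w * ?y w - ?Z' w * ?y' w)) \<le> ennreal (a * (1 + 2 * B)) * ennreal ((?Z w)\<^sup>2)
      + ennreal (a * (2 * B)) * ennreal ((?Z' w)\<^sup>2)
      + ennreal (1 / a) * ennreal ((?y w - ?y' w)\<^sup>2) + ennreal (2 * B / a) * ennreal ((?X w - ?X' w)\<^sup>2)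
      + ennreal (2 * B / a) * ennreal ((?E w - ?E' w)\<^sup>2)" .
  qed
  also have "\<dots> = ennreal (a * (1 + 2 * B)) * (\<integral>\<^sup>+w. ennreal ((?Z w)\<^sup>2) \<partial>P) + ennreal (a * (2 * B)) * (\<integral>\<^sup>+w. ennreal ((?Z' w)\<^sup>2) \<partial>P)
      + ennreal (1 / a) * (\<integral>\<^sup>+w. ennreal ((?y w - ?y' w)\<^sup>2) \<partial>P) + ennreal (2 * B / a) * (\<integral>\<^sup>+w. ennreal ((?X w - ?X' w)\<^sup>2) \<partial>P)
      + ennreal (2 * B / a) * (\<integral>\<^sup>+w. ennreal ((?E w - ?E' w)\<^sup>2) \<partial>P)"
    by (simp add: nn_integral_add nn_integral_cmult)
  also have "\<dots> \<le> ennreal (a * (1 + 2 * B)) * ennreal K + ennreal (a * (2 * B)) * ennreal K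
      + ennreal (1 / a) * ennreal (e * ((1 + T + C)\<^sup>2 + (2 * C * (1 + T))\<^sup>2))
      + ennreal (2 * B / a) * ennreal (e * (9 * (2 * T + 2 * C\<^sup>2 + 4 * C\<^sup>2 * T)))
      + ennreal (2 * B / a) * ennreal (e * ((2 * C * (T + C))\<^sup>2 + (2 * C * (2 * C * T))\<^sup>2))"
    by (intro add_mono mult_left_mono i1 i2 i3 dens_L2 z \<alpha>) auto
  also have "\<dots> = ennreal (a * (1 + 2 * B) * K + a * (2 * B) * K
      + 1 / a * (e * ((1 + T + C)\<^sup>2 + (2 * C * (1 + T))\<^sup>2))
      + 2 * B / a * (e * (9 * (2 * T + 2 * C\<^sup>2 + 4 * C\<^sup>2 * T)))
      + 2 * B / a * (e * ((2 * C * (T + C))\<^sup>2 + (2 * C * (2 * C * T))\<^sup>2)))"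
    using a B e T_nonneg by (simp add: K_def ennreal_mult[symmetric] ennreal_plus[symmetric] del: ennreal_plus)
  also have "\<dots> = ennreal (a * M\<^sub>1 + e / a * M\<^sub>2)"
    unfolding M\<^sub>1_def M\<^sub>2_def B_def[symmetric] using a by (intro arg_cong[where f=ennreal]) (simp add: field_simps)
  finally have *: "ennreal \<bar>cost T W b f \<xi> t \<omega> \<alpha> $ i - cost T W b f \<xi> t' \<omega>' \<alpha> $ i\<bar> \<le> ennreal (a * M\<^sub>1 + e / a * M\<^sub>2)" .
  have "0 \<le> a * M\<^sub>1 + e / a * M\<^sub>2"
    using a e C_nonneg T_nonneg unfolding M\<^sub>1_def M\<^sub>2_def K_def
    by (intro add_nonneg_nonneg mult_nonneg_nonneg divide_nonneg_pos) auto
  then show ?thesis using * by (simp add: ennreal_le_iff)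
qed

text \<open>The choices of \<open>a\<close>, \<open>e\<close>, the radius for the modulus and the
  oscillation set involve neither the control nor the player, so one \<open>\<delta>\<close> serves
  all of them.\<close>

proposition cost_uniformly_continuous:
  assumes "0 < \<kappa>"
  obtains \<delta> where "0 < \<delta>"
    "\<And>t \<omega> t' \<omega>' \<alpha> i. (t, \<omega>) \<in> S \<Longrightarrow> (t', \<omega>') \<in> S \<Longrightarrow> path_dist T (t, \<omega>) (t', \<omega>') < \<delta> \<Longrightarrow> \<alpha> \<in> CP \<Longrightarrow>
      \<bar>cost T W b f \<xi> t \<omega> \<alpha> $ i - cost T W b f \<xi> t' \<omega>' \<alpha> $ i\<bar> \<le> \<kappa>"
proof -
  have K: "0 < K" by (simp add: K_def)
  have M1: "0 < M\<^sub>1" unfolding M\<^sub>1_def using K C_nonneg T_nonneg by (intro mult_pos_pos add_pos_nonneg) auto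
  have M2: "0 \<le> M\<^sub>2" unfolding M\<^sub>2_def using C_nonneg T_nonneg by (intro add_nonneg_nonneg mult_nonneg_nonneg) auto
  \<comment> \<open>Half of \<open>\<kappa>\<close> is reserved for the terms without a
    difference.\<close>
  define a where "a = \<kappa> / (2 * M\<^sub>1)"
  have a: "0 < a" "a * M\<^sub>1 = \<kappa> / 2" using assms M1 by (simp_all add: a_def)
  \<comment> \<open>The other half goes to \<open>e / a * M\<^sub>2\<close>; the summand
    \<open>1\<close> keeps the denominator positive, since \<open>M\<^sub>2\<close> has only been
    shown to be nonnegative.\<close>
  define e where "e = min 1 (a * \<kappa> / (2 * (M\<^sub>2 + 1)))"
  have e: "0 < e" "e \<le> 1" using a assms M2 by (auto simp: e_def)
  have "e * M\<^sub>2 \<le> (a * \<kappa> / (2 * (M\<^sub>2 + 1))) * (M\<^sub>2 + 1)"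
    using M2 a assms by (intro mult_mono) (auto simp: e_def)
  also have "\<dots> = a * \<kappa> / 2"
  proof -
    have "x / (2 * m) * m = x / 2" if "0 < m" for x m :: real using that by simp
    from this[of "M\<^sub>2 + 1" "a * \<kappa>"] show ?thesis using M2 by simp
  qed
  finally have e2: "e / a * M\<^sub>2 \<le> \<kappa> / 2" using a by (simp add: field_simps)
  obtain d where d: "0 < d" "\<And>x. 0 \<le> x \<Longrightarrow> x \<le> d \<Longrightarrow> \<rho> x < e" using modulus_tendsto[OF \<rho> e(1)] by blast
  have "0 < d / 2" using d by simp
  obtain h G where h: "0 < h" and G: "G \<in> sets P" "prob (\<Omega> - G) < e"
    and osc: "\<And>w. w \<in> G \<Longrightarrow> osc_le (d / 2) h w"
    by (rule osc_small[OF \<open>0 < d / 2\<close> e(1)]) blast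
  \<comment> \<open>One half of \<open>d\<close> is for the distance of the points, the other for
    the oscillation. As \<open>path_dist\<close> contains the root of the time lag, the second bound
    yields \<open>\<bar>t - t'\<bar> < min h e\<close>.\<close>
  define \<delta> where "\<delta> = min (d / 2) (sqrt (min h e))"
  have \<delta>: "0 < \<delta>" using d h e by (simp add: \<delta>_def)
  show thesis
  proof (rule that[OF \<delta>])
    fix t \<omega> t' \<omega>' \<alpha> i assume z: "(t, \<omega>) \<in> S" "(t', \<omega>') \<in> S" and dist: "path_dist T (t, \<omega>) (t', \<omega>') < \<delta>" and \<alpha>: "\<alpha> \<in> CP"
    have "sqrt \<bar>t - t'\<bar> \<le> path_dist T (t, \<omega>) (t', \<omega>')"
      using z by (intro path_dist_time T_nonneg) auto
    also have "\<dots> < sqrt (min h e)" using dist by (simp add: \<delta>_def)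
    finally have tt: "\<bar>t - t'\<bar> < h" "\<bar>t - t'\<bar> < e" by auto
    have "\<bar>cost T W b f \<xi> t \<omega> \<alpha> $ i - cost T W b f \<xi> t' \<omega>' \<alpha> $ i\<bar> \<le> a * M\<^sub>1 + e / a * M\<^sub>2"
    proof (rule cost_diff_le[OF z \<alpha> G(1), where \<kappa>="d / 2"])
      show "osc_le (d / 2) \<bar>t - t'\<bar> w" if "w \<in> G" for w
        using osc_le_mono[OF osc[OF that]] tt(1) by simp
      show "\<rho> x \<le> e" if "0 \<le> x" "x \<le> path_dist T (t, \<omega>) (t', \<omega>') + d / 2" for x
      proof -
        have "\<rho> x < e" using that dist by (intro d(2)) (auto simp: \<delta>_def)
        then show ?thesis by simp
      qed
    qed (use G(2) e tt a in auto)
    then show "\<bar>cost T W b f \<xi> t \<omega> \<alpha> $ i - cost T W b f \<xi> t' \<omega>' \<alpha> $ i\<bar> \<le> \<kappa>"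
      using a(2) e2 by linarith
  qed
qed

end

section \<open>Measurability of the set values\<close>

context wiener_space
begin

text \<open>On the event \<open>\<tau> \<le> t\<close> the stopping time may be replaced by
  \<open>min \<tau> t\<close>, which is measurable for \<open>F t\<close>, so the path is evaluated
  at a measurable time not after \<open>t\<close>.\<close>

lemma stopped_coordinate_measurable:
  assumes \<tau>: "stopping_time F \<tau>" "\<And>\<omega>. \<omega> \<in> \<Omega> \<Longrightarrow> \<tau> \<omega> \<in> {0..T}" and q: "q \<in> {0..T}"
  shows "(\<lambda>\<omega>. \<omega> (min (\<tau> \<omega>) q)) \<in> borel_measurable (pre_sigma \<tau>)"
proof (rule measurableI)
  fix U :: "(real ^ 'd) set" assume U: "U \<in> sets borel"
  let ?V = "(\<lambda>\<omega>. \<omega> (min (\<tau> \<omega>) q)) -` U \<inter> space (pre_sigma \<tau>)"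
  show "?V \<in> sets (pre_sigma \<tau>)"
  proof (rule sets_pre_sigmaI[OF \<tau>(1)])
    fix t
    show "{\<omega> \<in> ?V. \<tau> \<omega> \<le> t} \<in> sets (F t)"
    proof (cases "0 \<le> t")
      case False
      have "\<not> \<tau> \<omega> \<le> t" if "\<omega> \<in> \<Omega>" for \<omega> using \<tau>(2)[OF that] False by simp
      then have "{\<omega> \<in> ?V. \<tau> \<omega> \<le> t} = {}" by (auto simp: space_pre_sigma)
      then show ?thesis by (simp only: sets.empty_sets)
    next
      case True
      \<comment> \<open>The filtration is indexed by all reals, whereas path evaluation needs a time
        in \<open>{0..T}\<close>.\<close>
      define v where "v = min t T"
      have v: "0 \<le> v" "v \<le> T" "v \<le> t" using True T_nonneg by (auto simp: v_def)
      have "(\<lambda>\<omega>. min (\<tau> \<omega>) t) \<in> borel_measurable (F t)"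
      proof (rule borel_measurableI_le)
        fix c
        show "{\<omega> \<in> space (F t). min (\<tau> \<omega>) t \<le> c} \<in> sets (F t)"
        proof (cases "c < t")
          case True
          then have "{\<omega> \<in> space (F t). min (\<tau> \<omega>) t \<le> c} = {\<omega> \<in> space (F t). \<tau> \<omega> \<le> c}"
            by (auto simp: min_le_iff_disj)
          then show ?thesis
            using stopping_time_le_const[OF \<tau>(1), of c t] True by (simp add: pred_def)
        next
          case False
          then have "{\<omega> \<in> space (F t). min (\<tau> \<omega>) t \<le> c} = space (F t)" by (auto simp: min_le_iff_disj)
          then show ?thesis by (metis sets.top)
        qed
      qed
      then have m: "(\<lambda>\<omega>. min (min (\<tau> \<omega>) t) q) \<in> borel_measurable (F t)" by measurable
      have "(\<lambda>\<omega>. \<omega> (min (min (\<tau> \<omega>) t) q)) \<in> borel_measurable (F t)"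
      proof (rule path_eval_measurable[OF _ v(1,2) m])
        show "(\<lambda>\<omega>. \<omega>) \<in> F t \<rightarrow>\<^sub>M F0 v"
          using measurable_F_mono[OF measurable_ident_F_raw v(3)] .
        show "min (min (\<tau> \<omega>) t) q \<in> {0..v}" if "\<omega> \<in> space (F t)" for \<omega>
          using \<tau>(2)[of \<omega>] that q True by (auto simp: v_def)
      qed
      then have 1: "(\<lambda>\<omega>. \<omega> (min (min (\<tau> \<omega>) t) q)) -` U \<inter> space (F t) \<in> sets (F t)"
        using U by (rule measurable_sets)
      have 2: "{\<omega> \<in> space (F t). \<tau> \<omega> \<le> t} \<in> sets (F t)"
        using stopping_timeD[OF \<tau>(1), of t] by (simp add: pred_def)
      have "{\<omega> \<in> ?V. \<tau> \<omega> \<le> t}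
          = ((\<lambda>\<omega>. \<omega> (min (min (\<tau> \<omega>) t) q)) -` U \<inter> space (F t)) \<inter> {\<omega> \<in> space (F t). \<tau> \<omega> \<le> t}"
        by (auto simp: space_pre_sigma min_absorb1)
      then show ?thesis using sets.Int[OF 1 2] by simp
    qed
  qed
qed simp

text \<open>A Lindelof argument by hand: \<open>I\<close> collects the countably many basic
  neighbourhoods on which \<open>Q\<close> holds throughout, with centres in the dense sequence and
  in \<open>Y\<close>. Measurability is then only asked of the distances to these centres.\<close>

lemma open_set_pullback_measurable:
  fixes Q :: "real \<Rightarrow> (real \<Rightarrow> real ^ 'd) \<Rightarrow> real ^ 'm \<Rightarrow> bool"
  assumes \<tau>: "stopping_time F \<tau>" "\<And>\<omega>. \<omega> \<in> \<Omega> \<Longrightarrow> \<tau> \<omega> \<in> {0..T}"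
    and \<eta>[measurable]: "\<eta> \<in> borel_measurable (pre_sigma \<tau>)"
    and op: "\<And>t \<omega> y. (t, \<omega>) \<in> S \<Longrightarrow> Q t \<omega> y \<Longrightarrow>
      \<exists>r>0. \<forall>t' \<omega>' y'. (t', \<omega>') \<in> S \<longrightarrow> path_dist T (t, \<omega>) (t', \<omega>') < r \<longrightarrow> norm (y - y') < r \<longrightarrow> Q t' \<omega>' y'"
  shows "{\<omega> \<in> \<Omega>. Q (\<tau> \<omega>) \<omega> (\<eta> \<omega>)} \<in> sets (pre_sigma \<tau>)"
proof -
  obtain x :: "nat \<Rightarrow> real \<times> (real \<Rightarrow> real ^ 'd)"
    where "\<forall>n. x n \<in> S" and "\<forall>z\<in>S. \<forall>e>0. \<exists>n. path_dist T z (x n) < e"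
    using path_separable by (elim exE conjE)
  then have x: "x n \<in> S" "z \<in> S \<Longrightarrow> 0 < e \<Longrightarrow> \<exists>n. path_dist T z (x n) < e" for n z e
    by auto
  obtain Y :: "(real ^ 'm) set" where Y: "countable Y" "\<And>y e. 0 < e \<Longrightarrow> \<exists>u\<in>Y. norm (u - y) < e"
    by (rule Rats_vec_dense) blast
  define near where "near = (\<lambda>(j, u :: real ^ 'm, k) t \<omega> y. path_dist T (t, \<omega>) (x j) < 1 / real (Suc k) \<and> norm (y - u) < 1 / real (Suc k))"
  define I where "I = {c \<in> (UNIV :: nat set) \<times> Y \<times> (UNIV :: nat set). \<forall>t \<omega> y. (t, \<omega>) \<in> S \<longrightarrow> near c t \<omega> y \<longrightarrow> Q t \<omega> y}"
  have I: "countable I"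
    using Y(1) by (intro countable_subset[of I "UNIV \<times> Y \<times> UNIV"] countable_SIGMA) (auto simp: I_def)
  have cover: "Q t \<omega> y \<longleftrightarrow> (\<exists>c\<in>I. near c t \<omega> y)" if z: "(t, \<omega>) \<in> S" for t \<omega> y
  proof
    assume "Q t \<omega> y"
    then obtain r where r: "0 < r" "\<And>t' \<omega>' y'. (t', \<omega>') \<in> S \<Longrightarrow> path_dist T (t, \<omega>) (t', \<omega>') < r \<Longrightarrow> norm (y - y') < r \<Longrightarrow> Q t' \<omega>' y'"
      using op[OF z] by blast
    \<comment> \<open>Two points of the same neighbourhood are less than two radii apart, hence a
      radius below \<open>r / 2\<close>.\<close>
    obtain k where k: "1 / real (Suc k) < r / 2" using reals_Archimedean[of "r / 2"] r(1) by (auto simp: inverse_eq_divide)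
    obtain j where j: "path_dist T (t, \<omega>) (x j) < 1 / real (Suc k)" using x(2)[OF z, of "1 / real (Suc k)"] by auto
    obtain u where u: "u \<in> Y" "norm (u - y) < 1 / real (Suc k)" using Y(2)[of "1 / real (Suc k)" y] by auto
    have "near (j, u, k) t \<omega> y" using j u by (simp add: near_def norm_minus_commute)
    moreover have "(j, u, k) \<in> I"
      unfolding I_def
    proof (intro CollectI conjI allI impI)
      fix t' \<omega>' y' assume z': "(t', \<omega>') \<in> S" and n: "near (j, u, k) t' \<omega>' y'"
      obtain s v where xj: "x j = (s, v)" by (cases "x j")
      have sv: "(s, v) \<in> S" using x(1)[of j] xj by simp
      have "path_dist T (t, \<omega>) (t', \<omega>') \<le> path_dist T (t, \<omega>) (s, v) + path_dist T (s, v) (t', \<omega>')"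
        using z z' sv by (intro path_dist_triangle T_nonneg) auto
      also have "\<dots> < r"
      proof -
        have "path_dist T (t, \<omega>) (s, v) < 1 / real (Suc k)" "path_dist T (s, v) (t', \<omega>') < 1 / real (Suc k)"
          using j n by (simp_all add: near_def xj path_dist_commute[OF T_nonneg, of "(s, v)" "(t', \<omega>')"])
        then show ?thesis using k by linarith
      qed
      finally have 1: "path_dist T (t, \<omega>) (t', \<omega>') < r" .
      have "norm (y - y') \<le> norm (y - u) + norm (u - y')"
        using norm_triangle_ineq[of "y - u" "u - y'"] by simp
      also have "\<dots> < r" using u n k by (simp add: near_def norm_minus_commute)
      finally show "Q t' \<omega>' y'" by (rule r(2)[OF z' 1])
    qed (use u in simp)
    ultimately show "\<exists>c\<in>I. near c t \<omega> y" by blast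
  next
    assume "\<exists>c\<in>I. near c t \<omega> y"
    then show "Q t \<omega> y" using z unfolding I_def by blast
  qed
  have \<tau>m[measurable]: "\<tau> \<in> borel_measurable (pre_sigma \<tau>)"
    by (rule measurable_stopping_time_pre_sigma[OF \<tau>(1)])
  have dist_m[measurable]: "(\<lambda>\<omega>. path_dist T (\<tau> \<omega>, \<omega>) (x j)) \<in> borel_measurable (pre_sigma \<tau>)" for j
  proof (rule path_dist_measurable[OF _ x(1) \<tau>m])
    show "(\<tau> \<omega>, \<omega>) \<in> S" if "\<omega> \<in> space (pre_sigma \<tau>)" for \<omega>
      using that \<tau>(2)[of \<omega>] by (simp add: space_pre_sigma)
    show "(\<lambda>\<omega>. \<omega> (min (\<tau> \<omega>) q)) \<in> borel_measurable (pre_sigma \<tau>)" if "q \<in> {0..T}" for q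
      by (rule stopped_coordinate_measurable[OF \<tau> that])
  qed
  have "{\<omega> \<in> space (pre_sigma \<tau>). near c (\<tau> \<omega>) \<omega> (\<eta> \<omega>)} \<in> sets (pre_sigma \<tau>)" for c
    unfolding near_def by (cases c) (simp, measurable)
  then have "(\<Union>c\<in>I. {\<omega> \<in> space (pre_sigma \<tau>). near c (\<tau> \<omega>) \<omega> (\<eta> \<omega>)}) \<in> sets (pre_sigma \<tau>)"
    using I by (intro sets.countable_UN') auto
  also have "(\<Union>c\<in>I. {\<omega> \<in> space (pre_sigma \<tau>). near c (\<tau> \<omega>) \<omega> (\<eta> \<omega>)}) = {\<omega> \<in> \<Omega>. Q (\<tau> \<omega>) \<omega> (\<eta> \<omega>)}"
    using cover \<tau>(2) by (auto simp: space_pre_sigma)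
  finally show ?thesis .
qed

end

section \<open>Set values under small perturbations\<close>

context game
begin

abbreviation "J \<equiv> cost T W b f \<xi>"

text \<open>The same control is kept at the nearby point. Its cost and that of a deviation each move
  by at most \<open>\<kappa>\<close>, and \<open>2 * \<kappa> \<le> e' - e\<close> turns the
  tolerance \<open>e\<close> into \<open>e'\<close>. Uniformity over controls is essential here, as
  one radius has to serve every deviation.\<close>

lemma approx_set_value_hat_open:
  assumes z: "(t, \<omega>) \<in> S" and y: "y \<in> approx_set_value_hat T W A b f \<xi> \<epsilon> t \<omega>"
  shows "\<exists>r>0. \<forall>t' \<omega>' y'. (t', \<omega>') \<in> S \<longrightarrow> path_dist T (t, \<omega>) (t', \<omega>') < r \<longrightarrow> norm (y - y') < r \<longrightarrow>
    y' \<in> approx_set_value_hat T W A b f \<xi> \<epsilon> t' \<omega>'"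
proof -
  obtain e \<alpha> where e: "0 < e" "e < \<epsilon>" and \<alpha>: "\<alpha> \<in> approx_equilibria T W A b f \<xi> e t \<omega>"
    and dist: "dist (J t \<omega> \<alpha>) y < e"
    using y by (auto simp: approx_set_value_hat_def approx_set_value_def)
  define e' where "e' = (e + \<epsilon>) / 2"
  have e': "0 < e'" "e < e'" "e' < \<epsilon>" using e by (auto simp: e'_def)
  define N where "N = real CARD('n)"
  have N: "1 \<le> N" by (simp add: N_def Suc_leI)
  \<comment> \<open>The number of players enters when the componentwise estimates are summed to
    bound the norm. Half of \<open>e' - e\<close> goes to the cost, the other half to
    \<open>y\<close>.\<close>
  define \<kappa> where "\<kappa> = (e' - e) / (2 * N)"
  have \<kappa>: "0 < \<kappa>" "2 * \<kappa> \<le> e' - e" "N * \<kappa> = (e' - e) / 2"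
  proof -
    show "0 < \<kappa>" "N * \<kappa> = (e' - e) / 2" using e' N by (auto simp: \<kappa>_def)
    have "(e' - e) / N \<le> (e' - e) / 1" using e' N by (intro divide_left_mono) auto
    moreover have "2 * (x / (2 * N)) = x / N" for x by simp
    ultimately show "2 * \<kappa> \<le> e' - e" unfolding \<kappa>_def by (simp only: div_by_1)
  qed
  obtain \<delta> where \<delta>: "0 < \<delta>"
    and cont: "\<And>t \<omega> t' \<omega>' \<alpha> i. (t, \<omega>) \<in> S \<Longrightarrow> (t', \<omega>') \<in> S \<Longrightarrow> path_dist T (t, \<omega>) (t', \<omega>') < \<delta> \<Longrightarrow> \<alpha> \<in> CP \<Longrightarrow>
      \<bar>J t \<omega> \<alpha> $ i - J t' \<omega>' \<alpha> $ i\<bar> \<le> \<kappa>"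
    by (rule cost_uniformly_continuous[OF \<kappa>(1)]) blast
  define r where "r = min \<delta> ((e' - e) / 2)"
  have r: "0 < r" using \<delta> e' by (simp add: r_def)
  have "y' \<in> approx_set_value_hat T W A b f \<xi> \<epsilon> t' \<omega>'"
    if z': "(t', \<omega>') \<in> S" and d: "path_dist T (t, \<omega>) (t', \<omega>') < r" and yy: "norm (y - y') < r" for t' \<omega>' y'
  proof -
    have d': "path_dist T (t, \<omega>) (t', \<omega>') < \<delta>" using d by (simp add: r_def)
    have \<alpha>CP: "\<alpha> \<in> CP" using \<alpha> by (simp add: approx_equilibria_def)
    have "\<alpha> \<in> approx_equilibria T W A b f \<xi> e' t' \<omega>'"
      unfolding approx_equilibria_def
    proof (intro CollectI conjI allI ballI \<alpha>CP)
      fix i \<beta> assume \<beta>: "\<beta> \<in> controls T W (A i)"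
      have "J t \<omega> \<alpha> $ i \<le> J t \<omega> (deviate \<alpha> i \<beta>) $ i + e"
        using \<alpha> \<beta> by (simp add: approx_equilibria_def)
      then show "J t' \<omega>' \<alpha> $ i \<le> J t' \<omega>' (deviate \<alpha> i \<beta>) $ i + e'"
        using cont[OF z z' d' \<alpha>CP, of i] cont[OF z z' d' deviate_control_profile[OF \<alpha>CP \<beta>], of i] \<kappa>(2) by linarith
    qed
    moreover have "dist (J t' \<omega>' \<alpha>) y' < e'"
    proof -
      have "norm (J t \<omega> \<alpha> - J t' \<omega>' \<alpha>) \<le> (\<Sum>i\<in>UNIV. \<bar>(J t \<omega> \<alpha> - J t' \<omega>' \<alpha>) $ i\<bar>)" by (rule norm_le_l1_cart)
      also have "\<dots> \<le> (\<Sum>i\<in>(UNIV :: 'n set). \<kappa>)" by (intro sum_mono) (simp add: cont[OF z z' d' \<alpha>CP])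
      also have "\<dots> = N * \<kappa>" by (simp add: N_def)
      finally have "dist (J t' \<omega>' \<alpha>) (J t \<omega> \<alpha>) \<le> (e' - e) / 2" using \<kappa>(3) by (simp add: dist_norm norm_minus_commute)
      moreover have "dist y y' < (e' - e) / 2" using yy by (simp add: dist_norm r_def)
      ultimately show ?thesis
        using dist dist_triangle[of "J t' \<omega>' \<alpha>" y' "J t \<omega> \<alpha>"] dist_triangle[of "J t \<omega> \<alpha>" y' y] by (simp add: field_simps)
    qed
    ultimately show ?thesis
      using e' unfolding approx_set_value_hat_def approx_set_value_def by (auto intro!: bexI[of _ e'] bexI[of _ \<alpha>])
  qed
  then show ?thesis using r by blast
qed

lemma approx_set_value_mono:
  assumes "e \<le> e'"
  shows "approx_set_value T W A b f \<xi> e t \<omega> \<subseteq> approx_set_value T W A b f \<xi> e' t \<omega>"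
proof
  fix y assume "y \<in> approx_set_value T W A b f \<xi> e t \<omega>"
  then obtain \<alpha> where \<alpha>: "\<alpha> \<in> approx_equilibria T W A b f \<xi> e t \<omega>" "dist (J t \<omega> \<alpha>) y < e"
    by (auto simp: approx_set_value_def)
  have "\<alpha> \<in> approx_equilibria T W A b f \<xi> e' t \<omega>"
    using \<alpha>(1) assms unfolding approx_equilibria_def by (auto intro: order_trans[OF _ add_left_mono])
  then show "y \<in> approx_set_value T W A b f \<xi> e' t \<omega>"
    using \<alpha>(2) assms unfolding approx_set_value_def by (intro UN_I[of \<alpha>]) auto
qed

text \<open>By monotonicity in the tolerance, the hat set at \<open>h\<close> lies between the sets
  without hat at \<open>h / 2\<close> and at \<open>h\<close>, so both families have the same
  intersection.\<close>

lemma set_value_eq: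
  "set_value T W A b f \<xi> t \<omega> = (\<Inter>n. approx_set_value_hat T W A b f \<xi> (1 / real (Suc n)) t \<omega>)"
proof (intro equalityI subsetI)
  fix y assume y: "y \<in> set_value T W A b f \<xi> t \<omega>"
  have "y \<in> approx_set_value_hat T W A b f \<xi> (1 / real (Suc n)) t \<omega>" for n
  proof -
    define h where "h = 1 / real (Suc n)"
    have "0 < h" by (simp add: h_def)
    then have "h / 2 \<in> {0<..<1 / real (Suc n)}" unfolding h_def[symmetric] by simp
    moreover have "y \<in> approx_set_value T W A b f \<xi> (h / 2) t \<omega>"
      using y \<open>0 < h\<close> unfolding set_value_def by simp
    ultimately show ?thesis unfolding approx_set_value_hat_def by blast
  qed
  then show "y \<in> (\<Inter>n. approx_set_value_hat T W A b f \<xi> (1 / real (Suc n)) t \<omega>)" by blast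
next
  fix y assume y: "y \<in> (\<Inter>n. approx_set_value_hat T W A b f \<xi> (1 / real (Suc n)) t \<omega>)"
  show "y \<in> set_value T W A b f \<xi> t \<omega>"
    unfolding set_value_def
  proof
    fix e :: real assume "e \<in> {0<..}"
    then obtain n where n: "1 / real (Suc n) < e" using reals_Archimedean[of e] by (auto simp: inverse_eq_divide)
    have "y \<in> approx_set_value_hat T W A b f \<xi> (1 / real (Suc n)) t \<omega>" using y by blast
    then obtain e' where "e' < 1 / real (Suc n)" "y \<in> approx_set_value T W A b f \<xi> e' t \<omega>"
      unfolding approx_set_value_hat_def by auto
    then show "y \<in> approx_set_value T W A b f \<xi> e t \<omega>"
      using n approx_set_value_mono[of e' e t \<omega>] by auto
  qed
qed

proposition set_values_measurable:
  assumes \<tau>: "stopping_time F \<tau>" "\<And>\<omega>. \<omega> \<in> \<Omega> \<Longrightarrow> \<tau> \<omega> \<in> {0..T}"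
    and \<eta>: "\<eta> \<in> borel_measurable (pre_sigma \<tau>)"
  shows "{\<omega> \<in> \<Omega>. \<eta> \<omega> \<in> approx_set_value_hat T W A b f \<xi> \<epsilon> (\<tau> \<omega>) \<omega>} \<in> sets (pre_sigma \<tau>)"
    and "{\<omega> \<in> \<Omega>. \<eta> \<omega> \<in> set_value T W A b f \<xi> (\<tau> \<omega>) \<omega>} \<in> sets (pre_sigma \<tau>)"
proof -
  have hat: "{\<omega> \<in> \<Omega>. \<eta> \<omega> \<in> approx_set_value_hat T W A b f \<xi> \<epsilon> (\<tau> \<omega>) \<omega>} \<in> sets (pre_sigma \<tau>)" for \<epsilon>
    by (rule open_set_pullback_measurable[OF \<tau> \<eta> approx_set_value_hat_open])
  then show "{\<omega> \<in> \<Omega>. \<eta> \<omega> \<in> approx_set_value_hat T W A b f \<xi> \<epsilon> (\<tau> \<omega>) \<omega>} \<in> sets (pre_sigma \<tau>)" .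
  have "{\<omega> \<in> \<Omega>. \<eta> \<omega> \<in> set_value T W A b f \<xi> (\<tau> \<omega>) \<omega>}
      = (\<Inter>n. {\<omega> \<in> \<Omega>. \<eta> \<omega> \<in> approx_set_value_hat T W A b f \<xi> (1 / real (Suc n)) (\<tau> \<omega>) \<omega>})"
    by (auto simp: set_value_eq)
  also have "\<dots> \<in> sets (pre_sigma \<tau>)" using hat by (intro sets.countable_INT) auto
  finally show "{\<omega> \<in> \<Omega>. \<eta> \<omega> \<in> set_value T W A b f \<xi> (\<tau> \<omega>) \<omega>} \<in> sets (pre_sigma \<tau>)" .
qed

end

theorem theorem3p8:
  fixes T \<epsilon> :: real
    and W :: "(real \<Rightarrow> real ^ 'd) measure"
    and A :: "'n::finite \<Rightarrow> 'e::euclidean_space set"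
    and b :: "real \<Rightarrow> (real \<Rightarrow> real ^ 'd) \<Rightarrow> 'e ^ 'n \<Rightarrow> real ^ 'd"
    and f :: "real \<Rightarrow> (real \<Rightarrow> real ^ 'd) \<Rightarrow> 'e ^ 'n \<Rightarrow> real ^ 'n"
    and \<xi> :: "(real \<Rightarrow> real ^ 'd) \<Rightarrow> real ^ 'n"
    and \<rho>\<^sub>0 :: "real \<Rightarrow> real"
    and \<tau> :: "(real \<Rightarrow> real ^ 'd) \<Rightarrow> real"
    and \<eta> :: "(real \<Rightarrow> real ^ 'd) \<Rightarrow> real ^ 'n"
  assumes "0 < T"
    and "wiener_measure T W"
    and "profiles A \<noteq> {}" and "convex (profiles A)"
    and "own_action_only T A f"
    and "prog_measurable_coeff T W (profiles A) b" and "bounded_coeff T (profiles A) b"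
    and "prog_measurable_coeff T W (profiles A) f" and "bounded_coeff T (profiles A) f"
    and "\<xi> \<in> borel_measurable (aug_filtration T W T)" and "bounded (\<xi> ` path_space T)"
    and "modulus_of_continuity \<rho>\<^sub>0"
    and "coeff_has_modulus T (profiles A) \<rho>\<^sub>0 b"
    and "coeff_has_modulus T (profiles A) \<rho>\<^sub>0 f"
    and "\<forall>\<omega>\<in>path_space T. \<forall>\<omega>'\<in>path_space T.
           norm (\<xi> \<omega> - \<xi> \<omega>') \<le> \<rho>\<^sub>0 (path_norm T (\<lambda>s. \<omega> s - \<omega>' s))"
    and "0 < \<epsilon>"
    and "stopping_time (aug_filtration T W) \<tau>" and "\<forall>\<omega>\<in>path_space T. \<tau> \<omega> \<in> {0..T}"
    and "\<eta> \<in> borel_measurable (stopped_algebra T W \<tau>)"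
  shows "{\<omega> \<in> path_space T. \<eta> \<omega> \<in> approx_set_value_hat T W A b f \<xi> \<epsilon> (\<tau> \<omega>) \<omega>}
           \<in> sets (stopped_algebra T W \<tau>) \<and>
         {\<omega> \<in> path_space T. \<eta> \<omega> \<in> set_value T W A b f \<xi> (\<tau> \<omega>) \<omega>}
           \<in> sets (stopped_algebra T W \<tau>)"
proof -
  obtain Cb where Cb: "\<forall>t\<in>{0..T}. \<forall>\<omega>\<in>path_space T. \<forall>a\<in>profiles A. norm (b t \<omega> a) \<le> Cb"
    using assms(7) unfolding bounded_coeff_def by blast
  obtain Cf where Cf: "\<forall>t\<in>{0..T}. \<forall>\<omega>\<in>path_space T. \<forall>a\<in>profiles A. norm (f t \<omega> a) \<le> Cf"
    using assms(9) unfolding bounded_coeff_def by blast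
  obtain Cx where Cx: "\<forall>\<omega>\<in>path_space T. norm (\<xi> \<omega>) \<le> Cx"
    using assms(11) unfolding bounded_iff by blast
  \<comment> \<open>The maximum with \<open>0\<close> provides the nonnegative common bound that the
    locale asks for.\<close>
  define C where "C = max 0 (max Cb (max Cf Cx))"
  have C: "0 \<le> C" "Cb \<le> C" "Cf \<le> C" "Cx \<le> C" by (auto simp: C_def)
  interpret game T W A b f \<xi> \<rho>\<^sub>0 C
  proof
    show "norm (b t \<omega> a) \<le> C" if "t \<in> {0..T}" "\<omega> \<in> path_space T" "a \<in> profiles A" for t \<omega> a
      using Cb that C(2) by (meson order_trans)
    show "norm (f t \<omega> a) \<le> C" if "t \<in> {0..T}" "\<omega> \<in> path_space T" "a \<in> profiles A" for t \<omega> a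
      using Cf that C(3) by (meson order_trans)
    show "norm (\<xi> \<omega>) \<le> C" if "\<omega> \<in> path_space T" for \<omega>
      using Cx that C(4) by (meson order_trans)
    show "norm (\<xi> \<omega> - \<xi> \<omega>') \<le> \<rho>\<^sub>0 (path_norm T (\<lambda>s. \<omega> s - \<omega>' s))"
      if "\<omega> \<in> path_space T" "\<omega>' \<in> path_space T" for \<omega> \<omega>'
      using assms(15) that by blast
  qed (use assms C(1) in simp_all)
  show ?thesis
    using set_values_measurable[OF assms(17) _ assms(19)] assms(18) by blast
qed

end
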